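(* Let $\phi$ be a supercritical solution to the steady Whitham equation tending to zero at infinity. Starting at a point $\lambda=-N$, where $N>0$, such that $\Sigma_\lambda^-$ is empty for all $\lambda\le -N$, and moving the plane $x=\lambda$ to the right as long as $$\phi(x)\ge\phi_\lambda(x)\qquad\text{for all } x\in\Sigma_\lambda,$$ this process stops only and finally at some point $x=\lambda_0$, where $\phi=\phi_{\lambda_0}$ on $\Sigma_{\lambda_0}$. In particular, $\phi$ is symmetric about $\lambda_0$ and (exponentially) decreasing on the half-line $[\lambda_0,\infty)$.
   Context: The Fourier transform is $\mathcal{F}(f)(\xi)=\int_{\mathbb{R}}f(x)e^{-ix\xi}\,dx$, extended to tempered distributions. Put $m(\xi)=\left(\frac{\tanh\xi}{\xi}\right)^{1/2}$ (with $m(0)=1$) and $K=\mathcal{F}^{-1}(m)\in L_1(\mathbb{R})$. A solution to the steady Whitham equation with wave speed $c$ is a real-valued, continuous, bounded function $\phi:\mathbb{R}\to\mathbb{R}$ satisfying $-c\phi+\phi^2+K*\phi=0$ pointwise on $\mathbb{R}$. It is called supercritical if $c>1$; in that case the equation is rewritten as $\phi(c-\phi)=H_c*\phi^2$ with $H_c=\mathcal{F}^{-1}\left(\frac{m}{c-m}\right)$. "Tending to zero at infinity" means $\phi(x)\to 0$ as $|x|\to\infty$. For $\lambda\in\mathbb{R}$, $\phi_\lambda(x)=\phi(2\lambda-x)$ denotes the reflection of $\phi$ about the axis $x=\lambda$, $\Sigma_\lambda=\{x\in\mathbb{R}: x>\lambda\}$ and $\Sigma_\lambda^-=\{x\in\Sigma_\lambda:\phi(x)<\phi_\lambda(x)\}$.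 Symmetric about $\lambda_0$ means $\phi(x)=\phi(2\lambda_0-x)$ for all $x\in\mathbb{R}$. The parenthetical "(exponentially)" refers to exponential decay of $\phi$ at infinity.
   Formalization: The solution φ is additionally assumed not to be identically zero; for φ = 0, which is a supercritical solution tending to zero, Σ_λ^- is empty for every λ, so the process never stops and the claim as worded fails. *)

theory Defs
  imports "HOL-Analysis.Analysis"
begin

definition fourier :: "(real \<Rightarrow> complex) \<Rightarrow> real \<Rightarrow> complex" where
  "fourier f \<xi> = (LINT x|lborel. f x * exp (- (\<i> * complex_of_real (x * \<xi>))))"

definition whitham_symbol :: "real \<Rightarrow> real" where
  "whitham_symbol \<xi> = (if \<xi> = 0 then 1 else sqrt (tanh \<xi> / \<xi>))"

text \<open>
  The Whitham kernel is the inverse Fourier transform of the symbol, an element of the space of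
  (classes of) integrable functions. The symbol itself is not integrable, so the inverse transform
  is not an absolutely convergent integral; for an integrable \<open>K\<close>, being the inverse transform
  in the sense of tempered distributions means that the Fourier integral of \<open>K\<close> is the symbol
  (everywhere, since both sides are continuous). The predicate thus holds exactly of the
  real-valued Borel representatives of the kernel, which agree almost everywhere; convolutions do
  not depend on the choice.
\<close>
definition whitham_kernel :: "(real \<Rightarrow> real) \<Rightarrow> bool" where
  "whitham_kernel K \<longleftrightarrow>
     integrable lborel K \<and>
     (\<forall>\<xi>. fourier (\<lambda>x. complex_of_real (K x)) \<xi> = complex_of_real (whitham_symbol \<xi>))"

definition convolution :: "(real \<Rightarrow> real) \<Rightarrow> (real \<Rightarrow> real) \<Rightarrow> real \<Rightarrow> real" where
  "convolution f g x = (LINT y|lborel. f (x - y) * g y)"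

definition steady_whitham_solution :: "(real \<Rightarrow> real) \<Rightarrow> real \<Rightarrow> (real \<Rightarrow> real) \<Rightarrow> bool" where
  "steady_whitham_solution K c \<phi> \<longleftrightarrow>
     continuous_on UNIV \<phi> \<and> bounded (range \<phi>) \<and>
     (\<forall>x. - c * \<phi> x + (\<phi> x)\<^sup>2 + convolution K \<phi> x = 0)"

definition supercritical_solution :: "(real \<Rightarrow> real) \<Rightarrow> real \<Rightarrow> (real \<Rightarrow> real) \<Rightarrow> bool" where
  "supercritical_solution K c \<phi> \<longleftrightarrow> steady_whitham_solution K c \<phi> \<and> c > 1"

definition reflection :: "real \<Rightarrow> (real \<Rightarrow> real) \<Rightarrow> real \<Rightarrow> real" where
  "reflection l \<phi> x = \<phi> (2 * l - x)"

definition Sigma_half :: "real \<Rightarrow> real set" where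
  "Sigma_half l = {x. x > l}"

definition Sigma_minus :: "(real \<Rightarrow> real) \<Rightarrow> real \<Rightarrow> real set" where
  "Sigma_minus \<phi> l = {x \<in> Sigma_half l. \<phi> x < reflection l \<phi> x}"

definition symmetric_about :: "(real \<Rightarrow> real) \<Rightarrow> real \<Rightarrow> bool" where
  "symmetric_about \<phi> l \<longleftrightarrow> (\<forall>x. \<phi> x = \<phi> (2 * l - x))"

definition starting_point :: "(real \<Rightarrow> real) \<Rightarrow> real \<Rightarrow> bool" where
  "starting_point \<phi> N \<longleftrightarrow> N > 0 \<and> (\<forall>l \<le> - N. Sigma_minus \<phi> l = {})"

text \<open>
  The positions to which the plane can be moved to the right from \<open>s\<close> while the reflection
  inequality holds at every position passed, the end position included.
\<close>
definition reachable :: "(real \<Rightarrow> real) \<Rightarrow> real \<Rightarrow> real set" where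
  "reachable \<phi> s =
     {l. s \<le> l \<and> (\<forall>l' \<in> {s..l}. \<forall>x \<in> Sigma_half l'. \<phi> x \<ge> reflection l' \<phi> x)}"

definition decays_exponentially :: "(real \<Rightarrow> real) \<Rightarrow> bool" where
  "decays_exponentially \<phi> \<longleftrightarrow> (\<exists>\<eta>>0. \<exists>C. \<forall>x. \<bar>\<phi> x\<bar> \<le> C * exp (- \<eta> * \<bar>x\<bar>))"

end

theory Submission
  imports Defs "HOL-Complex_Analysis.Complex_Analysis" "HOL-Probability.Probability"
begin

text \<open>
  Everything rests on a Stieltjes representation of the symbol. The function \<open>sqrt (tanh z / z)\<close> is
  holomorphic in the right half-plane, and Cauchy's formula, pushed to the imaginary axis, gives
  \<open>m(\<xi>) = \<integral> \<rho>(s) 2\<bar>s\<bar> / (s\<^sup>2 + \<xi>\<^sup>2) ds\<close> with a density \<open>\<rho> \<ge> 0\<close> supported in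
  \<open>\<bar>s\<bar> \<ge> \<pi>/2\<close>. Hence the kernel is the superposition \<open>K(x) = \<integral> \<rho>(s) exp (- \<bar>s\<bar>\<bar>x\<bar>) ds\<close>: positive, even,
  strictly decreasing in \<open>\<bar>x\<bar>\<close> and exponentially decaying.

  Write the equation as \<open>\<phi> (c - \<phi>) = K * \<phi>\<close>. Then
  \<open>(\<phi>\<^sub>\<lambda> - \<phi>) (c - \<phi> - \<phi>\<^sub>\<lambda>) = K * (\<phi>\<^sub>\<lambda> - \<phi>)\<close>, and the monotonicity of \<open>K\<close> turns this into a maximum
  principle on \<open>\<Sigma>\<^sub>\<lambda>\<close>: at a positive maximum of \<open>\<phi>\<^sub>\<lambda> - \<phi>\<close> at distance \<open>d\<close> from the plane,
  \<open>c - \<phi> - \<phi>\<^sub>\<lambda>\<close> is at most the integral of \<open>K\<close> over \<open>[-d, d]\<close>. Being at most \<open>1 < c\<close>, this starts the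
  plane; tending to \<open>0\<close> with \<open>d\<close>, it moves the plane past every \<open>\<lambda>\<close> with
  \<open>\<phi> \<noteq> \<phi>\<^sub>\<lambda>\<close> unless \<open>\<phi>(\<lambda>) = c/2\<close>.

  In that degenerate case (take \<open>\<lambda> = 0\<close>) put \<open>f(t) = \<phi>(t) - \<phi>(-t)\<close> and \<open>s(t) = c - \<phi>(t) - \<phi>(-t)\<close>, so
  that \<open>f s = K * f\<close> and \<open>(s\<^sup>2 + f\<^sup>2) / 2 = (K * s)(t) - (K * s)(0)\<close>. As \<open>K\<close> behaves like
  \<open>\<bar>x\<bar> powr (-1/2)\<close> near \<open>0\<close>, the second identity yields \<open>f, s \<le> C sqrt t\<close>, and with
  \<open>K * f \<ge> \<delta> t\<close> the first one yields \<open>f \<ge> \<epsilon> sqrt t\<close>. But then \<open>K * f\<close> is of order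
  \<open>t log (1/t)\<close>, which contradicts \<open>K * f = f s \<le> C\<^sup>2 t\<close>.
\<close>

section \<open>The Stieltjes representation of the symbol\<close>

text \<open>The definition of the kernel gives only its Fourier transform, and the symbol is not
  integrable, so pointwise facts come by a detour: the Stieltjes integral is inverted exponential by
  exponential, and the resulting \<open>wkernel\<close> is identified almost everywhere with any
  given kernel through the uniqueness of characteristic functions. The obstacle is that no
  hypothesis keeps \<phi> below \<open>c / 2\<close>. Near a plane through a point of that height
  both sides of the maximum principle may tend to 0: the factor vanishes together with the kernel
  mass of a short interval, and a finer balance has to decide. No expansion of the kernel at 0
  enters this balance. The upper estimates use only
  \<open>wkernel x \<le> 2 / sqrt \<bar>x\<bar>\<close>, and the logarithm appears as the divergence
  of the integral of \<open>wkernel_slope y * sqrt y\<close> over (0, 1), which goes back to the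
  fact that \<open>sqrt (tanh \<xi>)\<close> does not tend to 0 at infinity.\<close>

lemma Re_sinh: "Re (sinh z) = sinh (Re z) * cos (Im z)"
  and Im_sinh: "Im (sinh z) = cosh (Re z) * sin (Im z)"
  and Re_cosh: "Re (cosh z) = cosh (Re z) * cos (Im z)"
  and Im_cosh: "Im (cosh z) = sinh (Re z) * sin (Im z)"
  by (simp_all add: sinh_def cosh_def scaleR_conv_of_real Re_exp Im_exp algebra_simps)

lemma norm_sinh_squared: "(norm (sinh z))\<^sup>2 = (sinh (Re z))\<^sup>2 + (sin (Im z))\<^sup>2"
proof -
  have "(norm (sinh z))\<^sup>2 = (sinh (Re z))\<^sup>2 * (cos (Im z))\<^sup>2 + (1 + (sinh (Re z))\<^sup>2) * (sin (Im z))\<^sup>2"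
    by (simp add: cmod_power2 Re_sinh Im_sinh power_mult_distrib cosh_square_eq add.commute)
  also have "\<dots> = (sinh (Re z))\<^sup>2 * ((sin (Im z))\<^sup>2 + (cos (Im z))\<^sup>2) + (sin (Im z))\<^sup>2"
    by (simp only: algebra_simps)
  finally show ?thesis by simp
qed

lemma norm_cosh_squared: "(norm (cosh z))\<^sup>2 = (sinh (Re z))\<^sup>2 + (cos (Im z))\<^sup>2"
proof -
  have "(norm (cosh z))\<^sup>2 = (1 + (sinh (Re z))\<^sup>2) * (cos (Im z))\<^sup>2 + (sinh (Re z))\<^sup>2 * (sin (Im z))\<^sup>2"
    by (simp add: cmod_power2 Re_cosh Im_cosh power_mult_distrib cosh_square_eq add.commute)
  also have "\<dots> = (sinh (Re z))\<^sup>2 * ((sin (Im z))\<^sup>2 + (cos (Im z))\<^sup>2) + (cos (Im z))\<^sup>2"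
    by (simp only: algebra_simps)
  finally show ?thesis by simp
qed

lemma cosh_complex_nonzero: "Re z > 0 \<Longrightarrow> cosh z \<noteq> 0"
  using norm_cosh_squared[of z]
  by (metis norm_zero power_zero_numeral sinh_real_zero_iff sum_power2_eq_zero_iff less_irrefl)

lemma tanh_complex_eq:
  "tanh z = Complex (sinh (Re z) * cosh (Re z)) (sin (Im z) * cos (Im z)) / of_real ((norm (cosh z))\<^sup>2)"
proof -
  have "sinh z * cnj (cosh z) = Complex (sinh (Re z) * cosh (Re z)) (sin (Im z) * cos (Im z))"
  proof (rule complex_eqI)
    have "Re (sinh z * cnj (cosh z)) = sinh (Re z) * cosh (Re z) * ((sin (Im z))\<^sup>2 + (cos (Im z))\<^sup>2)"
      unfolding power2_eq_square by (simp add: Re_sinh Im_sinh Re_cosh Im_cosh algebra_simps del: sin_cos_squared_add3)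
    then show "Re (sinh z * cnj (cosh z)) = Re (Complex (sinh (Re z) * cosh (Re z)) (sin (Im z) * cos (Im z)))"
      by simp
    have "Im (sinh z * cnj (cosh z)) = sin (Im z) * cos (Im z) * ((cosh (Re z))\<^sup>2 - (sinh (Re z))\<^sup>2)"
      unfolding power2_eq_square by (simp add: Re_sinh Im_sinh Re_cosh Im_cosh algebra_simps)
    then show "Im (sinh z * cnj (cosh z)) = Im (Complex (sinh (Re z) * cosh (Re z)) (sin (Im z) * cos (Im z)))"
      by (simp add: cosh_square_eq)
  qed
  then show ?thesis
    unfolding tanh_def by (metis complex_div_cnj of_real_power)
qed

text \<open>The bound is uniform in \<open>Re z\<close>, so it survives the limit to the imaginary
  axis, where \<open>tanh\<close> has poles at the zeros of \<open>cos (Im z)\<close>; under the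
  root in \<open>csym\<close> they leave only integrable singularities.\<close>

lemma norm_tanh_times_cos_le:
  assumes "Re z > 0"
  shows "norm (tanh z) * \<bar>cos (Im z)\<bar> \<le> 1"
proof -
  define a b where "a = (sinh (Re z))\<^sup>2" and "b = (cos (Im z))\<^sup>2"
  have a: "a > 0" using assms by (simp add: a_def)
  have b: "0 \<le> b" "b \<le> 1"
    by (auto simp: b_def abs_square_le_1)
  have eq: "(norm (tanh z) * \<bar>cos (Im z)\<bar>)\<^sup>2 = (a + (1 - b)) / (a + b) * b"
    by (simp add: tanh_def norm_divide power_divide power_mult_distrib norm_sinh_squared
        norm_cosh_squared a_def b_def sin_squared_eq)
  have "0 \<le> a * (1 - b)" "0 \<le> b * b"
    using a b by auto
  moreover have "(a + (1 - b)) * b = a + b - (a * (1 - b) + b * b)"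
    by (simp add: algebra_simps)
  ultimately have "(a + (1 - b)) * b \<le> a + b"
    by linarith
  then have "(a + (1 - b)) / (a + b) * b \<le> 1"
    using a b by (simp add: pos_divide_le_eq)
  with eq have "(norm (tanh z) * \<bar>cos (Im z)\<bar>)\<^sup>2 \<le> 1\<^sup>2" by simp
  then show ?thesis by (rule power2_le_imp_le) simp
qed

text \<open>For the far vertical side of the rectangle, where \<open>cos (Im z)\<close> may vanish
  but \<open>sinh (Re z)\<close> is at least 1.\<close>

lemma norm_tanh_le_2:
  assumes "Re z \<ge> 1"
  shows "norm (tanh z) \<le> 2"
proof -
  define a b where "a = (sinh (Re z))\<^sup>2" and "b = (cos (Im z))\<^sup>2"
  have "1 \<le> sinh (Re z)"
    using assms sinh_real_less_iff[of 0 "Re z"] real_le_x_sinh[of "Re z"]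
    by (simp add: sinh_def exp_minus)
  then have a: "a \<ge> 1" by (simp add: a_def one_le_power)
  have b: "0 \<le> b" "b \<le> 1"
    by (auto simp: b_def abs_square_le_1)
  have eq: "(norm (tanh z))\<^sup>2 = (a + (1 - b)) / (a + b)"
    by (simp add: tanh_def norm_divide power_divide norm_sinh_squared
        norm_cosh_squared a_def b_def sin_squared_eq)
  have "(a + (1 - b)) / (a + b) \<le> 4"
    using a b by (simp add: divide_le_eq)
  with eq have "(norm (tanh z))\<^sup>2 \<le> 2\<^sup>2" by simp
  then show ?thesis by (rule power2_le_imp_le) simp
qed

text \<open>The symbol in the right half-plane, where \<open>tanh z / z\<close> avoids the branch cut of the root.\<close>

definition csym :: "complex \<Rightarrow> complex" where
  "csym z = csqrt (tanh z / z)"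

text \<open>Both \<open>z\<close> and \<open>tanh z\<close> have positive real part, so neither is a
  nonpositive real multiple of the other.\<close>

lemma tanh_over_id_not_nonpos:
  assumes "Re z > 0"
  shows "tanh z / z \<notin> \<real>\<^sub>\<le>\<^sub>0"
proof
  assume "tanh z / z \<in> \<real>\<^sub>\<le>\<^sub>0"
  then obtain r where r: "r \<le> 0" "tanh z / z = of_real r"
    by (metis nonpos_Reals_cases)
  have "z \<noteq> 0" using assms by auto
  then have "tanh z = of_real r * z" using r by (simp add: field_simps)
  then have "Re (tanh z) = r * Re z" by simp
  also have "\<dots> \<le> 0" using r assms by (simp add: mult_nonpos_nonneg)
  finally have "Re (tanh z) \<le> 0" .
  moreover have "Re (tanh z) > 0"
    using assms cosh_complex_nonzero[OF assms] by (subst tanh_complex_eq) (simp)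
  ultimately show False by simp
qed

lemma holomorphic_csym: "csym holomorphic_on {z. Re z > 0}"
  unfolding csym_def
  unfolding tanh_def sinh_def cosh_def
  by (intro holomorphic_on_csqrt' holomorphic_intros)
     (use tanh_over_id_not_nonpos cosh_complex_nonzero in \<open>auto simp: tanh_def sinh_def cosh_def\<close>)

text \<open>For z = x + iy the sign is that of
  \<open>(x * (sin y * cos y) - y * (sinh x * cosh x)) * y\<close>, and
  \<open>\<bar>sin y * cos y\<bar> < \<bar>y\<bar>\<close> while
  \<open>sinh x * cosh x \<ge> x\<close>.\<close>

lemma Im_tanh_over_id:
  assumes "Re z > 0" "Im z \<noteq> 0"
  shows "Im (tanh z / z) * Im z < 0"
proof -
  define x y where "x = Re z" and "y = Im z"
  have x: "x > 0" and y: "y \<noteq> 0" using assms by (auto simp: x_def y_def)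
  have "x * (sin y * cos y) * y < x * y * y"
  proof -
    have "sin y * cos y * y < y * y"
    proof -
      have "\<bar>sin y * cos y\<bar> < \<bar>y\<bar>"
      proof (cases "\<bar>cos y\<bar> = 1")
        case True
        then have "sin y = 0" by (metis abs_1 power2_abs power_one sin_cos_squared_add add_cancel_right_left power_eq_0_iff zero_eq_power2 add_right_cancel)
        then show ?thesis using y by simp
      next
        case False
        then have "\<bar>cos y\<bar> < 1" using abs_cos_le_one[of y] by linarith
        then have "\<bar>y\<bar> * \<bar>cos y\<bar> < \<bar>y\<bar>" using y by simp
        moreover have "\<bar>sin y\<bar> * \<bar>cos y\<bar> \<le> \<bar>y\<bar> * \<bar>cos y\<bar>"
          by (intro mult_right_mono abs_sin_x_le_abs_x) simp
        ultimately show ?thesis by (simp add: abs_mult)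
      qed
      then have "\<bar>sin y * cos y\<bar> * \<bar>y\<bar> < \<bar>y\<bar> * \<bar>y\<bar>"
        using y by (intro mult_strict_right_mono) auto
      then show ?thesis by (metis abs_ge_self abs_mult abs_mult_self_eq le_less_trans)
    qed
    then show ?thesis using x by (simp add: mult.assoc)
  qed
  moreover have "y * y * (sinh x * cosh x) \<ge> y * y * x"
  proof -
    have "sinh (2*x) \<ge> 2 * x" using x real_le_x_sinh[of "2*x"] by (simp add: sinh_def exp_minus)
    then show ?thesis by (simp add: sinh_double mult_left_mono)
  qed
  ultimately have *: "(x * (sin y * cos y) - y * (sinh x * cosh x)) * y < 0"
    by (simp add: algebra_simps)
  define d where "d = (norm (cosh z))\<^sup>2 * (norm z)\<^sup>2"
  have "z \<noteq> 0" using assms by auto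
  then have d: "d > 0" using assms cosh_complex_nonzero[of z] by (simp add: d_def)
  have "Im (tanh z / z) = (x * (sin y * cos y) - y * (sinh x * cosh x)) / d"
    unfolding complex_div_cnj[of "tanh z" z]
    by (subst tanh_complex_eq)
      (simp add: d_def x_def y_def Im_divide_of_real Re_divide_of_real field_simps del: of_real_power)
  then have "Im (tanh z / z) * y = (x * (sin y * cos y) - y * (sinh x * cosh x)) * y / d" by simp
  with * d show ?thesis by (simp add: y_def divide_neg_pos)
qed

section \<open>Integrability of the majorant on the imaginary axis\<close>

lemma set_integrable_lborel_nonneg:
  fixes f :: "real \<Rightarrow> real"
  assumes "f \<in> borel_measurable borel" "A \<in> sets borel" "\<And>x. x \<in> A \<Longrightarrow> 0 \<le> f x" "f integrable_on A"
  shows "set_integrable lborel A f"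
proof -
  have "f absolutely_integrable_on A"
    using assms by (intro nonnegative_absolutely_integrable_1) auto
  then have "integrable lebesgue (\<lambda>x. indicator A x *\<^sub>R f x)"
    by (simp add: set_integrable_def)
  then show ?thesis
    unfolding set_integrable_def
    using assms(1,2) by (subst integrable_completion[symmetric]) auto
qed

lemma half_le_abs_sin:
  assumes "\<bar>t\<bar> \<le> pi / 2"
  shows "\<bar>t\<bar> / 2 \<le> \<bar>sin t\<bar>"
proof -
  have "(\<Sum>m<3. sin_coeff m * t ^ m) = t"
    by (simp add: numeral_3_eq_3 sin_coeff_def)
  then have "\<bar>sin t - t\<bar> \<le> inverse (fact 3) * \<bar>t\<bar> ^ 3"
    using Maclaurin_sin_bound[of t 3] by simp
  also have "\<dots> = \<bar>t\<bar> * (\<bar>t\<bar>\<^sup>2 / 6)"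
    by (simp add: fact_numeral power3_eq_cube power2_eq_square)
  also have "\<dots> \<le> \<bar>t\<bar> * (1 / 2)"
  proof -
    \<comment> \<open>Since 1.7 squared is below 3, the cubic Taylor error
      \<open>\<bar>t\<bar> ^ 3 / 6\<close> is at most half of \<open>\<bar>t\<bar>\<close>.\<close>
    have "pi / 2 \<le> 1.7" using pi_approx by simp
    then have "\<bar>t\<bar> \<le> 1.7" using assms by linarith
    then have "\<bar>t\<bar>\<^sup>2 \<le> 1.7\<^sup>2" by (intro power_mono) auto
    then have "\<bar>t\<bar>\<^sup>2 / 6 \<le> 1 / 2" by (simp add: power2_eq_square)
    then show ?thesis by (intro mult_left_mono) auto
  qed
  finally show ?thesis by linarith
qed

lemma set_integrable_inverse_sqrt:
  "set_integrable lborel {-a..a} (\<lambda>t::real. 1 / sqrt \<bar>t\<bar>)"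
proof (cases "a \<ge> 0")
  case True
  have "(\<lambda>t. t powr (-(1/2))) integrable_on {0..a}"
    using True by (intro integrable_on_powr_from_0) auto
  then have "(\<lambda>t. 1 / sqrt \<bar>t\<bar>) integrable_on {0..a}"
    by (rule integrable_eq) (simp add: powr_minus_divide powr_half_sqrt)
  then have *: "set_integrable lborel {0..a} (\<lambda>t. 1 / sqrt \<bar>t\<bar>)"
    by (intro set_integrable_lborel_nonneg) auto
  have "integrable lborel (\<lambda>t. indicator {0..a} (- t) *\<^sub>R (1 / sqrt \<bar>- t\<bar>))"
    using * lborel_integrable_real_affine[of "\<lambda>t. indicator {0..a} t *\<^sub>R (1 / sqrt \<bar>t\<bar>)" "-1" 0]
    unfolding set_integrable_def by simp
  also have "(\<lambda>t. indicator {0..a} (- t) *\<^sub>R (1 / sqrt \<bar>- t\<bar>)) = (\<lambda>t. indicator {-a..0} t *\<^sub>R (1 / sqrt \<bar>t\<bar>))"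
    by (rule ext) (auto simp: indicator_def)
  finally have "set_integrable lborel {-a..0} (\<lambda>t. 1 / sqrt \<bar>t\<bar>)"
    by (simp add: set_integrable_def)
  with * have "set_integrable lborel ({-a..0} \<union> {0..a}) (\<lambda>t. 1 / sqrt \<bar>t\<bar>)"
    by (intro set_integrable_Un) auto
  also have "{-a..0} \<union> {0..a} = {-a..a}" using True by auto
  finally show ?thesis .
qed (simp add: set_integrable_def)

text \<open>Each period of \<open>\<bar>cos s\<bar>\<close> contains one zero, at
  \<open>(n + 1/2) * pi\<close>. Translated to 0, the singularity is bounded by
  \<open>2 / sqrt \<bar>t\<bar>\<close>, which is the same for every \<open>n\<close>.\<close>

lemma nn_integral_inverse_sqrt_cos_period:
  "\<exists>C<\<infinity>. \<forall>n::nat. (\<integral>\<^sup>+s. ennreal (indicator {real n * pi..<(real n + 1) * pi} s / sqrt \<bar>cos s\<bar>) \<partial>lborel) \<le> C"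
proof (intro exI conjI allI)
  let ?g = "\<lambda>t. indicator {-pi/2..pi/2} t * (2 * (1 / sqrt \<bar>t\<bar>))"
  have "set_integrable lborel {-pi/2..pi/2} (\<lambda>t. 2 * (1 / sqrt \<bar>t\<bar>))"
    using set_integrable_inverse_sqrt[of "pi/2"] by (intro set_integrable_mult_right) auto
  then have "integrable lborel ?g" by (simp add: set_integrable_def)
  then show "(\<integral>\<^sup>+t. ennreal (?g t) \<partial>lborel) < \<infinity>"
    by (subst nn_integral_eq_integral) (auto intro!: AE_I2)
  fix n :: nat
  define h where "h = (\<lambda>s. indicator {real n * pi..<(real n + 1) * pi} s / sqrt \<bar>cos s\<bar>)"
  have [measurable]: "h \<in> borel_measurable borel" unfolding h_def by measurable
  have "(\<integral>\<^sup>+s. ennreal (h s) \<partial>lborel) = (\<integral>\<^sup>+t. ennreal (h ((real n + 1/2) * pi + 1 * t)) \<partial>lborel)"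
    by (subst nn_integral_real_affine[where c=1 and t="(real n + 1/2) * pi"]) auto
  also have "\<dots> \<le> (\<integral>\<^sup>+t. ennreal (?g t) \<partial>lborel)"
  proof (intro nn_integral_mono ennreal_leI)
    fix t :: real
    show "h ((real n + 1/2) * pi + 1 * t) \<le> ?g t"
    proof (cases "t \<in> {-pi/2..<pi/2}")
      case True
      have "\<bar>cos ((real n + 1/2) * pi + 1 * t)\<bar> = \<bar>sin t\<bar>"
        by (simp add: cos_add distrib_right sin_add abs_mult)
      moreover have "1 / sqrt \<bar>sin t\<bar> \<le> 2 * (1 / sqrt \<bar>t\<bar>)"
      proof (cases "t = 0")
        case False
        \<comment> \<open>The weaker constant 1/4 is a square.\<close>
        have "\<bar>t\<bar> / 4 \<le> \<bar>sin t\<bar>"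
          using half_le_abs_sin[of t] True by force
        then have "sqrt (\<bar>t\<bar> / 4) \<le> sqrt \<bar>sin t\<bar>" by simp
        then have "sqrt \<bar>t\<bar> / 2 \<le> sqrt \<bar>sin t\<bar>" by (simp add: real_sqrt_divide)
        moreover have "0 < sqrt \<bar>t\<bar> / 2" using False by simp
        ultimately have "1 / sqrt \<bar>sin t\<bar> \<le> 1 / (sqrt \<bar>t\<bar> / 2)" by (intro frac_le) auto
        then show ?thesis by simp
      qed simp
      ultimately show ?thesis using True by (auto simp: h_def indicator_def algebra_simps)
    next
      case False
      define u where "u = (real n + 1/2) * pi + 1 * t"
      have "u \<notin> {real n * pi..<(real n + 1) * pi}"
        using False by (auto simp: u_def algebra_simps)
      then have "h u = 0" by (simp add: h_def)
      then have "h ((real n + 1/2) * pi + 1 * t) = 0" by (simp only: u_def)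
      then show ?thesis by (simp add: indicator_def)
    qed
  qed
  finally show "(\<integral>\<^sup>+s. ennreal (h s) \<partial>lborel) \<le> (\<integral>\<^sup>+t. ennreal (?g t) \<partial>lborel)" .
qed

text \<open>The n-th period starts at \<open>n * pi \<ge> n\<close>, so it contributes at most a
  constant times \<open>real (Suc n) powr (-3/2)\<close>, which is summable. Evenness gives the
  negative half-line.\<close>

lemma integrable_inverse_sqrt_cos:
  "integrable lborel (\<lambda>s::real. 1 / sqrt \<bar>cos s\<bar> * (1 + \<bar>s\<bar>) powr (-3/2))"
proof -
  obtain C where C: "C < \<infinity>"
    "\<And>n. (\<integral>\<^sup>+s. ennreal (indicator {real n * pi..<(real n + 1) * pi} s / sqrt \<bar>cos s\<bar>) \<partial>lborel) \<le> C"
    using nn_integral_inverse_sqrt_cos_period by blast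
  define f where "f = (\<lambda>s::real. indicator {0..} s * (1 / sqrt \<bar>cos s\<bar> * (1 + \<bar>s\<bar>) powr (-3/2)))"
  have [measurable]: "f \<in> borel_measurable borel" unfolding f_def by measurable
  define J where "J = (\<lambda>n::nat. {real n * pi..<(real n + 1) * pi})"
  define g where "g = (\<lambda>(n::nat) s. indicator (J n) s / sqrt \<bar>cos s\<bar>)"
  have [measurable]: "g n \<in> borel_measurable borel" for n unfolding g_def J_def by measurable
  have "(\<integral>\<^sup>+s. ennreal (f s) \<partial>lborel) \<le> (\<integral>\<^sup>+s. (\<Sum>n. ennreal (real (Suc n) powr (-3/2)) * ennreal (g n s)) \<partial>lborel)"
  proof (intro nn_integral_mono)
    fix s :: real
    show "ennreal (f s) \<le> (\<Sum>n. ennreal (real (Suc n) powr (-3/2)) * ennreal (g n s))"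
    proof (cases "s \<ge> 0")
      case True
      define n where "n = nat \<lfloor>s / pi\<rfloor>"
      have n: "real n = of_int \<lfloor>s / pi\<rfloor>" using True by (simp add: n_def)
      have "real n \<le> s / pi" "s / pi < real n + 1"
        unfolding n by linarith+
      then have s: "real n * pi \<le> s" "s < (real n + 1) * pi"
        by (auto simp: field_simps)
      then have "s \<in> J n" by (simp add: J_def)
      have "real n * 1 \<le> real n * pi" using pi_ge_two by (intro mult_left_mono) auto
      then have "(1 + \<bar>s\<bar>) powr (-3/2) \<le> real (Suc n) powr (-3/2)"
        using s by (intro powr_mono2') auto
      then have "f s \<le> real (Suc n) powr (-3/2) * g n s"
        using \<open>s \<in> J n\<close> True by (simp add: f_def g_def divide_right_mono)
      then have "ennreal (f s) \<le> ennreal (real (Suc n) powr (-3/2)) * ennreal (g n s)"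
        by (subst ennreal_mult[symmetric]) (auto simp: g_def ennreal_leI)
      also have "\<dots> = (\<Sum>n\<in>{n}. ennreal (real (Suc n) powr (-3/2)) * ennreal (g n s))" by simp
      also have "\<dots> \<le> (\<Sum>n. ennreal (real (Suc n) powr (-3/2)) * ennreal (g n s))"
        by (intro sum_le_suminf) auto
      finally show ?thesis .
    qed (simp add: f_def)
  qed
  also have "\<dots> = (\<Sum>n. ennreal (real (Suc n) powr (-3/2)) * (\<integral>\<^sup>+s. ennreal (g n s) \<partial>lborel))"
    by (subst nn_integral_suminf) (auto simp: nn_integral_cmult)
  also have "\<dots> \<le> (\<Sum>n. ennreal (real (Suc n) powr (-3/2)) * C)"
    using C(2) by (intro suminf_le mult_left_mono) (auto simp: g_def J_def)
  also have "\<dots> = (\<Sum>n. ennreal (real (Suc n) powr (-3/2))) * C"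
    by simp
  also have "\<dots> < \<infinity>"
  proof -
    have "summable (\<lambda>n. real n powr (-3/2))" by (subst summable_real_powr_iff) auto
    then have "summable (\<lambda>n. real (Suc n) powr (-3/2))" by (subst summable_Suc_iff)
    then have "(\<Sum>n. ennreal (real (Suc n) powr (-3/2))) < \<infinity>"
      by (subst suminf_ennreal2) auto
    with C(1) show ?thesis by (simp add: ennreal_mult_less_top)
  qed
  finally have f: "integrable lborel f"
    by (intro integrableI_nonneg) (auto simp: f_def)
  then have "integrable lborel (\<lambda>s. f (0 + (-1) * s))"
    by (intro lborel_integrable_real_affine) auto
  with f have "integrable lborel (\<lambda>s. f s + f (0 + (-1) * s))" by (rule Bochner_Integration.integrable_add)
  then show ?thesis
  proof (rule Bochner_Integration.integrable_bound)
    show "AE s in lborel. norm (1 / sqrt \<bar>cos s\<bar> * (1 + \<bar>s\<bar>) powr (-3/2)) \<le> norm (f s + f (0 + (-1) * s))"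
    proof (intro AE_I2)
      fix s :: real
      have *: "0 \<le> 1 / sqrt \<bar>cos s\<bar> * (1 + \<bar>s\<bar>) powr (-3/2)" by simp
      have "f s \<ge> 0" "f (-s) \<ge> 0" by (simp_all add: f_def)
      moreover have "f \<bar>s\<bar> = 1 / sqrt \<bar>cos s\<bar> * (1 + \<bar>s\<bar>) powr (-3/2)" by (simp add: f_def)
      ultimately show "norm (1 / sqrt \<bar>cos s\<bar> * (1 + \<bar>s\<bar>) powr (-3/2)) \<le> norm (f s + f (0 + (-1) * s))"
        using * by (cases "s \<ge> 0") (simp_all add: abs_of_nonneg del: times_divide_eq_left)
    qed
  qed simp
qed

section \<open>Cauchy's formula on a growing rectangle\<close>

lemma norm_csym: "norm (csym z) = sqrt (norm (tanh z) / norm z)"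
  by (simp add: csym_def norm_divide)

lemma norm_add_of_real_ge:
  assumes "Re z \<ge> 0" "\<xi> \<ge> 0"
  shows "norm z \<le> norm (z + of_real \<xi>)"
  using assms by (simp add: cmod_def power_mono)

text \<open>
  The Cauchy kernel is \<open>1 / (z - \<xi>) + 1 / (z + \<xi>)\<close>: the second summand contributes nothing to the
  contour integral, but makes the kernel purely imaginary on the imaginary axis, so that the real part
  of the limiting integrand lives where \<open>tan s / s < 0\<close>.
\<close>

definition cauchy_csym :: "real \<Rightarrow> complex \<Rightarrow> complex" where
  "cauchy_csym \<xi> z = csym z * (2 * z) / (z + of_real \<xi>) / (z - of_real \<xi>)"

text \<open>The bound is of order \<open>R powr (-3/2)\<close>; multiplied by the length of the
  three far sides, at most \<open>4 * R\<close>, it still tends to 0.\<close>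

lemma norm_cauchy_csym_le:
  assumes "0 < \<xi>" "\<xi> < R" "Re z > 0" "norm z \<ge> R" "norm (tanh z) \<le> 2"
  shows "norm (cauchy_csym \<xi> z) \<le> sqrt (2 / R) * 2 / (R - \<xi>)"
proof -
  have z: "norm z > 0" using assms by linarith
  have zp: "norm z \<le> norm (z + of_real \<xi>)"
    using assms by (intro norm_add_of_real_ge) auto
  have zm: "R - \<xi> \<le> norm (z - of_real \<xi>)"
    using norm_triangle_ineq2[of z "of_real \<xi>"] assms by simp
  have "norm (csym z) \<le> sqrt (2 / R)"
    unfolding norm_csym using assms z by (intro real_sqrt_le_mono frac_le) auto
  moreover have "2 * norm z / norm (z + of_real \<xi>) \<le> 2"
    using z zp by (simp add: divide_le_eq)
  ultimately have "norm (csym z) * (2 * norm z / norm (z + of_real \<xi>)) \<le> sqrt (2 / R) * 2"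
    using assms by (intro mult_mono) auto
  then have "norm (csym z) * (2 * norm z / norm (z + of_real \<xi>)) / norm (z - of_real \<xi>) \<le> sqrt (2 / R) * 2 / (R - \<xi>)"
    using zm assms by (intro frac_le) auto
  then show ?thesis
    by (simp add: cauchy_csym_def norm_divide norm_mult)
qed

lemma continuous_on_cauchy_csym:
  assumes "\<xi> > 0" "S \<subseteq> {z. Re z > 0} - {of_real \<xi>}"
  shows "continuous_on S (cauchy_csym \<xi>)"
proof -
  have "continuous_on S csym"
    using holomorphic_csym assms(2)
    by (intro holomorphic_on_imp_continuous_on holomorphic_on_subset[OF holomorphic_csym]) auto
  moreover have "z + of_real \<xi> \<noteq> 0" if "z \<in> S" for z
    using assms that by (auto simp: complex_eq_iff)
  ultimately show ?thesis
    unfolding cauchy_csym_def using assms(2) by (intro continuous_intros) auto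
qed

text \<open>The height \<open>n \<pi>\<close> of the rectangle makes \<open>\<bar>tanh z\<bar> \<le> 1\<close> on its horizontal sides.\<close>

lemma csym_cauchy_estimate:
  assumes "0 < \<epsilon>" "\<epsilon> < \<xi>" "\<xi> < real n * pi" "n \<ge> 1"
  defines "R \<equiv> real n * pi"
  shows "norm (2 * pi * csym (of_real \<xi>) + integral {-R..R} (\<lambda>s. cauchy_csym \<xi> (Complex \<epsilon> s)))
           \<le> 4 * R * (sqrt (2 / R) * 2 / (R - \<xi>))"
proof -
  define a1 a2 a3 a4 where "a1 = Complex \<epsilon> (-R)" and "a2 = Complex R (-R)" and "a3 = Complex R R" and "a4 = Complex \<epsilon> R"
  define f where "f = cauchy_csym \<xi>"
  define B where "B = sqrt (2 / R) * 2 / (R - \<xi>)"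
  have \<xi>: "\<xi> > 0" and R: "R > \<xi>" "R > 0" using assms by auto
  have "1 * 1 \<le> real n * pi" using assms pi_ge_two by (intro mult_mono) auto
  then have R1: "R \<ge> 1" by (simp add: R_def)
  have B: "B \<ge> 0" using R by (simp add: B_def)
  have box: "of_real \<xi> \<in> box a1 a3"
    using assms R by (auto simp: in_box_complex_iff a1_def a3_def)
  \<comment> \<open>In the right half-plane only the pole at \<xi> remains. There the factor
    \<open>2 * w / (w + of_real \<xi>)\<close> is 1, so the residue is the value of the
    symbol.\<close>
  have "((\<lambda>w. (csym w * (2 * w) / (w + of_real \<xi>)) / (w - of_real \<xi>)) has_contour_integral
      (2*pi * \<i> * winding_number (rectpath a1 a3) (of_real \<xi>) *
        (csym (of_real \<xi>) * (2 * of_real \<xi>) / (of_real \<xi> + of_real \<xi>)))) (rectpath a1 a3)"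
  proof (rule Cauchy_integral_formula_convex_simple[where S = "{z. Re z > 0}"])
    show "convex {z. Re z > 0}" by (rule convex_halfspace_Re_gt)
    have "w + of_real \<xi> \<noteq> 0" if "Re w > 0" for w
      using \<xi> that by (auto simp: complex_eq_iff)
    then show "(\<lambda>w. csym w * (2 * w) / (w + of_real \<xi>)) holomorphic_on {z. Re z > 0}"
      by (intro holomorphic_intros holomorphic_csym) auto
    show "of_real \<xi> \<in> interior {z. Re z > 0}"
      using \<xi> open_halfspace_Re_gt[of 0] by (simp add: interior_open)
    show "path_image (rectpath a1 a3) \<subseteq> {z. 0 < Re z} - {complex_of_real \<xi>}"
      using assms R by (auto simp: path_image_rectpath a1_def a3_def)
  qed auto
  then have "(f has_contour_integral (2*pi * \<i> * csym (of_real \<xi>))) (rectpath a1 a3)"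
    using winding_number_rectpath[OF box] \<xi> by (simp add: f_def cauchy_csym_def[abs_def])
  then have eq: "2*pi * \<i> * csym (of_real \<xi>) = contour_integral (rectpath a1 a3) f"
    by (simp add: contour_integral_unique)
  have sub: "closed_segment a1 a2 \<subseteq> {z. Re z > 0 \<and> Im z = -R}"
    "closed_segment a2 a3 \<subseteq> {z. Re z = R}"
    "closed_segment a3 a4 \<subseteq> {z. Re z > 0 \<and> Im z = R}"
    "closed_segment a4 a1 \<subseteq> {z. Re z = \<epsilon>}"
    using assms R by (auto simp: a1_def a2_def a3_def a4_def closed_segment_same_Re closed_segment_same_Im closed_segment_eq_real_ivl)
  have cont: "continuous_on (closed_segment a1 a2) f" "continuous_on (closed_segment a2 a3) f"
     "continuous_on (closed_segment a3 a4) f" "continuous_on (closed_segment a4 a1) f"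
    unfolding f_def using sub R \<xi> assms
    by (auto intro!: continuous_on_cauchy_csym)
  note int = cont[THEN contour_integrable_continuous_linepath]
  have a24: "Complex (Re a3) (Im a1) = a2" "Complex (Re a1) (Im a3) = a4"
    by (simp_all add: a1_def a2_def a3_def a4_def)
  have sum: "contour_integral (rectpath a1 a3) f =
      contour_integral (linepath a1 a2) f + contour_integral (linepath a2 a3) f +
      contour_integral (linepath a3 a4) f + contour_integral (linepath a4 a1) f"
    unfolding rectpath_def Let_def a24 using int by (simp add: contour_integrable_joinI)
  have left: "contour_integral (linepath a4 a1) f = - (\<i> * integral {-R..R} (\<lambda>s. f (Complex \<epsilon> s)))"
    using R contour_integral_linepath_same_Re[of a1 \<epsilon> a4 "-R" R f] contour_integral_reverse_linepath[of a4 a1 f] cont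
    by (simp add: a1_def a4_def)
  have bound: "norm (f z) \<le> B" if "Re z > 0" "Re z = R \<or> \<bar>Im z\<bar> = R" for z
    unfolding f_def B_def
  proof (rule norm_cauchy_csym_le)
    show "R \<le> norm z"
      using that abs_Re_le_cmod[of z] abs_Im_le_cmod[of z] by auto
    show "norm (tanh z) \<le> 2"
    proof (cases "Re z = R")
      case True
      then show ?thesis using R1 norm_tanh_le_2[of z] by simp
    next
      case False
      then have "cos (Im z) = cos (real n * pi)"
        using that R_def by (metis cos_abs_real)
      then have "\<bar>cos (Im z)\<bar> = 1" by simp
      then show ?thesis using norm_tanh_times_cos_le[of z] that by simp
    qed
  qed (use that R \<xi> in auto)
  have "norm (contour_integral (linepath a1 a2) f) \<le> B * norm (a2 - a1)"
    using int(1) B sub(1) R by (intro contour_integral_bound_linepath bound) auto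
  moreover have "norm (contour_integral (linepath a2 a3) f) \<le> B * norm (a3 - a2)"
    using int(2) B sub(2) R by (intro contour_integral_bound_linepath bound) auto
  moreover have "norm (contour_integral (linepath a3 a4) f) \<le> B * norm (a4 - a3)"
    using int(3) B sub(3) R by (intro contour_integral_bound_linepath bound) auto
  moreover have "norm (a2 - a1) \<le> R" "norm (a3 - a2) \<le> 2 * R" "norm (a4 - a3) \<le> R"
  proof -
    have "a2 - a1 = of_real (R - \<epsilon>)" "a3 - a2 = of_real (2 * R) * \<i>" "a4 - a3 = of_real (\<epsilon> - R)"
      by (simp_all add: a1_def a2_def a3_def a4_def complex_eq_iff)
    then have "norm (a2 - a1) = \<bar>R - \<epsilon>\<bar>" "norm (a3 - a2) = \<bar>2 * R\<bar>" "norm (a4 - a3) = \<bar>\<epsilon> - R\<bar>"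
      by (simp_all only: norm_mult norm_of_real norm_ii mult_1_right)
    then show "norm (a2 - a1) \<le> R" "norm (a3 - a2) \<le> 2 * R" "norm (a4 - a3) \<le> R"
      using assms R by auto
  qed
  ultimately have le: "norm (contour_integral (linepath a1 a2) f) \<le> B * R"
      "norm (contour_integral (linepath a2 a3) f) \<le> B * (2 * R)"
      "norm (contour_integral (linepath a3 a4) f) \<le> B * R"
    using B by (meson mult_left_mono order_trans)+
  \<comment> \<open>The left side is traversed downwards, so its integral joins the residue with a
    plus sign; the common factor \<open>\<i>\<close> does not affect the norm.\<close>
  have "\<i> * (2 * pi * csym (of_real \<xi>) + integral {-R..R} (\<lambda>s. f (Complex \<epsilon> s))) =
      contour_integral (linepath a1 a2) f + contour_integral (linepath a2 a3) f + contour_integral (linepath a3 a4) f"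
    using eq sum left by (simp add: algebra_simps)
  then have "norm (2 * pi * csym (of_real \<xi>) + integral {-R..R} (\<lambda>s. f (Complex \<epsilon> s))) =
      norm (contour_integral (linepath a1 a2) f + contour_integral (linepath a2 a3) f + contour_integral (linepath a3 a4) f)"
    by (metis norm_mult norm_ii mult_1)
  also have "\<dots> \<le> B * R + B * (2 * R) + B * R"
    using le by (intro norm_triangle_mono) auto
  finally show ?thesis by (simp add: f_def B_def)
qed

text \<open>On the imaginary axis \<open>tanh z / z\<close> reaches the cut; the side is decided by \<open>Im_tanh_over_id\<close>.\<close>

lemma csqrt_tendsto_below:
  assumes "(f \<longlongrightarrow> of_real r) F" "r < 0" "\<forall>\<^sub>F x in F. Im (f x) < 0"
  shows "((\<lambda>x. csqrt (f x)) \<longlongrightarrow> - \<i> * of_real (sqrt (- r))) F"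
proof -
  \<comment> \<open>\<open>csqrt\<close> jumps at the negative number \<open>of_real r\<close> but
    is continuous at its opposite; below the cut it equals
    \<open>- \<i> * csqrt (- f x)\<close>.\<close>
  have "((\<lambda>x. - \<i> * csqrt (- f x)) \<longlongrightarrow> - \<i> * csqrt (- of_real r)) F"
    using assms(2) by (intro tendsto_intros assms(1) tendsto_compose[OF _ tendsto_minus[OF assms(1)]] isContD continuous_at_csqrt)
      (auto simp: complex_nonpos_Reals_iff)
  moreover have "\<forall>\<^sub>F x in F. - \<i> * csqrt (- f x) = csqrt (f x)"
    using assms(3) by eventually_elim (simp add: csqrt_minus)
  moreover have "csqrt (- of_real r) = of_real (sqrt (- r))"
    using assms(2) by (simp flip: of_real_minus)
  ultimately show ?thesis by (simp add: tendsto_cong)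
qed

lemma csqrt_tendsto_above:
  assumes "(f \<longlongrightarrow> of_real r) F" "r < 0" "\<forall>\<^sub>F x in F. Im (f x) > 0"
  shows "((\<lambda>x. csqrt (f x)) \<longlongrightarrow> \<i> * of_real (sqrt (- r))) F"
proof -
  have "((\<lambda>x. \<i> * csqrt (- f x)) \<longlongrightarrow> \<i> * csqrt (- of_real r)) F"
    using assms(2) by (intro tendsto_intros assms(1) tendsto_compose[OF _ tendsto_minus[OF assms(1)]] isContD continuous_at_csqrt)
      (auto simp: complex_nonpos_Reals_iff)
  moreover have "\<forall>\<^sub>F x in F. \<i> * csqrt (- f x) = csqrt (f x)"
    using assms(3)
  proof eventually_elim
    case (elim x)
    then show ?case using csqrt_minus[of "- f x"] by simp
  qed
  moreover have "csqrt (- of_real r) = of_real (sqrt (- r))"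
    using assms(2) by (simp flip: of_real_minus)
  ultimately show ?thesis by (simp add: tendsto_cong)
qed

text \<open>On the imaginary axis \<open>tanh z / z\<close> becomes \<open>tan s / s\<close>. Where
  this is negative its root is imaginary and survives in the real part of Cauchy's formula, whose
  constant is \<open>2 * pi\<close>. At 0 and at the poles of \<open>tan\<close>, division by zero
  makes the density 0.\<close>

definition stieltjes_density :: "real \<Rightarrow> real" ("\<rho>") where
  "\<rho> s = (if tan s / s < 0 then sqrt (- (tan s / s)) / (2 * pi) else 0)"

text \<open>The limit \<open>- (\<i> * of_real q)\<close> of the rational factor is imaginary, so a
  real root of \<open>tan s / s\<close> contributes nothing. An imaginary root has the sign opposite
  to that of \<open>s\<close>, by \<open>Im_tanh_over_id\<close>; this cancels the sign of
  \<open>q\<close> and leaves \<open>\<bar>s\<bar>\<close>.\<close>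

lemma Re_cauchy_csym_tendsto:
  assumes \<xi>: "\<xi> > 0" and s: "sin s \<noteq> 0" "cos s \<noteq> 0"
    and \<epsilon>: "\<epsilon> \<longlonglongrightarrow> 0" "\<And>n::nat. \<epsilon> n > 0"
  shows "(\<lambda>n. Re (cauchy_csym \<xi> (Complex (\<epsilon> n) s))) \<longlonglongrightarrow>
           - (2 * pi) * (\<rho> s * (2 * \<bar>s\<bar> / (s\<^sup>2 + \<xi>\<^sup>2)))"
proof -
  define T where "T = (\<lambda>n. tanh (Complex (\<epsilon> n) s) / Complex (\<epsilon> n) s)"
  define r where "r = tan s / s"
  define q where "q = 2 * s / (s\<^sup>2 + \<xi>\<^sup>2)"
  have s0: "s \<noteq> 0" using s by auto
  have r0: "r \<noteq> 0" using s s0 by (simp add: r_def tan_def)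
  have z: "(\<lambda>n. Complex (\<epsilon> n) s) \<longlonglongrightarrow> Complex 0 s"
    using \<epsilon> by (intro tendsto_intros)
  have cosh0: "cosh (Complex 0 s) \<noteq> 0"
    using s by (simp add: complex_eq_iff Re_cosh)
  have Z0: "Complex 0 s \<noteq> 0" using s0 by (simp add: complex_eq_iff)
  have "(norm (cosh (Complex 0 s)))\<^sup>2 = (cos s)\<^sup>2" by (simp add: norm_cosh_squared)
  then have "tanh (Complex 0 s) = Complex 0 (tan s)"
    using s by (subst tanh_complex_eq) (simp add: complex_eq_iff Re_divide_of_real Im_divide_of_real tan_def power2_eq_square)
  then have "tanh (Complex 0 s) / Complex 0 s = of_real r"
  proof -
    assume "tanh (Complex 0 s) = Complex 0 (tan s)"
    also have "\<dots> = of_real r * Complex 0 s"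
      using s0 by (simp add: r_def complex_eq_iff)
    finally show ?thesis using Z0 by simp
  qed
  then have T: "T \<longlonglongrightarrow> of_real r"
    unfolding T_def using tendsto_divide[OF tendsto_tanh[OF z cosh0] z Z0] by simp
  have "(\<lambda>n. 2 * Complex (\<epsilon> n) s / (Complex (\<epsilon> n) s + of_real \<xi>) / (Complex (\<epsilon> n) s - of_real \<xi>))
      \<longlonglongrightarrow> 2 * Complex 0 s / (Complex 0 s + of_real \<xi>) / (Complex 0 s - of_real \<xi>)"
    using s0 by (intro tendsto_intros z) (auto simp: complex_eq_iff)
  also have "2 * Complex 0 s / (Complex 0 s + of_real \<xi>) / (Complex 0 s - of_real \<xi>) = - (\<i> * of_real q)"
  proof -
    have "(Complex 0 s + of_real \<xi>) * (Complex 0 s - of_real \<xi>) = - of_real (s\<^sup>2 + \<xi>\<^sup>2)"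
      by (simp add: complex_eq_iff power2_eq_square)
    moreover have "2 * Complex 0 s = of_real (2 * s) * \<i>" by (simp add: complex_eq_iff)
    ultimately show ?thesis
      unfolding divide_divide_eq_left by (simp add: q_def flip: of_real_power of_real_add)
  qed
  finally have Q: "(\<lambda>n. 2 * Complex (\<epsilon> n) s / (Complex (\<epsilon> n) s + of_real \<xi>) / (Complex (\<epsilon> n) s - of_real \<xi>))
      \<longlonglongrightarrow> - (\<i> * of_real q)" .
  have main: "(\<lambda>n. Re (cauchy_csym \<xi> (Complex (\<epsilon> n) s))) \<longlonglongrightarrow> Re (w * (- (\<i> * of_real q)))"
    if "(\<lambda>n. csqrt (T n)) \<longlonglongrightarrow> w" for w
  proof -
    have "cauchy_csym \<xi> (Complex (\<epsilon> n) s) = csqrt (T n) *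
        (2 * Complex (\<epsilon> n) s / (Complex (\<epsilon> n) s + of_real \<xi>) / (Complex (\<epsilon> n) s - of_real \<xi>))" for n
      by (simp add: cauchy_csym_def csym_def T_def)
    then show ?thesis using that Q by (simp only:) (intro tendsto_intros)
  qed
  have sign: "Im (T n) * s < 0" for n
    using Im_tanh_over_id[of "Complex (\<epsilon> n) s"] \<epsilon>(2)[of n] s0 by (simp add: T_def)
  consider "r > 0" | "r < 0" "s > 0" | "r < 0" "s < 0"
    using r0 s0 by linarith
  then show ?thesis
  proof cases
    case 1
    have "(\<lambda>n. csqrt (T n)) \<longlonglongrightarrow> csqrt (of_real r)"
      using 1 by (intro tendsto_compose[OF _ T] isContD continuous_at_csqrt)
        (auto simp: complex_nonpos_Reals_iff)
    from main[OF this] 1 show ?thesis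
      by (simp add: stieltjes_density_def r_def[symmetric])
  next
    case 2
    have "\<forall>\<^sub>F n in sequentially. Im (T n) < 0"
      using sign 2 by (intro always_eventually) (metis mult_less_0_iff less_asym)
    from main[OF csqrt_tendsto_below[OF T 2(1) this]] 2 show ?thesis
      by (simp add: stieltjes_density_def r_def[symmetric] q_def mult_ac)
  next
    case 3
    have "\<forall>\<^sub>F n in sequentially. Im (T n) > 0"
      using sign 3 by (intro always_eventually) (metis mult_less_0_iff less_asym)
    from main[OF csqrt_tendsto_above[OF T 3(1) this]] 3 show ?thesis
      by (simp add: stieltjes_density_def r_def[symmetric] q_def mult_ac)
  qed
qed

text \<open>The root reduces \<open>2 * norm z\<close> to \<open>2 * sqrt (norm z)\<close>, at most
  \<open>2 * sqrt (norm (z + of_real \<xi>))\<close>, so three half powers of distances remain in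
  the denominator. The right-hand side is free of \<open>\<epsilon>\<close>, as dominated
  convergence requires.\<close>

lemma norm_cauchy_csym_bound:
  assumes \<xi>: "\<xi> > 0" and \<epsilon>: "0 < \<epsilon>" "\<epsilon> \<le> \<xi> / 2" and s: "cos s \<noteq> 0"
  defines "\<kappa> \<equiv> (\<xi> / 2) / (1 + \<xi> / 2)"
  shows "norm (cauchy_csym \<xi> (Complex \<epsilon> s)) \<le>
           2 * \<kappa> powr (-3/2) * (1 / sqrt \<bar>cos s\<bar> * (1 + \<bar>s\<bar>) powr (-3/2))"
proof -
  define z where "z = Complex \<epsilon> s"
  \<comment> \<open>Both distances, to \<xi> and to its negative, are at least
    \<open>max (\<xi> / 2) \<bar>s\<bar>\<close>. The value of \<kappa> makes \<open>A\<close> touch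
    this maximum from below at \<open>\<bar>s\<bar> = \<xi> / 2\<close>.\<close>
  define A where "A = \<kappa> * (1 + \<bar>s\<bar>)"
  have \<kappa>: "\<kappa> > 0" using \<xi> by (simp add: \<kappa>_def)
  have A: "A > 0" using \<kappa> by (simp add: A_def add_pos_nonneg)
  have z0: "norm z > 0" using \<epsilon> by (simp add: z_def complex_eq_iff)
  have "A \<le> max (\<xi> / 2) \<bar>s\<bar>"
  proof (cases "\<bar>s\<bar> \<le> \<xi> / 2")
    case True
    then have "A \<le> \<kappa> * (1 + \<xi> / 2)" unfolding A_def using \<kappa> by (intro mult_left_mono) auto
    also have "\<dots> = \<xi> / 2"
      using \<xi> nonzero_eq_divide_eq[of "1 + \<xi> / 2" \<kappa> "\<xi> / 2"] by (simp add: \<kappa>_def)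
    finally show ?thesis by simp
  next
    case False
    then have "\<kappa> \<le> \<bar>s\<bar> / (1 + \<bar>s\<bar>)"
      using \<xi> by (simp add: \<kappa>_def field_simps)
    then have "A \<le> \<bar>s\<bar> / (1 + \<bar>s\<bar>) * (1 + \<bar>s\<bar>)" unfolding A_def by (intro mult_right_mono) auto
    then show ?thesis by simp
  qed
  moreover have "\<xi> / 2 \<le> norm (z - of_real \<xi>)" "\<bar>s\<bar> \<le> norm (z - of_real \<xi>)"
    "\<xi> / 2 \<le> norm (z + of_real \<xi>)" "\<bar>s\<bar> \<le> norm (z + of_real \<xi>)"
    using abs_Re_le_cmod[of "z - of_real \<xi>"] abs_Im_le_cmod[of "z - of_real \<xi>"]
      abs_Re_le_cmod[of "z + of_real \<xi>"] abs_Im_le_cmod[of "z + of_real \<xi>"] \<epsilon> \<xi>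
    by (auto simp: z_def)
  ultimately have Am: "A \<le> norm (z - of_real \<xi>)" and Ap: "A \<le> norm (z + of_real \<xi>)"
    by linarith+
  have zp: "norm z \<le> norm (z + of_real \<xi>)"
    using \<epsilon> \<xi> by (intro norm_add_of_real_ge) (auto simp: z_def)
  have "norm (csym z) * (2 * norm z) = sqrt (norm (tanh z)) * (2 * (norm z / sqrt (norm z)))"
    by (simp add: norm_csym real_sqrt_divide)
  also have "norm z / sqrt (norm z) = sqrt (norm z)" using z0 by (simp add: real_div_sqrt)
  also have "sqrt (norm (tanh z)) * (2 * sqrt (norm z)) \<le> (1 / sqrt \<bar>cos s\<bar>) * (2 * sqrt (norm (z + of_real \<xi>)))"
  proof (intro mult_mono)
    have "norm (tanh z) * \<bar>cos s\<bar> \<le> 1" using norm_tanh_times_cos_le[of z] \<epsilon> by (simp add: z_def)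
    then have "sqrt (norm (tanh z) * \<bar>cos s\<bar>) \<le> sqrt 1" by (rule real_sqrt_le_mono)
    then show "sqrt (norm (tanh z)) \<le> 1 / sqrt \<bar>cos s\<bar>"
      using s by (simp add: real_sqrt_mult pos_le_divide_eq)
  qed (use zp in auto)
  finally have 1: "norm (csym z) * (2 * norm z) \<le> (1 / sqrt \<bar>cos s\<bar>) * (2 * sqrt (norm (z + of_real \<xi>)))" .
  have "norm (cauchy_csym \<xi> z) = norm (csym z) * (2 * norm z) / norm (z + of_real \<xi>) / norm (z - of_real \<xi>)"
    by (simp add: cauchy_csym_def norm_divide norm_mult)
  also have "\<dots> \<le> (1 / sqrt \<bar>cos s\<bar>) * (2 * sqrt (norm (z + of_real \<xi>))) / norm (z + of_real \<xi>) / norm (z - of_real \<xi>)"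
    using 1 by (intro divide_right_mono) auto
  also have "\<dots> = (2 / sqrt \<bar>cos s\<bar>) * (1 / sqrt (norm (z + of_real \<xi>))) / norm (z - of_real \<xi>)"
  proof -
    have "sqrt (norm (z + of_real \<xi>)) / norm (z + of_real \<xi>) = 1 / sqrt (norm (z + of_real \<xi>))"
      by (simp add: sqrt_divide_self_eq inverse_eq_divide)
    moreover have "(1 / x) * (2 * p) / P / Q = (2 / x) * (p / P) / Q" for x p P Q :: real by simp
    ultimately show ?thesis by (simp only:)
  qed
  also have "\<dots> \<le> (2 / sqrt \<bar>cos s\<bar>) * (1 / sqrt A) / A"
    using Ap Am A by (intro frac_le mult_left_mono) auto
  also have "\<dots> = (2 / sqrt \<bar>cos s\<bar>) * A powr (-3/2)"
  proof -
    have "A powr (-3/2) = A powr (- (1/2)) * A powr (- 1)"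
      by (subst powr_add[symmetric]) simp
    also have "\<dots> = (1 / sqrt A) / A"
      using A by (simp add: powr_minus_divide powr_half_sqrt)
    finally show ?thesis by simp
  qed
  also have "A powr (-3/2) = \<kappa> powr (-3/2) * (1 + \<bar>s\<bar>) powr (-3/2)"
    using \<kappa> by (simp add: A_def powr_mult)
  finally show ?thesis by (simp add: z_def mult_ac)
qed

lemma AE_sin_cos_nonzero: "AE s in lborel. sin s \<noteq> 0 \<and> cos (s::real) \<noteq> 0"
proof -
  have "{s::real. \<not> (sin s \<noteq> 0 \<and> cos s \<noteq> 0)} \<subseteq> (\<lambda>i::int. of_int i * pi / 2) ` UNIV"
  proof
    fix s :: real assume "s \<in> {s. \<not> (sin s \<noteq> 0 \<and> cos s \<noteq> 0)}"
    then have "sin (2 * s) = 0" by (auto simp: sin_double)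
    then obtain i :: int where "2 * s = of_int i * pi" by (auto simp: sin_zero_iff_int2)
    then show "s \<in> (\<lambda>i::int. of_int i * pi / 2) ` UNIV" by (intro image_eqI[of _ _ i]) auto
  qed
  then have "countable {s::real. \<not> (sin s \<noteq> 0 \<and> cos s \<noteq> 0)}"
    by (rule countable_subset) auto
  then have "{s::real. \<not> (sin s \<noteq> 0 \<and> cos s \<noteq> 0)} \<in> null_sets lborel"
    by (rule countable_imp_null_set_lborel)
  then show ?thesis by (rule AE_I'[of _ _]) auto
qed

lemma stieltjes_density_nonneg: "\<rho> s \<ge> 0"
proof (cases "tan s / s < 0")
  case True
  then have "sqrt (- (tan s / s)) \<ge> 0" by (intro real_sqrt_ge_zero) linarith
  then have "sqrt (- (tan s / s)) / (2 * pi) \<ge> 0" by (intro divide_nonneg_pos) (use pi_gt_zero in linarith)+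
  then show ?thesis by (simp only: stieltjes_density_def True if_True)
next
  case False
  then show ?thesis by (simp only: stieltjes_density_def if_False order_refl)
qed

lemma stieltjes_density_measurable [measurable]: "\<rho> \<in> borel_measurable borel"
  unfolding stieltjes_density_def[abs_def] tan_def by measurable

text \<open>The round number 1 in place of \<pi>/2 still leaves a gap around 0, which gives the
  kernel exponential moments of every rate below 1.\<close>

lemma stieltjes_density_support:
  assumes "\<bar>s\<bar> \<le> 1"
  shows "\<rho> s = 0"
proof -
  have "tan s / s \<ge> 0"
  proof (cases "s \<ge> 0")
    case True
    have "s = 0 \<or> 0 < tan s"
    proof (cases "s = 0")
      case False
      then show ?thesis using True assms pi_gt3 by (intro disjI2 tan_gt_zero) linarith+
    qed simp
    with True show ?thesis by auto
  next
    case False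
    then have "tan (- s) > 0" using assms pi_gt3 by (intro tan_gt_zero) linarith+
    then have "tan s \<le> 0" by simp
    then show ?thesis using False by (intro divide_nonpos_nonpos) auto
  qed
  then have "\<not> tan s / s < 0" by linarith
  then show ?thesis by (simp only: stieltjes_density_def if_False)
qed

lemma tanh_of_real: "tanh (of_real x :: complex) = of_real (tanh x)"
  by (simp add: tanh_def sinh_def cosh_def scaleR_conv_of_real exp_of_real[symmetric] del: exp_of_real)

lemma csym_of_real: "\<xi> > 0 \<Longrightarrow> csym (of_real \<xi>) = of_real (whitham_symbol \<xi>)"
  by (simp add: csym_def whitham_symbol_def tanh_of_real flip: of_real_divide)

text \<open>The contour approaches the imaginary axis and the rectangle fills the half-plane along
  the same sequence, so a single dominated convergence takes both limits.\<close>

lemma whitham_symbol_stieltjes_pos: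
  assumes \<xi>: "\<xi> > 0"
  shows "has_bochner_integral lborel (\<lambda>s. \<rho> s * (2 * \<bar>s\<bar> / (s\<^sup>2 + \<xi>\<^sup>2))) (whitham_symbol \<xi>)"
proof -
  \<comment> \<open>The 2 in \<open>n + 2\<close> keeps \<open>\<epsilon> n\<close> at most
    \<open>\<xi> / 2\<close>, the range of the majorant; \<open>R n\<close> below is a positive
    multiple of \<pi>, as the horizontal sides require.\<close>
  define \<epsilon> where "\<epsilon> = (\<lambda>n::nat. \<xi> / real (n + 2))"
  define R where "R = (\<lambda>n::nat. real (Suc n) * pi)"
  define h where "h = (\<lambda>n s. indicator {- R n..R n} s * Re (cauchy_csym \<xi> (Complex (\<epsilon> n) s)))"
  define l where "l = (\<lambda>s. - (2 * pi) * (\<rho> s * (2 * \<bar>s\<bar> / (s\<^sup>2 + \<xi>\<^sup>2))))"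
  define \<kappa> where "\<kappa> = (\<xi> / 2) / (1 + \<xi> / 2)"
  define w where "w = (\<lambda>s::real. 2 * \<kappa> powr (-3/2) * (1 / sqrt \<bar>cos s\<bar> * (1 + \<bar>s\<bar>) powr (-3/2)))"
  have \<epsilon>: "\<epsilon> n > 0" "\<epsilon> n \<le> \<xi> / 2" for n
  proof -
    show "\<epsilon> n > 0" using \<xi> by (simp add: \<epsilon>_def)
    show "\<epsilon> n \<le> \<xi> / 2" unfolding \<epsilon>_def using \<xi> by (intro divide_left_mono) auto
  qed
  then have \<epsilon>_less: "\<epsilon> n < \<xi>" for n
    using \<xi> le_less_trans[of "\<epsilon> n" "\<xi> / 2" \<xi> for n] by simp
  have R_top: "filterlim R at_top sequentially" unfolding R_def by real_asymp
  have \<epsilon>0: "\<epsilon> \<longlonglongrightarrow> 0" unfolding \<epsilon>_def by real_asymp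
  have cont: "continuous_on S (\<lambda>s. cauchy_csym \<xi> (Complex (\<epsilon> n) s))" for S n
    using \<epsilon>[of n] \<epsilon>_less[of n] \<xi> by (intro continuous_on_compose2[OF continuous_on_cauchy_csym[of \<xi> "{z. Re z = \<epsilon> n}"]] continuous_intros) (auto simp: complex_eq_iff)
  have [measurable]: "(\<lambda>s. Re (cauchy_csym \<xi> (Complex (\<epsilon> n) s))) \<in> borel_measurable borel" for n
    by (intro borel_measurable_continuous_onI continuous_intros cont)
  have [measurable]: "h n \<in> borel_measurable borel" for n unfolding h_def by measurable
  have [measurable]: "l \<in> borel_measurable borel" unfolding l_def by measurable
  have w: "integrable lborel w"
    unfolding w_def by (rule integrable_mult_right) (rule integrable_inverse_sqrt_cos)
  have lim: "AE s in lborel. (\<lambda>n. h n s) \<longlonglongrightarrow> l s"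
    using AE_sin_cos_nonzero
  proof eventually_elim
    case (elim s)
    have "\<forall>\<^sub>F n in sequentially. R n \<ge> \<bar>s\<bar>"
      using R_top by (simp add: filterlim_at_top)
    then have "\<forall>\<^sub>F n in sequentially. Re (cauchy_csym \<xi> (Complex (\<epsilon> n) s)) = h n s"
      by eventually_elim (auto simp: h_def indicator_def abs_le_iff)
    moreover have "(\<lambda>n. Re (cauchy_csym \<xi> (Complex (\<epsilon> n) s))) \<longlonglongrightarrow> l s"
      unfolding l_def using elim \<xi> \<epsilon>0 \<epsilon>(1) by (intro Re_cauchy_csym_tendsto) auto
    ultimately show ?case by (rule Lim_transform_eventually[rotated])
  qed
  have bnd: "AE s in lborel. norm (h n s) \<le> w s" for n
    using AE_sin_cos_nonzero
  proof eventually_elim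
    case (elim s)
    have "norm (h n s) \<le> norm (cauchy_csym \<xi> (Complex (\<epsilon> n) s))"
      using abs_Re_le_cmod by (auto simp: h_def indicator_def)
    also have "\<dots> \<le> w s"
      unfolding w_def \<kappa>_def using elim \<xi> \<epsilon> by (intro norm_cauchy_csym_bound) auto
    finally show ?case .
  qed
  have lint: "integrable lborel l"
    by (rule integrable_dominated_convergence[OF _ _ w lim bnd]) auto
  have conv: "(\<lambda>n. integral\<^sup>L lborel (h n)) \<longlonglongrightarrow> integral\<^sup>L lborel l"
    by (rule integral_dominated_convergence[OF _ _ w lim bnd]) auto
  have hint: "integral\<^sup>L lborel (h n) = Re (integral {- R n..R n} (\<lambda>s. cauchy_csym \<xi> (Complex (\<epsilon> n) s)))" for n
  proof -
    have "set_integrable lborel {- R n..R n} (\<lambda>s. Re (cauchy_csym \<xi> (Complex (\<epsilon> n) s)))"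
      by (intro borel_integrable_atLeastAtMost' continuous_intros cont)
    then have "integral\<^sup>L lborel (h n) = integral {- R n..R n} (\<lambda>s. Re (cauchy_csym \<xi> (Complex (\<epsilon> n) s)))"
      using set_borel_integral_eq_integral(2)[of "{- R n..R n}" "\<lambda>s. Re (cauchy_csym \<xi> (Complex (\<epsilon> n) s))"]
      by (simp only: h_def set_lebesgue_integral_def real_scaleR_def)
    also have "\<dots> = Re (integral {- R n..R n} (\<lambda>s. cauchy_csym \<xi> (Complex (\<epsilon> n) s)))"
      using integral_linear[OF integrable_continuous_real[OF cont] bounded_linear_Re] by (simp add: o_def)
    finally show ?thesis .
  qed
  have "(\<lambda>n. 2 * pi * whitham_symbol \<xi> + integral\<^sup>L lborel (h n)) \<longlonglongrightarrow> 0"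
  proof (rule Lim_null_comparison)
    have "\<forall>\<^sub>F n in sequentially. R n > \<xi>"
      using R_top by (simp add: filterlim_at_top_dense)
    then show "\<forall>\<^sub>F n in sequentially. norm (2 * pi * whitham_symbol \<xi> + integral\<^sup>L lborel (h n))
        \<le> 4 * R n * (sqrt (2 / R n) * 2 / (R n - \<xi>))"
    proof eventually_elim
      case (elim n)
      have "norm (2 * pi * whitham_symbol \<xi> + integral\<^sup>L lborel (h n)) =
         \<bar>Re (2 * pi * csym (of_real \<xi>) + integral {- R n..R n} (\<lambda>s. cauchy_csym \<xi> (Complex (\<epsilon> n) s)))\<bar>"
        using \<xi> by (simp add: hint csym_of_real)
      also have "\<dots> \<le> norm (2 * pi * csym (of_real \<xi>) + integral {- R n..R n} (\<lambda>s. cauchy_csym \<xi> (Complex (\<epsilon> n) s)))"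
        by (rule abs_Re_le_cmod)
      also have "\<dots> \<le> 4 * R n * (sqrt (2 / R n) * 2 / (R n - \<xi>))"
        using csym_cauchy_estimate[of "\<epsilon> n" \<xi> "Suc n"] \<epsilon>[of n] \<epsilon>_less[of n] elim by (simp add: R_def)
      finally show ?case .
    qed
    show "(\<lambda>n. 4 * R n * (sqrt (2 / R n) * 2 / (R n - \<xi>))) \<longlonglongrightarrow> 0"
      unfolding R_def by real_asymp
  qed
  moreover have "(\<lambda>n. 2 * pi * whitham_symbol \<xi> + integral\<^sup>L lborel (h n)) \<longlonglongrightarrow> 2 * pi * whitham_symbol \<xi> + integral\<^sup>L lborel l"
    by (intro tendsto_intros conv)
  ultimately have "2 * pi * whitham_symbol \<xi> + integral\<^sup>L lborel l = 0"
    using LIMSEQ_unique by blast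
  then have "has_bochner_integral lborel l (- (2 * pi) * whitham_symbol \<xi>)"
    using lint by (simp add: has_bochner_integral_iff)
  then have "has_bochner_integral lborel (\<lambda>s. l s * (- 1 / (2 * pi))) (- (2 * pi) * whitham_symbol \<xi> * (- 1 / (2 * pi)))"
    by (rule has_bochner_integral_mult_left)
  moreover have "- (2 * pi) * X * (- 1 / (2 * pi)) = X" for X by simp
  ultimately show ?thesis by (simp only: l_def)
qed

lemma whitham_symbol_minus: "whitham_symbol (- \<xi>) = whitham_symbol \<xi>"
  by (simp add: whitham_symbol_def)

lemma stieltjes_density_zero_or: "\<rho> s = 0 \<or> \<bar>s\<bar> > 1"
  using stieltjes_density_support[of s] by linarith

text \<open>At 0 the pole lies on the boundary of the half-plane, out of reach of the contour. The
  integrand increases as \<xi> decreases to 0, so this value is a monotone limit of the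
  others.\<close>

lemma whitham_symbol_stieltjes:
  "has_bochner_integral lborel (\<lambda>s. \<rho> s * (2 * \<bar>s\<bar> / (s\<^sup>2 + \<xi>\<^sup>2))) (whitham_symbol \<xi>)"
proof -
  consider "\<xi> > 0" | "\<xi> < 0" | "\<xi> = 0" by linarith
  then show ?thesis
  proof cases
    case 1
    then show ?thesis by (rule whitham_symbol_stieltjes_pos)
  next
    case 2
    then show ?thesis using whitham_symbol_stieltjes_pos[of "- \<xi>"] by (simp add: whitham_symbol_minus)
  next
    case 3
    define x where "x = (\<lambda>n::nat. 1 / real (Suc n))"
    have x: "x n > 0" for n by (simp add: x_def)
    note hbi = whitham_symbol_stieltjes_pos[OF x]
    have x0: "x \<longlonglongrightarrow> 0" unfolding x_def by real_asymp
    have tanh: "((\<lambda>t. sqrt (tanh t / t)) \<longlongrightarrow> 1) (at_right (0::real))"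
    proof -
      have "(tanh has_field_derivative 1 - (tanh 0)\<^sup>2) (at (0::real))"
        by (rule derivative_eq_intros refl | simp)+
      then have "((\<lambda>t. tanh t / t) \<longlongrightarrow> 1) (at (0::real))"
        by (simp add: DERIV_def)
      then have "((\<lambda>t. sqrt (tanh t / t)) \<longlongrightarrow> sqrt 1) (at (0::real))"
        by (rule tendsto_real_sqrt)
      then show ?thesis by (simp add: filterlim_at_split)
    qed
    have "filterlim x (at_right 0) sequentially"
      using x x0 by (simp add: filterlim_at less_imp_neq[symmetric])
    from filterlim_compose[OF tanh this]
    have lim: "(\<lambda>n. whitham_symbol (x n)) \<longlonglongrightarrow> 1"
      using x by (simp add: whitham_symbol_def less_imp_neq[symmetric])
    have "has_bochner_integral lborel (\<lambda>s. \<rho> s * (2 * \<bar>s\<bar> / s\<^sup>2)) 1"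
    proof (rule has_bochner_integral_monotone_convergence)
      show "integrable lborel (\<lambda>s. \<rho> s * (2 * \<bar>s\<bar> / (s\<^sup>2 + (x n)\<^sup>2)))" for n
        using hbi by (rule has_bochner_integral_iff[THEN iffD1, THEN conjunct1])
      show "(\<lambda>n. LINT s|lborel. \<rho> s * (2 * \<bar>s\<bar> / (s\<^sup>2 + (x n)\<^sup>2))) \<longlonglongrightarrow> 1"
        using lim has_bochner_integral_integral_eq[OF hbi] by simp
      show "AE s in lborel. mono (\<lambda>n. \<rho> s * (2 * \<bar>s\<bar> / (s\<^sup>2 + (x n)\<^sup>2)))"
      proof (intro AE_I2 monoI)
        fix s and m n :: nat assume "m \<le> n"
        then have "x n \<le> x m" by (simp add: x_def frac_le)
        then have "(x n)\<^sup>2 \<le> (x m)\<^sup>2" using x[of n] by (intro power_mono) auto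
        then have "2 * \<bar>s\<bar> / (s\<^sup>2 + (x m)\<^sup>2) \<le> 2 * \<bar>s\<bar> / (s\<^sup>2 + (x n)\<^sup>2)"
          using x[of m] x[of n] by (intro divide_left_mono mult_pos_pos add_nonneg_pos) (simp_all only: zero_less_power zero_le_power2 abs_ge_zero add_left_mono mult_nonneg_nonneg zero_le_numeral)
        then show "\<rho> s * (2 * \<bar>s\<bar> / (s\<^sup>2 + (x m)\<^sup>2)) \<le> \<rho> s * (2 * \<bar>s\<bar> / (s\<^sup>2 + (x n)\<^sup>2))"
          using stieltjes_density_nonneg by (intro mult_left_mono)
      qed
      show "AE s in lborel. (\<lambda>n. \<rho> s * (2 * \<bar>s\<bar> / (s\<^sup>2 + (x n)\<^sup>2))) \<longlonglongrightarrow> \<rho> s * (2 * \<bar>s\<bar> / s\<^sup>2)"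
      proof (intro AE_I2)
        fix s :: real
        show "(\<lambda>n. \<rho> s * (2 * \<bar>s\<bar> / (s\<^sup>2 + (x n)\<^sup>2))) \<longlonglongrightarrow> \<rho> s * (2 * \<bar>s\<bar> / s\<^sup>2)"
        proof (cases "s = 0")
          case False
          then have "(\<lambda>n. \<rho> s * (2 * \<bar>s\<bar> / (s\<^sup>2 + (x n)\<^sup>2))) \<longlonglongrightarrow> \<rho> s * (2 * \<bar>s\<bar> / (s\<^sup>2 + 0\<^sup>2))"
            by (intro tendsto_intros x0) auto
          then show ?thesis by simp
        qed simp
      qed
    qed measurable
    then show ?thesis using 3 by (simp add: whitham_symbol_def)
  qed
qed

text \<open>The symbol at 0, in the form that serves as total mass of the kernel and as majorant for
  the integrals against \<open>\<rho>\<close>.\<close>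

lemma stieltjes_mass:
  "has_bochner_integral lborel (\<lambda>s. \<rho> s * (2 / \<bar>s\<bar>)) 1"
proof -
  have "2 * \<bar>s\<bar> / s\<^sup>2 = 2 / \<bar>s\<bar>" for s :: real
    by (cases "s = 0") (simp_all add: power2_eq_square field_simps)
  then show ?thesis
    using whitham_symbol_stieltjes[of 0] by (simp add: whitham_symbol_def)
qed

section \<open>Fourier transform of the two-sided exponential\<close>

lemma integrable_exp_abs:
  assumes "a > 0"
  shows "integrable lborel (\<lambda>x::real. exp (- (a * \<bar>x\<bar>)))"
proof -
  have 1: "integrable lborel (\<lambda>x::real. indicator {0<..} x * exp (- (x * a)))"
    using integrable_I0i_exp_mscale[OF assms] by (simp add: set_integrable_def)
  then have "integrable lborel (\<lambda>x::real. indicator {0<..} (0 + (-1) * x) * exp (- ((0 + (-1) * x) * a)))"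
    by (rule lborel_integrable_real_affine) auto
  from Bochner_Integration.integrable_add[OF 1 this] show ?thesis
  proof (rule integrable_cong_AE_imp)
    have "AE x in lborel. x \<noteq> (0::real)" by (rule AE_lborel_singleton)
    then show "AE x in lborel. indicator {0<..} x * exp (- (x * a)) + indicator {0<..} (0 + (-1) * x) * exp (- ((0 + (-1) * x) * a)) = exp (- (a * \<bar>x\<bar>))"
      by eventually_elim (auto simp: indicator_def mult.commute abs_if)
  qed auto
qed

lemma integral_exp_half_line:
  fixes c :: complex
  assumes "Re c > 0"
  shows "has_bochner_integral lborel (\<lambda>x::real. indicator {0..} x *\<^sub>R exp (- (c * of_real x))) (1 / c)"
proof -
  have c0: "c \<noteq> 0" using assms by auto
  define s where "s = (\<lambda>(n::nat) x::real. indicator {0..real n} x *\<^sub>R exp (- (c * of_real x)))"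
  define f where "f = (\<lambda>x::real. indicator {0..} x *\<^sub>R exp (- (c * of_real x)))"
  have [measurable]: "f \<in> borel_measurable borel" "s n \<in> borel_measurable borel" for n
    unfolding f_def s_def by measurable
  have w: "integrable lborel (\<lambda>x::real. exp (- (Re c * \<bar>x\<bar>)))" by (rule integrable_exp_abs[OF assms])
  have lim: "AE x in lborel. (\<lambda>n. s n x) \<longlonglongrightarrow> f x"
  proof (intro AE_I2 tendsto_eventually)
    fix x :: real
    have "\<forall>\<^sub>F n in sequentially. x \<le> real n" by real_asymp
    then show "\<forall>\<^sub>F n in sequentially. s n x = f x"
      by eventually_elim (auto simp: s_def f_def indicator_def)
  qed
  have bnd: "AE x in lborel. norm (s n x) \<le> exp (- (Re c * \<bar>x\<bar>))" for n
    by (intro AE_I2) (auto simp: s_def indicator_def)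
  have int: "integral\<^sup>L lborel (s n) = - exp (- (c * of_real (real n))) / c - (- exp (- (c * of_real 0)) / c)" for n
    unfolding s_def
  proof (rule integral_FTC_atLeastAtMost)
    fix x :: real
    have "((\<lambda>z. - exp (- (c * z)) / c) has_field_derivative exp (- (c * of_real x))) (at (of_real x))"
    proof -
      have "((\<lambda>z. exp (- (c * z))) has_field_derivative exp (- (c * of_real x)) * - (c * 1)) (at (of_real x))"
        by (intro DERIV_fun_exp DERIV_minus DERIV_cmult DERIV_ident)
      from DERIV_cmult[OF this, of "- 1 / c"] show ?thesis using c0 by simp
    qed
    then show "((\<lambda>x. - exp (- (c * of_real x)) / c) has_vector_derivative exp (- (c * of_real x))) (at x within {0..real n})"
      by (rule has_vector_derivative_at_within[OF has_vector_derivative_real_field])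
  qed (auto intro!: continuous_intros)
  have lim1: "(\<lambda>n. integral\<^sup>L lborel (s n)) \<longlonglongrightarrow> integral\<^sup>L lborel f"
    by (rule integral_dominated_convergence[OF _ _ w lim bnd]) auto
  have lim2: "(\<lambda>n. integral\<^sup>L lborel (s n)) \<longlonglongrightarrow> - 0 / c - (- exp (- (c * of_real 0)) / c)"
    unfolding int
  proof (intro tendsto_intros c0)
    show "(\<lambda>n. exp (- (c * of_real (real n)))) \<longlonglongrightarrow> 0"
    proof (rule tendsto_norm_zero_cancel)
      have "(\<lambda>n. exp (- (Re c * real n))) \<longlonglongrightarrow> 0" using assms by real_asymp
      then show "(\<lambda>n. norm (exp (- (c * of_real (real n))))) \<longlonglongrightarrow> 0" by simp
    qed
  qed
  have "integral\<^sup>L lborel f = 1 / c"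
    using LIMSEQ_unique[OF lim1 lim2] by simp
  moreover have "integrable lborel f"
    by (rule integrable_dominated_convergence[OF _ _ w lim bnd]) auto
  ultimately show ?thesis by (simp add: has_bochner_integral_iff f_def)
qed

text \<open>The result is the Stieltjes kernel of the symbol, so inverting the transform under the
  integral over \<open>s\<close> produces \<open>wkernel\<close>. The two half-lines contribute
  \<open>1 / c\<close> and \<open>1 / d\<close> with conjugate \<open>c\<close> and
  \<open>d\<close>.\<close>

lemma fourier_exp_abs:
  assumes "a > 0"
  shows "has_bochner_integral lborel (\<lambda>x::real. of_real (exp (- (a * \<bar>x\<bar>))) * exp (- (\<i> * of_real (x * \<xi>))))
           (of_real (2 * a / (a\<^sup>2 + \<xi>\<^sup>2)))"
proof -
  define c where "c = Complex a \<xi>"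
  define d where "d = Complex a (- \<xi>)"
  define f where "f = (\<lambda>c (x::real). indicator {0..} x *\<^sub>R exp (- (c * of_real x)) :: complex)"
  have c: "has_bochner_integral lborel (f c) (1 / c)"
    unfolding f_def by (rule integral_exp_half_line) (simp add: c_def assms)
  have "has_bochner_integral lborel (f d) (1 / d)"
    unfolding f_def by (rule integral_exp_half_line) (simp add: d_def assms)
  then have "has_bochner_integral lborel (\<lambda>x. f d (0 + (-1) * x)) (1 / d)"
    using lborel_integrable_real_affine[of "f d" "-1" 0] lborel_integral_real_affine[of "-1" "f d" 0]
    by (simp add: has_bochner_integral_iff)
  from has_bochner_integral_add[OF c this]
  have "has_bochner_integral lborel (\<lambda>x. f c x + f d (0 + (-1) * x)) (1 / c + 1 / d)" .
  also have "1 / c + 1 / d = of_real (2 * a / (a\<^sup>2 + \<xi>\<^sup>2))"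
  proof -
    have "c \<noteq> 0" "d \<noteq> 0" using assms by (auto simp: c_def d_def complex_eq_iff)
    then have "1 / c + 1 / d = (c + d) / (c * d)" by (simp add: field_simps)
    also have "c + d = of_real (2 * a)" by (simp add: c_def d_def complex_eq_iff)
    also have "c * d = of_real (a\<^sup>2 + \<xi>\<^sup>2)" by (simp add: c_def d_def complex_eq_iff power2_eq_square)
    finally show ?thesis by simp
  qed
  finally have *: "has_bochner_integral lborel (\<lambda>x. f c x + f d (0 + (-1) * x)) (of_real (2 * a / (a\<^sup>2 + \<xi>\<^sup>2)))" .
  show ?thesis
  proof (rule has_bochner_integral_cong_AE[THEN iffD1, OF _ _ _ *])
    have "AE x in lborel. x \<noteq> (0::real)" by (rule AE_lborel_singleton)
    then show "AE x in lborel. f c x + f d (0 + (-1) * x) = of_real (exp (- (a * \<bar>x\<bar>))) * exp (- (\<i> * of_real (x * \<xi>)))"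
    proof eventually_elim
      case (elim x)
      have "f c x + f d (0 + (-1) * x) = exp (- (of_real (a * \<bar>x\<bar>) + \<i> * of_real (x * \<xi>)))"
      proof (cases "x > 0")
        case True
        have "c * of_real x = of_real (a * \<bar>x\<bar>) + \<i> * of_real (x * \<xi>)"
          using True by (simp add: c_def complex_eq_iff mult.commute)
        then show ?thesis using True by (simp add: f_def indicator_def del: of_real_mult)
      next
        case False
        have "d * of_real ((-1) * x) = of_real (a * \<bar>x\<bar>) + \<i> * of_real (x * \<xi>)"
          using False by (simp add: d_def complex_eq_iff mult.commute)
        then show ?thesis using False elim by (simp add: f_def indicator_def del: of_real_mult)
      qed
      also have "\<dots> = of_real (exp (- (a * \<bar>x\<bar>))) * exp (- (\<i> * of_real (x * \<xi>)))"
        by (simp add: exp_of_real[symmetric] exp_add[symmetric] del: exp_of_real)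
      finally show ?case .
    qed
  qed (auto simp: f_def)
qed

lemma integral_exp_abs:
  assumes "a > 0"
  shows "has_bochner_integral lborel (\<lambda>x::real. exp (- (a * \<bar>x\<bar>))) (2 / a)"
proof -
  have "has_bochner_integral lborel (\<lambda>x::real. complex_of_real (exp (- (a * \<bar>x\<bar>)))) (complex_of_real (2 / a))"
    using fourier_exp_abs[OF assms, of 0] assms by (simp add: power2_eq_square)
  then have "complex_of_real (LINT x|lborel. exp (- (a * \<bar>x\<bar>))) = complex_of_real (2 / a)"
    by (simp only: integral_complex_of_real[symmetric] has_bochner_integral_integral_eq)
  then have "(LINT x|lborel. exp (- (a * \<bar>x\<bar>))) = 2 / a"
    by (simp only: of_real_eq_iff)
  then show ?thesis using integrable_exp_abs[OF assms] by (simp add: has_bochner_integral_iff)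
qed

section \<open>The Whitham kernel\<close>

text \<open>The integral diverges at \<open>x = 0\<close>, where the value of \<open>wkernel\<close> is the junk value \<open>0\<close>.\<close>

definition wkernel :: "real \<Rightarrow> real" where
  "wkernel x = (LINT s|lborel. \<rho> s * exp (- (\<bar>s\<bar> * \<bar>x\<bar>)))"

lemma wkernel_measurable [measurable]: "wkernel \<in> borel_measurable borel"
  unfolding wkernel_def[abs_def] by measurable

lemma wkernel_minus: "wkernel (- x) = wkernel x"
  by (simp add: wkernel_def)

lemma wkernel_nonneg: "wkernel x \<ge> 0"
  unfolding wkernel_def by (intro Bochner_Integration.integral_nonneg mult_nonneg_nonneg stieltjes_density_nonneg) auto

section \<open>Positivity, monotonicity and exponential moments of the kernel\<close>

lemma power_le_fact_exp:
  assumes "u \<ge> (0::real)"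
  shows "u ^ n \<le> fact n * exp u"
proof -
  have "(\<Sum>k\<in>{n}. u ^ k /\<^sub>R fact k) \<le> (\<Sum>k. u ^ k /\<^sub>R fact k)"
    using assms by (intro sum_le_suminf summable_exp_generic) auto
  then have "u ^ n / fact n \<le> exp u"
    by (simp add: exp_def divide_inverse mult.commute)
  then show ?thesis by (simp add: field_simps)
qed

lemma power_exp_minus_le:
  assumes "a > 0" "t \<ge> (0::real)"
  shows "t ^ n * exp (- (t * a)) \<le> fact n / a ^ n"
proof -
  have "(t * a) ^ n \<le> fact n * exp (t * a)"
    using assms by (intro power_le_fact_exp) auto
  then have "t ^ n * a ^ n * exp (- (t * a)) \<le> fact n * exp (t * a) * exp (- (t * a))"
    by (intro mult_right_mono) (auto simp: power_mult_distrib)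
  then have "t ^ n * exp (- (t * a)) * a ^ n \<le> fact n"
    by (simp add: exp_minus mult_ac)
  then show ?thesis using assms by (simp add: pos_le_divide_eq)
qed

text \<open>The mass controls \<open>\<rho> s / \<bar>s\<bar>\<close>, and the exponential absorbs
  the remaining \<open>n + 1\<close> powers of \<open>\<bar>s\<bar>\<close>.\<close>

lemma integrable_stieltjes_exp:
  assumes "a > 0"
  shows "integrable lborel (\<lambda>s. \<rho> s * (\<bar>s\<bar> ^ n * exp (- (\<bar>s\<bar> * a))))"
proof (rule Bochner_Integration.integrable_bound)
  define C where "C = fact (Suc n) / a ^ Suc n"
  show "integrable lborel (\<lambda>s. C * (\<rho> s * (2 / \<bar>s\<bar>)))"
    using stieltjes_mass by (intro integrable_mult_right) (simp add: has_bochner_integral_iff)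
  show "AE s in lborel. norm (\<rho> s * (\<bar>s\<bar> ^ n * exp (- (\<bar>s\<bar> * a)))) \<le>
      norm (C * (\<rho> s * (2 / \<bar>s\<bar>)))"
  proof (intro AE_I2)
    fix s :: real
    consider "\<rho> s = 0" | "\<bar>s\<bar> > 1" using stieltjes_density_zero_or by blast
    then show "norm (\<rho> s * (\<bar>s\<bar> ^ n * exp (- (\<bar>s\<bar> * a)))) \<le>
      norm (C * (\<rho> s * (2 / \<bar>s\<bar>)))"
    proof cases
      case 2
      have C: "C \<ge> 0" using assms by (simp add: C_def)
      have "\<bar>s\<bar> ^ Suc n * exp (- (\<bar>s\<bar> * a)) \<le> C"
        unfolding C_def using assms by (intro power_exp_minus_le) auto
      then have "\<bar>s\<bar> ^ n * exp (- (\<bar>s\<bar> * a)) \<le> C / \<bar>s\<bar>"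
        using 2 by (simp add: pos_le_divide_eq mult_ac)
      also have "\<dots> \<le> C * (2 / \<bar>s\<bar>)" using C 2 by (simp add: field_simps)
      finally have "\<rho> s * (\<bar>s\<bar> ^ n * exp (- (\<bar>s\<bar> * a))) \<le> \<rho> s * (C * (2 / \<bar>s\<bar>))"
        by (intro mult_left_mono stieltjes_density_nonneg)
      then have le: "\<rho> s * (\<bar>s\<bar> ^ n * exp (- (\<bar>s\<bar> * a))) \<le> C * (\<rho> s * (2 / \<bar>s\<bar>))"
        by (simp only: mult.left_commute)
      have nn: "0 \<le> \<rho> s * (\<bar>s\<bar> ^ n * exp (- (\<bar>s\<bar> * a)))"
        by (intro mult_nonneg_nonneg stieltjes_density_nonneg) auto
      show ?thesis unfolding real_norm_def abs_of_nonneg[OF nn] by (rule order_trans[OF le abs_ge_self])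
    qed simp
  qed
qed measurable

lemma integrable_stieltjes_exp0:
  "x \<noteq> 0 \<Longrightarrow> integrable lborel (\<lambda>s. \<rho> s * exp (- (\<bar>s\<bar> * \<bar>x\<bar>)))"
  using integrable_stieltjes_exp[of "\<bar>x\<bar>" 0] by simp

text \<open>Otherwise \<open>\<rho>\<close> would vanish almost everywhere, against its mass
  1.\<close>

lemma stieltjes_integral_pos:
  assumes "integrable lborel (\<lambda>s. \<rho> s * g s)" "\<And>s. \<bar>s\<bar> > 1 \<Longrightarrow> g s > 0"
  shows "(LINT s|lborel. \<rho> s * g s) > 0"
proof -
  have nn: "0 \<le> \<rho> s * g s" for s
    using stieltjes_density_zero_or[of s] assms(2)[of s] stieltjes_density_nonneg[of s] by fastforce
  have "(LINT s|lborel. \<rho> s * g s) \<noteq> 0"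
  proof
    assume "(LINT s|lborel. \<rho> s * g s) = 0"
    then have "AE s in lborel. \<rho> s * g s = 0"
      using assms(1) nn by (subst (asm) integral_nonneg_eq_0_iff_AE) auto
    then have "AE s in lborel. \<rho> s * (2 / \<bar>s\<bar>) = 0"
    proof eventually_elim
      case (elim s)
      then show ?case using stieltjes_density_zero_or[of s] assms(2)[of s] by fastforce
    qed
    then have "(LINT s|lborel. \<rho> s * (2 / \<bar>s\<bar>)) = 0"
      by (rule integral_eq_zero_AE)
    then show False using stieltjes_mass by (simp add: has_bochner_integral_iff)
  qed
  moreover have "(LINT s|lborel. \<rho> s * g s) \<ge> 0" by (intro Bochner_Integration.integral_nonneg nn)
  ultimately show ?thesis by simp
qed

lemma wkernel_pos: "x \<noteq> 0 \<Longrightarrow> wkernel x > 0"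
  unfolding wkernel_def by (intro stieltjes_integral_pos integrable_stieltjes_exp0) auto

lemma wkernel_strict_antimono:
  assumes "x \<noteq> 0" "\<bar>x\<bar> < \<bar>y\<bar>"
  shows "wkernel y < wkernel x"
proof -
  have "y \<noteq> 0" using assms by auto
  have "0 < (LINT s|lborel. \<rho> s * (exp (- (\<bar>s\<bar> * \<bar>x\<bar>)) - exp (- (\<bar>s\<bar> * \<bar>y\<bar>))))"
  proof (rule stieltjes_integral_pos)
    show "integrable lborel (\<lambda>s. \<rho> s * (exp (- (\<bar>s\<bar> * \<bar>x\<bar>)) - exp (- (\<bar>s\<bar> * \<bar>y\<bar>))))"
      unfolding right_diff_distrib using assms \<open>y \<noteq> 0\<close>
      by (intro Bochner_Integration.integrable_diff integrable_stieltjes_exp0)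
    fix s :: real assume "1 < \<bar>s\<bar>"
    then have "\<bar>s\<bar> * \<bar>x\<bar> < \<bar>s\<bar> * \<bar>y\<bar>" using assms by (intro mult_strict_left_mono) auto
    then show "0 < exp (- (\<bar>s\<bar> * \<bar>x\<bar>)) - exp (- (\<bar>s\<bar> * \<bar>y\<bar>))" by simp
  qed
  also have "\<dots> = wkernel x - wkernel y"
    unfolding wkernel_def right_diff_distrib using assms \<open>y \<noteq> 0\<close>
    by (intro Bochner_Integration.integral_diff integrable_stieltjes_exp0)
  finally show ?thesis by simp
qed

lemma ennreal_wkernel:
  "x \<noteq> 0 \<Longrightarrow> ennreal (wkernel x) = (\<integral>\<^sup>+s. ennreal (\<rho> s * exp (- (\<bar>s\<bar> * \<bar>x\<bar>))) \<partial>lborel)"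
  unfolding wkernel_def using integrable_stieltjes_exp0 stieltjes_density_nonneg
  by (intro nn_integral_eq_integral[symmetric]) auto

text \<open>By Tonelli; \<open>\<bar>s\<bar> - \<eta>\<close> is positive on the support of
  \<open>\<rho>\<close>, which makes the inner integrals over \<open>x\<close> finite.\<close>

lemma nn_integral_wkernel_exp:
  assumes "0 \<le> \<eta>" "\<eta> < 1"
  shows "(\<integral>\<^sup>+x. ennreal (wkernel x * exp (\<eta> * \<bar>x\<bar>)) \<partial>lborel) =
    (\<integral>\<^sup>+s. ennreal (\<rho> s * (2 / (\<bar>s\<bar> - \<eta>))) \<partial>lborel)"
proof -
  have "(\<integral>\<^sup>+x. ennreal (wkernel x * exp (\<eta> * \<bar>x\<bar>)) \<partial>lborel) =
    (\<integral>\<^sup>+x. (\<integral>\<^sup>+s. ennreal (\<rho> s * exp (- ((\<bar>s\<bar> - \<eta>) * \<bar>x\<bar>))) \<partial>lborel) \<partial>lborel)"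
  proof (rule nn_integral_cong_AE)
    have "AE x in lborel. x \<noteq> (0::real)" by (rule AE_lborel_singleton)
    then show "AE x in lborel. ennreal (wkernel x * exp (\<eta> * \<bar>x\<bar>)) =
       (\<integral>\<^sup>+s. ennreal (\<rho> s * exp (- ((\<bar>s\<bar> - \<eta>) * \<bar>x\<bar>))) \<partial>lborel)"
    proof eventually_elim
      case (elim x)
      have "ennreal (wkernel x * exp (\<eta> * \<bar>x\<bar>)) = ennreal (wkernel x) * ennreal (exp (\<eta> * \<bar>x\<bar>))"
        using wkernel_nonneg by (intro ennreal_mult) auto
      also have "\<dots> = (\<integral>\<^sup>+s. ennreal (\<rho> s * exp (- (\<bar>s\<bar> * \<bar>x\<bar>))) * ennreal (exp (\<eta> * \<bar>x\<bar>)) \<partial>lborel)"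
        unfolding ennreal_wkernel[OF elim] by (intro nn_integral_multc[symmetric]) measurable
      also have "\<dots> = (\<integral>\<^sup>+s. ennreal (\<rho> s * exp (- ((\<bar>s\<bar> - \<eta>) * \<bar>x\<bar>))) \<partial>lborel)"
      proof (rule nn_integral_cong)
        fix s :: real
        have "exp (- ((\<bar>s\<bar> - \<eta>) * \<bar>x\<bar>)) = exp (- (\<bar>s\<bar> * \<bar>x\<bar>)) * exp (\<eta> * \<bar>x\<bar>)"
          by (subst exp_add[symmetric]) (simp add: algebra_simps)
        then show "ennreal (\<rho> s * exp (- (\<bar>s\<bar> * \<bar>x\<bar>))) * ennreal (exp (\<eta> * \<bar>x\<bar>)) =
          ennreal (\<rho> s * exp (- ((\<bar>s\<bar> - \<eta>) * \<bar>x\<bar>)))"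
          using stieltjes_density_nonneg[of s] by (subst ennreal_mult[symmetric]) (auto simp: mult.assoc)
      qed
      finally show ?case .
    qed
  qed
  also have "\<dots> = (\<integral>\<^sup>+s. (\<integral>\<^sup>+x. ennreal (\<rho> s * exp (- ((\<bar>s\<bar> - \<eta>) * \<bar>x\<bar>))) \<partial>lborel) \<partial>lborel)"
    by (rule lborel_pair.Fubini') measurable
  also have "\<dots> = (\<integral>\<^sup>+s. ennreal (\<rho> s * (2 / (\<bar>s\<bar> - \<eta>))) \<partial>lborel)"
  proof (rule nn_integral_cong)
    fix s :: real
    consider "\<rho> s = 0" | "\<bar>s\<bar> > 1" using stieltjes_density_zero_or by blast
    then show "(\<integral>\<^sup>+x. ennreal (\<rho> s * exp (- ((\<bar>s\<bar> - \<eta>) * \<bar>x\<bar>))) \<partial>lborel) =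
        ennreal (\<rho> s * (2 / (\<bar>s\<bar> - \<eta>)))"
    proof cases
      case 2
      then have "\<bar>s\<bar> - \<eta> > 0" using assms by simp
      from has_bochner_integral_mult_right[OF integral_exp_abs[OF this], of "\<rho> s"]
      show ?thesis
        using stieltjes_density_nonneg by (subst nn_integral_eq_integral) (auto simp: has_bochner_integral_iff)
    qed simp
  qed
  finally show ?thesis .
qed

lemma has_bochner_integral_wkernel: "has_bochner_integral lborel wkernel 1"
proof (rule has_bochner_integral_nn_integral)
  have "(\<integral>\<^sup>+s. ennreal (\<rho> s * (2 / \<bar>s\<bar>)) \<partial>lborel) = ennreal 1"
    using stieltjes_mass stieltjes_density_nonneg
    by (subst nn_integral_eq_integral) (auto simp: has_bochner_integral_iff)
  then show "(\<integral>\<^sup>+x. ennreal (wkernel x) \<partial>lborel) = ennreal 1"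
    using nn_integral_wkernel_exp[of 0] by simp
qed (auto simp: wkernel_nonneg)

text \<open>On the support,
  \<open>\<bar>s\<bar> - \<eta> \<ge> \<bar>s\<bar> * (1 - \<eta>)\<close>, which reduces the moment
  to the mass. The bound tends to 1 with \<eta> tending to 0, so a small rate brings it below any
  speed \<open>c > 1\<close>.\<close>

lemma wkernel_exp_moment:
  assumes "0 \<le> \<eta>" "\<eta> < 1"
  shows "integrable lborel (\<lambda>x. wkernel x * exp (\<eta> * \<bar>x\<bar>))"
    and "(LINT x|lborel. wkernel x * exp (\<eta> * \<bar>x\<bar>)) \<le> 1 / (1 - \<eta>)"
proof -
  have "(\<integral>\<^sup>+x. ennreal (wkernel x * exp (\<eta> * \<bar>x\<bar>)) \<partial>lborel) \<le>
      (\<integral>\<^sup>+s. ennreal (1 / (1 - \<eta>) * (\<rho> s * (2 / \<bar>s\<bar>))) \<partial>lborel)"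
    unfolding nn_integral_wkernel_exp[OF assms]
  proof (intro nn_integral_mono ennreal_leI)
    fix s :: real
    consider "\<rho> s = 0" | "\<bar>s\<bar> > 1" using stieltjes_density_zero_or by blast
    then show "\<rho> s * (2 / (\<bar>s\<bar> - \<eta>)) \<le> 1 / (1 - \<eta>) * (\<rho> s * (2 / \<bar>s\<bar>))"
    proof cases
      case 2
      have "\<bar>s\<bar> * (1 - \<eta>) \<le> \<bar>s\<bar> - \<eta>"
        using 2 assms mult_left_mono[of 1 "\<bar>s\<bar>" \<eta>] by (simp add: algebra_simps)
      moreover have "0 < \<bar>s\<bar> * (1 - \<eta>)" using 2 assms by (intro mult_pos_pos) auto
      ultimately have "2 / (\<bar>s\<bar> - \<eta>) \<le> 2 / (\<bar>s\<bar> * (1 - \<eta>))"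
        by (intro frac_le) auto
      then have "\<rho> s * (2 / (\<bar>s\<bar> - \<eta>)) \<le> \<rho> s * (2 / (\<bar>s\<bar> * (1 - \<eta>)))"
        by (intro mult_left_mono stieltjes_density_nonneg)
      then show ?thesis by (simp add: mult_ac)
    qed simp
  qed
  also have "\<dots> = ennreal (1 / (1 - \<eta>))"
    using has_bochner_integral_mult_right[OF stieltjes_mass, of "1 / (1 - \<eta>)"] stieltjes_density_nonneg assms
    by (subst nn_integral_eq_integral) (auto simp: has_bochner_integral_iff)
  finally have le: "(\<integral>\<^sup>+x. ennreal (wkernel x * exp (\<eta> * \<bar>x\<bar>)) \<partial>lborel) \<le> ennreal (1 / (1 - \<eta>))" .
  show int: "integrable lborel (\<lambda>x. wkernel x * exp (\<eta> * \<bar>x\<bar>))"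
    using le wkernel_nonneg by (intro integrableI_nonneg) (auto simp: order_le_less_trans[OF _ ennreal_less_top])
  have "ennreal (LINT x|lborel. wkernel x * exp (\<eta> * \<bar>x\<bar>)) \<le> ennreal (1 / (1 - \<eta>))"
    using le int wkernel_nonneg by (subst nn_integral_eq_integral[symmetric]) auto
  then show "(LINT x|lborel. wkernel x * exp (\<eta> * \<bar>x\<bar>)) \<le> 1 / (1 - \<eta>)"
    using assms by (subst (asm) ennreal_le_iff) auto
qed

text \<open>Absolute integrability for Fubini is again \<open>stieltjes_mass\<close>: the
  oscillating factor has norm 1, and the norms integrate over \<open>x\<close> to
  \<open>\<rho> s * (2 / \<bar>s\<bar>)\<close>.\<close>

lemma fourier_wkernel: "fourier (\<lambda>x. complex_of_real (wkernel x)) \<xi> = complex_of_real (whitham_symbol \<xi>)"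
proof -
  define f where "f = (\<lambda>s x. complex_of_real (\<rho> s) *
    (of_real (exp (- (\<bar>s\<bar> * \<bar>x\<bar>))) * exp (- (\<i> * of_real (x * \<xi>)))))"
  have hb: "has_bochner_integral lborel (f s) (complex_of_real (\<rho> s * (2 * \<bar>s\<bar> / (s\<^sup>2 + \<xi>\<^sup>2))))"
    and hbn: "has_bochner_integral lborel (\<lambda>x. norm (f s x)) (\<rho> s * (2 / \<bar>s\<bar>))" for s
  proof -
    consider "\<rho> s = 0" | "\<bar>s\<bar> > 1" using stieltjes_density_zero_or by blast
    then have "has_bochner_integral lborel (f s) (complex_of_real (\<rho> s * (2 * \<bar>s\<bar> / (s\<^sup>2 + \<xi>\<^sup>2)))) \<and>
       has_bochner_integral lborel (\<lambda>x. norm (f s x)) (\<rho> s * (2 / \<bar>s\<bar>))"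
    proof cases
      case 2
      then have "\<bar>s\<bar> > 0" by simp
      have "norm (f s x) = \<rho> s * exp (- (\<bar>s\<bar> * \<bar>x\<bar>))" for x
        using stieltjes_density_nonneg[of s] by (simp add: f_def norm_mult)
      then show ?thesis
        using has_bochner_integral_mult_right[OF fourier_exp_abs[OF \<open>\<bar>s\<bar> > 0\<close>, of \<xi>], of "of_real (\<rho> s)"]
          has_bochner_integral_mult_right[OF integral_exp_abs[OF \<open>\<bar>s\<bar> > 0\<close>], of "\<rho> s"]
        by (simp add: f_def)
    qed (simp add: f_def has_bochner_integral_zero)
    then show "has_bochner_integral lborel (f s) (complex_of_real (\<rho> s * (2 * \<bar>s\<bar> / (s\<^sup>2 + \<xi>\<^sup>2))))"
      "has_bochner_integral lborel (\<lambda>x. norm (f s x)) (\<rho> s * (2 / \<bar>s\<bar>))" by auto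
  qed
  have [measurable]: "(\<lambda>(s, x). f s x) \<in> borel_measurable (lborel \<Otimes>\<^sub>M lborel)"
    unfolding f_def by measurable
  have int: "integrable (lborel \<Otimes>\<^sub>M lborel) (\<lambda>(s, x). f s x)"
  proof (rule lborel_pair.Fubini_integrable)
    show "integrable lborel (\<lambda>s. LINT x|lborel. norm (case (s, x) of (s, x) \<Rightarrow> f s x))"
      using has_bochner_integral_integral_eq[OF hbn] stieltjes_mass by (simp add: has_bochner_integral_iff)
    show "AE s in lborel. integrable lborel (\<lambda>x. case (s, x) of (s, x) \<Rightarrow> f s x)"
      using hb by (auto simp: has_bochner_integral_iff)
  qed measurable
  have "fourier (\<lambda>x. complex_of_real (wkernel x)) \<xi> = (LINT x|lborel. LINT s|lborel. f s x)"
    unfolding fourier_def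
  proof (rule Bochner_Integration.integral_cong[OF refl])
    fix x :: real
    have "(LINT s|lborel. f s x) =
      (LINT s|lborel. complex_of_real (\<rho> s * exp (- (\<bar>s\<bar> * \<bar>x\<bar>))) * exp (- (\<i> * of_real (x * \<xi>))))"
      by (simp add: f_def mult_ac)
    also have "\<dots> = complex_of_real (wkernel x) * exp (- (\<i> * of_real (x * \<xi>)))"
      unfolding wkernel_def by (simp only: integral_mult_left_zero integral_complex_of_real)
    finally show "complex_of_real (wkernel x) * exp (- (\<i> * of_real (x * \<xi>))) = (LINT s|lborel. f s x)" ..
  qed
  also have "\<dots> = (LINT s|lborel. LINT x|lborel. f s x)"
    by (rule lborel_pair.Fubini_integral[OF int])
  also have "\<dots> = (LINT s|lborel. complex_of_real (\<rho> s * (2 * \<bar>s\<bar> / (s\<^sup>2 + \<xi>\<^sup>2))))"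
    using has_bochner_integral_integral_eq[OF hb] by simp
  also have "\<dots> = complex_of_real (whitham_symbol \<xi>)"
    using has_bochner_integral_integral_eq[OF whitham_symbol_stieltjes] by (simp only: integral_complex_of_real)
  finally show ?thesis .
qed

lemma whitham_kernel_wkernel: "whitham_kernel wkernel"
  using has_bochner_integral_wkernel fourier_wkernel by (simp add: whitham_kernel_def has_bochner_integral_iff)

section \<open>Uniqueness of the kernel and convolutions with it\<close>

lemma real_distribution_normalized_density:
  fixes g :: "real \<Rightarrow> real"
  assumes [measurable]: "g \<in> borel_measurable borel" and "\<And>x. g x \<ge> 0"
    and "has_bochner_integral lborel g I" "I > 0"
  shows "real_distribution (density lborel (\<lambda>x. ennreal (g x / I)))"
proof -
  have "has_bochner_integral lborel (\<lambda>x. g x / I) (I / I)"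
    using assms(3) by (rule has_bochner_integral_divide_zero)
  then have "(\<integral>\<^sup>+x. ennreal (g x / I) \<partial>lborel) = ennreal (I / I)"
    using assms by (subst nn_integral_eq_integral) (auto simp: has_bochner_integral_iff)
  then have "emeasure (density lborel (\<lambda>x. ennreal (g x / I))) UNIV = 1"
    using assms(4) by (simp add: emeasure_density)
  then have "prob_space (density lborel (\<lambda>x. ennreal (g x / I)))"
    by (intro prob_spaceI) simp
  then show ?thesis
    by (simp add: real_distribution_def real_distribution_axioms_def)
qed

text \<open>Positive and negative part of the difference have the same transform, in particular the
  same mass at frequency 0. Divided by that mass they are probability densities with equal
  characteristic functions, and Levy's theorem applies.\<close>

lemma fourier_inj_AE:
  fixes K1 K2 :: "real \<Rightarrow> real"
  assumes K: "integrable lborel K1" "integrable lborel K2"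
    and eq: "\<And>\<xi>. fourier (\<lambda>x. complex_of_real (K1 x)) \<xi> = fourier (\<lambda>x. complex_of_real (K2 x)) \<xi>"
  shows "AE x in lborel. K1 x = K2 x"
proof -
  have [measurable]: "K1 \<in> borel_measurable borel" "K2 \<in> borel_measurable borel"
    using K by (auto dest: borel_measurable_integrable)
  define P where "P = (\<lambda>x. max (K1 x - K2 x) 0)"
  define N where "N = (\<lambda>x. max (K2 x - K1 x) 0)"
  define e where "e = (\<lambda>t x. exp (\<i> * complex_of_real (t * x)))"
  have [measurable]: "P \<in> borel_measurable borel" "N \<in> borel_measurable borel" "e t \<in> borel_measurable borel" for t
    unfolding P_def N_def e_def by measurable
  have int: "integrable lborel P" "integrable lborel N"
    unfolding P_def N_def using K by auto
  have nn: "P x \<ge> 0" "N x \<ge> 0" for x by (auto simp: P_def N_def)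
  have inte: "integrable lborel (\<lambda>x. complex_of_real (g x) * e t x)" if "integrable lborel g" for g t
  proof (rule Bochner_Integration.integrable_bound[OF that])
    have [measurable]: "g \<in> borel_measurable borel" using that by auto
    show "(\<lambda>x. complex_of_real (g x) * e t x) \<in> borel_measurable lborel" by measurable
  qed (auto simp: e_def norm_mult)
  have E: "(LINT x|lborel. complex_of_real (P x) * e t x) = (LINT x|lborel. complex_of_real (N x) * e t x)" for t
  proof -
    have "(LINT x|lborel. complex_of_real (P x) * e t x) - (LINT x|lborel. complex_of_real (N x) * e t x)
        = (LINT x|lborel. complex_of_real (P x) * e t x - complex_of_real (N x) * e t x)"
      by (intro Bochner_Integration.integral_diff[symmetric] inte int)
    also have "\<dots> = (LINT x|lborel. complex_of_real (K1 x) * e t x - complex_of_real (K2 x) * e t x)"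
      by (intro Bochner_Integration.integral_cong) (auto simp: P_def N_def max_def algebra_simps)
    also have "\<dots> = (LINT x|lborel. complex_of_real (K1 x) * e t x) - (LINT x|lborel. complex_of_real (K2 x) * e t x)"
      by (intro Bochner_Integration.integral_diff inte K)
    also have "\<dots> = 0"
      using eq[of "- t"] by (simp add: fourier_def e_def mult.commute)
    finally show ?thesis by simp
  qed
  have "complex_of_real (integral\<^sup>L lborel P) = complex_of_real (integral\<^sup>L lborel N)"
    using E[of 0] by (simp add: e_def)
  then have I: "integral\<^sup>L lborel P = integral\<^sup>L lborel N" by (simp only: of_real_eq_iff)
  define I where "I = integral\<^sup>L lborel P"
  have "I \<ge> 0" unfolding I_def using nn by (intro Bochner_Integration.integral_nonneg)
  have "AE x in lborel. P x = N x"
  proof (cases "I = 0")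
    case True
    then have "AE x in lborel. P x = 0" "AE x in lborel. N x = 0"
      using int nn integral_nonneg_eq_0_iff_AE[of lborel P] integral_nonneg_eq_0_iff_AE[of lborel N] I
      by (auto simp: I_def)
    then show ?thesis by eventually_elim simp
  next
    case False
    with \<open>I \<ge> 0\<close> have I0: "I > 0" by simp
    have hP: "has_bochner_integral lborel P I" and hN: "has_bochner_integral lborel N I"
      using int I by (auto simp: has_bochner_integral_iff I_def)
    have char: "char (density lborel (\<lambda>x. ennreal (g x / I))) t = (LINT x|lborel. complex_of_real (g x) * e t x) / of_real I"
      if [measurable]: "g \<in> borel_measurable borel" and "\<And>x. g x \<ge> 0" for g t
    proof -
      have "char (density lborel (\<lambda>x. ennreal (g x / I))) t = (LINT x|lborel. (g x / I) *\<^sub>R e t x)"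
        unfolding char_def e_def using that I0 by (subst integral_density) auto
      also have "\<dots> = (LINT x|lborel. complex_of_real (g x) * e t x / of_real I)"
        by (intro Bochner_Integration.integral_cong) (auto simp: scaleR_conv_of_real)
      finally show ?thesis by simp
    qed
    have "density lborel (\<lambda>x. ennreal (P x / I)) = density lborel (\<lambda>x. ennreal (N x / I))"
    proof (rule Levy_uniqueness)
      show "real_distribution (density lborel (\<lambda>x. ennreal (P x / I)))"
        by (rule real_distribution_normalized_density[OF _ _ hP I0]) (auto simp: nn)
      show "real_distribution (density lborel (\<lambda>x. ennreal (N x / I)))"
        by (rule real_distribution_normalized_density[OF _ _ hN I0]) (auto simp: nn)
      show "char (density lborel (\<lambda>x. ennreal (P x / I))) = char (density lborel (\<lambda>x. ennreal (N x / I)))"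
        using E nn by (intro ext) (simp add: char)
    qed
    then have "AE x in lborel. ennreal (P x / I) = ennreal (N x / I)"
      by (intro sigma_finite_measure.density_unique[OF lborel.sigma_finite_measure_axioms]) auto
    then show ?thesis
      by eventually_elim (use I0 nn in \<open>simp add: ennreal_inj\<close>)
  qed
  then show ?thesis
    by eventually_elim (auto simp: P_def N_def max_def split: if_splits)
qed

lemma whitham_kernel_AE_eq:
  assumes "whitham_kernel K"
  shows "AE x in lborel. K x = wkernel x"
  using assms whitham_kernel_wkernel unfolding whitham_kernel_def
  by (intro fourier_inj_AE) auto

section \<open>Convolution with the kernel and reflections\<close>

definition wconv :: "(real \<Rightarrow> real) \<Rightarrow> real \<Rightarrow> real" where
  "wconv f x = (LINT y|lborel. wkernel (x - y) * f y)"

lemma whitham_convolution_eq: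
  assumes "whitham_kernel K" and [measurable]: "f \<in> borel_measurable borel"
  shows "Defs.convolution K f x = wconv f x"
proof -
  have [measurable]: "K \<in> borel_measurable borel"
    using assms(1) by (auto simp: whitham_kernel_def dest: borel_measurable_integrable)
  have "AE y in lborel. K (x + (-1) * y) = wkernel (x + (-1) * y)"
    using whitham_kernel_AE_eq[OF assms(1)] by (intro AE_borel_affine[where P="\<lambda>x. K x = wkernel x"]) auto
  then show ?thesis
    unfolding Defs.convolution_def wconv_def by (intro integral_cong_AE) auto
qed

lemma integral_reflect:
  fixes f :: "real \<Rightarrow> real"
  shows "(LINT y|lborel. f (a - y)) = (LINT y|lborel. f y)"
  using lborel_integral_real_affine[of "-1" f a] by simp

lemma integrable_reflect:
  fixes f :: "real \<Rightarrow> real"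
  shows "integrable lborel f \<Longrightarrow> integrable lborel (\<lambda>y. f (a - y))"
  using lborel_integrable_real_affine[of f "-1" a] by simp

lemma has_bochner_integral_wkernel_reflect: "has_bochner_integral lborel (\<lambda>y. wkernel (x - y)) 1"
  using has_bochner_integral_wkernel integral_reflect[of wkernel x] integrable_reflect[of wkernel x]
  by (simp add: has_bochner_integral_iff)

lemma integrable_wkernel_mult:
  assumes [measurable]: "f \<in> borel_measurable borel" and B: "\<And>y. \<bar>f y\<bar> \<le> B"
  shows "integrable lborel (\<lambda>y. wkernel (x - y) * f y)"
proof (rule Bochner_Integration.integrable_bound)
  show "integrable lborel (\<lambda>y. B * wkernel (x - y))"
    using has_bochner_integral_wkernel_reflect by (intro integrable_mult_right) (auto simp: has_bochner_integral_iff)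
  show "AE y in lborel. norm (wkernel (x - y) * f y) \<le> norm (B * wkernel (x - y))"
  proof (intro AE_I2)
    fix y
    have "wkernel (x - y) * \<bar>f y\<bar> \<le> wkernel (x - y) * B"
      by (intro mult_left_mono B wkernel_nonneg)
    then show "norm (wkernel (x - y) * f y) \<le> norm (B * wkernel (x - y))"
      using wkernel_nonneg[of "x - y"] B[of y] by (simp add: abs_mult mult.commute)
  qed
qed measurable

lemma wconv_const: "wconv (\<lambda>_. M) x = M"
  using has_bochner_integral_wkernel_reflect[of x] by (simp add: wconv_def has_bochner_integral_iff)

lemma wconv_add:
  assumes "f \<in> borel_measurable borel" "\<And>y. \<bar>f y\<bar> \<le> B" "g \<in> borel_measurable borel" "\<And>y. \<bar>g y\<bar> \<le> C"
  shows "wconv (\<lambda>y. f y + g y) x = wconv f x + wconv g x"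
  unfolding wconv_def distrib_left
  by (rule Bochner_Integration.integral_add[OF integrable_wkernel_mult[OF assms(1,2)] integrable_wkernel_mult[OF assms(3,4)]])

lemma wconv_diff:
  assumes "f \<in> borel_measurable borel" "\<And>y. \<bar>f y\<bar> \<le> B" "g \<in> borel_measurable borel" "\<And>y. \<bar>g y\<bar> \<le> C"
  shows "wconv (\<lambda>y. f y - g y) x = wconv f x - wconv g x"
  unfolding wconv_def right_diff_distrib
  by (rule Bochner_Integration.integral_diff[OF integrable_wkernel_mult[OF assms(1,2)] integrable_wkernel_mult[OF assms(3,4)]])

lemma wconv_cmult: "wconv (\<lambda>y. M * f y) x = M * wconv f x"
  unfolding wconv_def by (simp add: mult.left_commute)

lemma wconv_uminus: "wconv (\<lambda>y. - f y) x = - wconv f x"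
  unfolding wconv_def by simp

lemma wconv_mono:
  assumes "f \<in> borel_measurable borel" "\<And>y. \<bar>f y\<bar> \<le> B" "g \<in> borel_measurable borel" "\<And>y. \<bar>g y\<bar> \<le> C"
    "\<And>y. f y \<le> g y"
  shows "wconv f x \<le> wconv g x"
  unfolding wconv_def
  using integrable_wkernel_mult[OF assms(1,2)] integrable_wkernel_mult[OF assms(3,4)]
  by (intro integral_mono mult_left_mono wkernel_nonneg assms(5))

lemma wconv_reflect:
  "wconv (\<lambda>y. f (2 * l - y)) x = wconv f (2 * l - x)"
proof -
  have "wkernel (x - y) = wkernel (2 * l - x - (2 * l - y))" for y
    using wkernel_minus[of "x - y"] by simp
  then have "wconv (\<lambda>y. f (2 * l - y)) x
      = (LINT y|lborel. (\<lambda>z. wkernel (2 * l - x - z) * f z) (2 * l - y))"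
    by (simp add: wconv_def)
  also have "\<dots> = wconv f (2 * l - x)"
    unfolding wconv_def by (rule integral_reflect)
  finally show ?thesis .
qed

lemma wconv_shift:
  "wconv (\<lambda>y. f (a + y)) x = wconv f (a + x)"
  using lborel_integral_real_affine[of 1 "\<lambda>y. wkernel (a + x - y) * f y" a]
  by (simp add: wconv_def)

text \<open>Averaging the convolution with its mirror image brings out the kernel difference while
  keeping the integral over the whole line; hence the factor 2 instead of a half-line.\<close>

lemma wconv_odd:
  assumes "f \<in> borel_measurable borel" "\<And>y. \<bar>f y\<bar> \<le> B" and odd: "\<And>y. f (2 * l - y) = - f y"
  shows "integrable lborel (\<lambda>y. (wkernel (x - y) - wkernel (x + y - 2 * l)) * f y)"
    and "2 * wconv f x = (LINT y|lborel. (wkernel (x - y) - wkernel (x + y - 2 * l)) * f y)"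
proof -
  have eq: "wkernel (x + y - 2 * l) = wkernel (2 * l - x - y)" for y
    using wkernel_minus[of "x + y - 2 * l"] by (simp add: algebra_simps)
  have int: "integrable lborel (\<lambda>y. wkernel (x - y) * f y)" "integrable lborel (\<lambda>y. wkernel (2 * l - x - y) * f y)"
    using assms by (auto intro!: integrable_wkernel_mult)
  then show "integrable lborel (\<lambda>y. (wkernel (x - y) - wkernel (x + y - 2 * l)) * f y)"
    by (simp add: left_diff_distrib eq)
  have "- wconv f x = wconv (\<lambda>y. f (2 * l - y)) x"
    by (simp add: odd wconv_uminus)
  also have "\<dots> = wconv f (2 * l - x)"
    by (rule wconv_reflect)
  finally have "2 * wconv f x = wconv f x - wconv f (2 * l - x)"
    by simp
  also have "\<dots> = (LINT y|lborel. (wkernel (x - y) - wkernel (x + y - 2 * l)) * f y)"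
    using int by (simp add: wconv_def left_diff_distrib eq)
  finally show "2 * wconv f x = (LINT y|lborel. (wkernel (x - y) - wkernel (x + y - 2 * l)) * f y)" .
qed

text \<open>Points on one side of the plane are nearer to each other than to each other's mirror
  images. \<open>x \<noteq> y\<close> avoids the default value of the kernel at 0.\<close>

lemma wkernel_reflection_less:
  assumes "l < x" "l < y" "x \<noteq> y"
  shows "wkernel (x + y - 2 * l) < wkernel (x - y)"
  using assms by (intro wkernel_strict_antimono) auto

text \<open>Both factors are odd about the plane, so the sign on the left follows from that on the
  right. The two excluded points are those where one of the kernel values is the default
  one.\<close>

lemma wconv_odd_integrand:
  assumes odd: "\<And>y. f (2 * l - y) = - f y" and nonneg: "\<And>y. y > l \<Longrightarrow> f y \<ge> 0"
    and x: "x > l" and y: "y \<noteq> x" "y \<noteq> 2 * l - x"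
  shows "0 \<le> (wkernel (x - y) - wkernel (x + y - 2 * l)) * f y"
    and "(wkernel (x - y) - wkernel (x + y - 2 * l)) * f y = 0 \<Longrightarrow> f y = 0"
proof -
  consider "y = l" | "y > l" | "y < l" by linarith
  then have "0 \<le> (wkernel (x - y) - wkernel (x + y - 2 * l)) * f y \<and>
      ((wkernel (x - y) - wkernel (x + y - 2 * l)) * f y = 0 \<longrightarrow> f y = 0)"
  proof cases
    case 1
    then show ?thesis using odd[of l] by simp
  next
    case 2
    then show ?thesis using wkernel_reflection_less[OF x 2] y nonneg[OF 2] by simp
  next
    case 3
    define z where "z = 2 * l - y"
    have z: "z > l" "z \<noteq> x" "f y = - f z" using 3 y odd[of z] by (auto simp: z_def)
    have "wkernel (x - z) = wkernel (x + y - 2 * l)" "wkernel (x + z - 2 * l) = wkernel (x - y)"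
      by (auto simp: z_def algebra_simps)
    then have "wkernel (x - y) < wkernel (x + y - 2 * l)"
      using wkernel_reflection_less[OF x z(1)] z by simp
    then show ?thesis using nonneg[OF z(1)] z by (simp add: mult_nonpos_nonneg)
  qed
  then show "0 \<le> (wkernel (x - y) - wkernel (x + y - 2 * l)) * f y"
    "(wkernel (x - y) - wkernel (x + y - 2 * l)) * f y = 0 \<Longrightarrow> f y = 0" by auto
qed

lemma wconv_odd_nonneg:
  assumes f: "f \<in> borel_measurable borel" "\<And>y. \<bar>f y\<bar> \<le> B" and odd: "\<And>y. f (2 * l - y) = - f y"
    and nonneg: "\<And>y. y > l \<Longrightarrow> f y \<ge> 0" and x: "x > l"
  shows "wconv f x \<ge> 0"
    and "wconv f x = 0 \<Longrightarrow> AE y in lborel. f y = 0"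
proof -
  define h where "h = (\<lambda>y. (wkernel (x - y) - wkernel (x + y - 2 * l)) * f y)"
  have ae: "AE y in lborel. y \<noteq> x \<and> y \<noteq> 2 * l - x"
    by (intro AE_conjI AE_lborel_singleton)
  have ae_nn: "AE y in lborel. 0 \<le> h y"
    using ae unfolding h_def by eventually_elim (use wconv_odd_integrand(1)[where f = f and l = l, OF odd nonneg x] in auto)
  have int: "integrable lborel h" and eq: "2 * wconv f x = integral\<^sup>L lborel h"
    unfolding h_def using wconv_odd[OF f odd] by auto
  show "wconv f x \<ge> 0"
    using eq integral_nonneg_AE[OF ae_nn] by simp
  show "AE y in lborel. f y = 0" if "wconv f x = 0"
  proof -
    have "AE y in lborel. h y = 0"
      using that eq integral_nonneg_eq_0_iff_AE[OF int ae_nn] by simp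
    then show ?thesis using ae
      unfolding h_def by eventually_elim (use wconv_odd_integrand(2)[where f = f and l = l, OF odd nonneg x] in blast)
  qed
qed

lemma continuous_AE_zero_imp_zero:
  fixes f :: "real \<Rightarrow> real"
  assumes "continuous_on UNIV f" "AE y in lborel. f y = 0"
  shows "f x = 0"
proof (rule ccontr)
  assume "f x \<noteq> 0"
  have "open {y. f y \<noteq> 0}" using assms(1) by (intro open_Collect_neq continuous_on_const)
  moreover have "{y. f y \<noteq> 0} \<in> null_sets lborel"
    using assms(2) calculation by (subst AE_iff_null_sets) auto
  then have "negligible {y. f y \<noteq> 0}"
    using negligible_iff_null_sets null_sets_completionI by blast
  ultimately show False using \<open>f x \<noteq> 0\<close> open_not_negligible by blast
qed

text \<open>The convolution of the kernel with the sign function, at \<open>d\<close>.\<close>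

definition wkernel_odd_mass :: "real \<Rightarrow> real" where
  "wkernel_odd_mass d = (LINT z|lborel. wkernel z * sgn (d - z))"

lemma abs_sgn_le_1: "\<bar>sgn (t::real)\<bar> \<le> 1"
  by (simp add: sgn_if)

lemma wkernel_odd_mass_le_1: "wkernel_odd_mass d \<le> 1"
proof -
  have "wkernel_odd_mass d \<le> (LINT z|lborel. wkernel z)"
    unfolding wkernel_odd_mass_def
  proof (rule integral_mono)
    show "integrable lborel (\<lambda>z. wkernel z * sgn (d - z))"
      using integrable_wkernel_mult[of "\<lambda>z. sgn (d + z)" 1 0] abs_sgn_le_1 integrable_reflect[of "\<lambda>z. wkernel (0 - z) * sgn (d + z)" 0]
      by simp
    show "integrable lborel wkernel" using has_bochner_integral_wkernel by (simp add: has_bochner_integral_iff)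
    show "wkernel z * sgn (d - z) \<le> wkernel z" for z
      using wkernel_nonneg[of z] by (auto simp: sgn_if)
  qed
  then show ?thesis using has_bochner_integral_wkernel by (simp add: has_bochner_integral_iff)
qed

text \<open>At distance 0 the integrand is odd, so the dominated limit vanishes.\<close>

lemma wkernel_odd_mass_tendsto_0:
  assumes "d \<longlonglongrightarrow> 0"
  shows "(\<lambda>n. wkernel_odd_mass (d n)) \<longlonglongrightarrow> 0"
proof -
  have "(\<lambda>n. wkernel_odd_mass (d n)) \<longlonglongrightarrow> (LINT z|lborel. wkernel z * sgn (0 - z))"
    unfolding wkernel_odd_mass_def
  proof (rule integral_dominated_convergence)
    show "integrable lborel wkernel" using has_bochner_integral_wkernel by (simp add: has_bochner_integral_iff)
    have "AE z in lborel. z \<noteq> (0::real)" by (rule AE_lborel_singleton)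
    then show "AE z in lborel. (\<lambda>n. wkernel z * sgn (d n - z)) \<longlonglongrightarrow> wkernel z * sgn (0 - z)"
      by eventually_elim (intro tendsto_intros assms, auto)
    show "AE z in lborel. norm (wkernel z * sgn (d n - z)) \<le> wkernel z" for n
      using wkernel_nonneg by (intro AE_I2) (auto simp: sgn_if abs_mult)
  qed measurable
  moreover have "(LINT z|lborel. wkernel z * sgn (0 - z)) = 0"
    using integral_reflect[of "\<lambda>z. wkernel z * sgn (0 - z)" 0] by (simp add: wkernel_minus sgn_minus)
  ultimately show ?thesis by simp
qed

text \<open>The step function \<open>M * sgn (y - l)\<close> minus \<open>f\<close> is odd about the
  plane and nonnegative to its right, so its convolution is nonnegative there.\<close>

lemma wconv_odd_le:
  assumes f: "f \<in> borel_measurable borel" "\<And>y. \<bar>f y\<bar> \<le> B" and odd: "\<And>y. f (2 * l - y) = - f y"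
    and le: "\<And>y. y > l \<Longrightarrow> f y \<le> M" and x: "x > l"
  shows "wconv f x \<le> M * wkernel_odd_mass (x - l)"
proof -
  define g where "g = (\<lambda>y. M * sgn (y - l))"
  have g: "g \<in> borel_measurable borel" "\<And>y. \<bar>g y\<bar> \<le> \<bar>M\<bar>"
    unfolding g_def by (measurable, auto simp: sgn_if)
  have gf: "\<bar>g y - f y\<bar> \<le> \<bar>M\<bar> + B" for y using g(2)[of y] f(2)[of y] by linarith
  have "sgn (2 * l - y - l) = - sgn (y - l)" for y by (simp add: sgn_if)
  then have "0 \<le> wconv (\<lambda>y. g y - f y) x"
    using le odd x f(1) g(1) by (intro wconv_odd_nonneg(1)[where l = l, OF _ gf]) (auto simp: g_def)
  also have "\<dots> = wconv g x - wconv f x"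
    by (rule wconv_diff[OF g f])
  also have "wconv g x = M * wkernel_odd_mass (x - l)"
  proof -
    have "wconv (\<lambda>y. sgn (y - l)) x = wkernel_odd_mass (x - l)"
      unfolding wconv_def wkernel_odd_mass_def
      using integral_reflect[of "\<lambda>y. wkernel y * sgn (x - l - y)" x] by (simp add: algebra_simps)
    then show ?thesis unfolding g_def by (simp add: wconv_cmult)
  qed
  finally show ?thesis by simp
qed

section \<open>Positivity, decay and the reflection maximum principle\<close>

lemma attains_positive_max:
  fixes g :: "real \<Rightarrow> real"
  assumes "closed S" "continuous_on S g" "x1 \<in> S" "g x1 > 0" "(g \<longlongrightarrow> 0) at_infinity"
  shows "\<exists>x\<in>S. g x > 0 \<and> (\<forall>y\<in>S. g y \<le> g x)"
proof -
  have "\<forall>\<^sub>F x in at_infinity. g x < g x1"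
    using assms(4,5) by (rule order_tendstoD(2)[rotated])
  then obtain R where R: "\<And>x. norm x \<ge> R \<Longrightarrow> g x < g x1"
    by (auto simp: eventually_at_infinity)
  have x1: "x1 \<in> S \<inter> cball 0 (max R \<bar>x1\<bar>)" using assms(3) by auto
  have "compact (S \<inter> cball 0 (max R \<bar>x1\<bar>))" using assms(1) by (intro closed_Int_compact) auto
  then obtain x where x: "x \<in> S \<inter> cball 0 (max R \<bar>x1\<bar>)"
    "\<And>y. y \<in> S \<inter> cball 0 (max R \<bar>x1\<bar>) \<Longrightarrow> g y \<le> g x"
    using continuous_attains_sup[of "S \<inter> cball 0 (max R \<bar>x1\<bar>)" g] x1 continuous_on_subset[OF assms(2)] by blast
  have "g x1 \<le> g x" using x(2)[OF x1] .
  moreover have "g y \<le> g x" if "y \<in> S" for y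
  proof (cases "norm y \<ge> R")
    case True
    then show ?thesis using R[of y] \<open>g x1 \<le> g x\<close> by simp
  next
    case False
    then show ?thesis using that by (intro x(2)) auto
  qed
  ultimately show ?thesis using x(1) assms(4) by (intro bexI[of _ x]) auto
qed

lemma wconv_zero_imp_AE:
  assumes f: "f \<in> borel_measurable borel" "\<And>y. \<bar>f y\<bar> \<le> B" "\<And>y. f y \<ge> 0" and "wconv f x = 0"
  shows "AE y in lborel. f y = 0"
proof -
  have "AE y in lborel. wkernel (x - y) * f y = 0"
    using assms(4) integral_nonneg_eq_0_iff_AE[OF integrable_wkernel_mult[OF f(1,2), of x]] wkernel_nonneg f(3)
    by (simp add: wconv_def)
  moreover have "AE y in lborel. y \<noteq> x" by (rule AE_lborel_singleton)
  ultimately show ?thesis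
  proof eventually_elim
    case (elim y)
    then show ?case using wkernel_pos[of "x - y"] by auto
  qed
qed

text \<open>The triangle inequality moves the weight from \<open>y\<close> to \<open>x\<close> at
  the price of \<open>exp (\<eta> * \<bar>x - y\<bar>)\<close>, which the exponential moment
  absorbs.\<close>

lemma wconv_exp_le:
  assumes "0 \<le> \<eta>" "\<eta> < 1"
  shows "wconv (\<lambda>y. exp (- (\<eta> * \<bar>y\<bar>))) x \<le> 1 / (1 - \<eta>) * exp (- (\<eta> * \<bar>x\<bar>))"
proof -
  define g where "g = (\<lambda>z. wkernel z * exp (\<eta> * \<bar>z\<bar>))"
  have g: "integrable lborel g" "integral\<^sup>L lborel g \<le> 1 / (1 - \<eta>)"
    unfolding g_def using wkernel_exp_moment[OF assms] by auto
  have "wconv (\<lambda>y. exp (- (\<eta> * \<bar>y\<bar>))) x \<le> (LINT y|lborel. exp (- (\<eta> * \<bar>x\<bar>)) * g (x - y))"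
    unfolding wconv_def
  proof (rule integral_mono)
    show "integrable lborel (\<lambda>y. wkernel (x - y) * exp (- (\<eta> * \<bar>y\<bar>)))"
      using assms by (intro integrable_wkernel_mult[where B=1]) auto
    show "integrable lborel (\<lambda>y. exp (- (\<eta> * \<bar>x\<bar>)) * g (x - y))"
      by (intro integrable_mult_right integrable_reflect g)
    fix y
    have "\<eta> * \<bar>x\<bar> \<le> \<eta> * (\<bar>x - y\<bar> + \<bar>y\<bar>)" using assms by (intro mult_left_mono) auto
    then have "exp (- (\<eta> * \<bar>y\<bar>)) \<le> exp (- (\<eta> * \<bar>x\<bar>)) * exp (\<eta> * \<bar>x - y\<bar>)"
      by (subst exp_add[symmetric]) (simp add: algebra_simps)
    then have "wkernel (x - y) * exp (- (\<eta> * \<bar>y\<bar>)) \<le> wkernel (x - y) * (exp (- (\<eta> * \<bar>x\<bar>)) * exp (\<eta> * \<bar>x - y\<bar>))"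
      by (intro mult_left_mono wkernel_nonneg)
    then show "wkernel (x - y) * exp (- (\<eta> * \<bar>y\<bar>)) \<le> exp (- (\<eta> * \<bar>x\<bar>)) * g (x - y)"
      by (simp add: g_def mult_ac)
  qed
  also have "\<dots> = exp (- (\<eta> * \<bar>x\<bar>)) * integral\<^sup>L lborel g"
    using integral_reflect[of g x] by simp
  also have "\<dots> \<le> exp (- (\<eta> * \<bar>x\<bar>)) * (1 / (1 - \<eta>))"
    using g(2) by (intro mult_left_mono) auto
  finally show ?thesis by (simp add: mult.commute)
qed

lemma tendsto_at_infinity_reflect:
  fixes f :: "real \<Rightarrow> real"
  assumes "(f \<longlongrightarrow> L) at_infinity"
  shows "((\<lambda>y. f (a - y)) \<longlongrightarrow> L) at_infinity"
proof (rule filterlim_compose[OF assms])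
  show "filterlim (\<lambda>y. a - y) at_infinity at_infinity"
    unfolding filterlim_at_infinity[OF order_refl]
  proof (intro allI impI)
    fix r :: real assume "0 < r"
    show "\<forall>\<^sub>F x in at_infinity. r \<le> norm (a - x)"
      unfolding eventually_at_infinity by (intro exI[of _ "r + \<bar>a\<bar>"]) auto
  qed
qed

text \<open>A locale, because the degenerate case is treated by interpreting it a second time for a
  translate of the wave. \<open>nontrivial\<close> excludes the zero solution, for which the plane
  never stops.\<close>

locale solitary_wave =
  fixes c :: real and \<phi> :: "real \<Rightarrow> real"
  assumes c_gt_1: "c > 1"
    and continuous: "continuous_on UNIV \<phi>"
    and bounded: "bounded (range \<phi>)"
    and equation: "\<phi> x * (c - \<phi> x) = wconv \<phi> x"
    and vanishing: "(\<phi> \<longlongrightarrow> 0) at_infinity"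
    and nontrivial: "\<exists>x. \<phi> x \<noteq> 0"
begin

lemma measurable [measurable]: "\<phi> \<in> borel_measurable borel"
  by (rule borel_measurable_continuous_onI[OF continuous])

definition bound :: real where "bound = (SOME B. \<forall>y. \<bar>\<phi> y\<bar> \<le> B)"

lemma abs_le_bound: "\<bar>\<phi> y\<bar> \<le> bound"
proof -
  obtain B where "\<forall>y. \<bar>\<phi> y\<bar> \<le> B" using bounded by (auto simp: bounded_iff)
  then have "\<forall>y. \<bar>\<phi> y\<bar> \<le> bound" unfolding bound_def by (rule someI)
  then show ?thesis by blast
qed

text \<open>At a negative minimum the convolution, a weighted mean, is at least the minimal value,
  whereas the factor \<open>c - \<phi> z > 1\<close> makes \<open>\<phi> z * (c - \<phi> z)\<close>
  smaller than it.\<close>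

lemma nonneg: "\<phi> x \<ge> 0"
proof (rule ccontr)
  assume "\<not> \<phi> x \<ge> 0"
  then have "- \<phi> x > 0" by simp
  moreover have "((\<lambda>x. - \<phi> x) \<longlongrightarrow> 0) at_infinity" using tendsto_minus[OF vanishing] by simp
  ultimately obtain z where z: "- \<phi> z > 0" "\<And>y. - \<phi> y \<le> - \<phi> z"
    using attains_positive_max[of UNIV "\<lambda>x. - \<phi> x" x] continuous_on_minus[OF continuous] by auto
  have "wconv (\<lambda>_. \<phi> z) z \<le> wconv \<phi> z"
    using z(2) abs_le_bound by (intro wconv_mono[where B="bound" and C="bound"]) auto
  then have "\<phi> z \<le> \<phi> z * (c - \<phi> z)" by (simp add: wconv_const equation)
  then have "0 \<le> \<phi> z * (c - \<phi> z - 1)" by (simp add: algebra_simps)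
  moreover have "\<phi> z * (c - \<phi> z - 1) < 0" using z(1) c_gt_1 by (intro mult_neg_pos) auto
  ultimately show False by simp
qed

lemma positive: "\<phi> x > 0"
proof (rule ccontr)
  assume "\<not> \<phi> x > 0"
  then have "\<phi> x = 0" using nonneg[of x] by simp
  then have "wconv \<phi> x = 0" using equation[of x] by simp
  then have "AE y in lborel. \<phi> y = 0"
    by (intro wconv_zero_imp_AE[OF _ abs_le_bound nonneg]) auto
  then have "\<phi> y = 0" for y by (rule continuous_AE_zero_imp_zero[OF continuous])
  with nontrivial show False by simp
qed

text \<open>Comparison with the barrier \<open>A * E\<close>. The rate \<eta> is tuned so that
  convolution multiplies \<open>E\<close> by at most \<open>c1\<close>, while far out the equation
  gives \<open>c1 * \<phi> \<le> wconv \<phi>\<close>. At a positive maximum \<open>M\<close> of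
  \<open>\<phi> - A * E\<close> the two yield \<open>c1 * M \<le> M\<close>, against
  \<open>c1 > 1\<close>.\<close>

lemma exponential_decay: "decays_exponentially \<phi>"
proof -
  define c1 where "c1 = (1 + c) / 2"
  define \<eta> where "\<eta> = 1 - 1 / c1"
  have c1: "1 < c1" "c1 < c" using c_gt_1 by (auto simp: c1_def)
  have \<eta>: "0 < \<eta>" "\<eta> < 1" "1 / (1 - \<eta>) = c1" using c1 by (auto simp: \<eta>_def)
  have "\<forall>\<^sub>F x in at_infinity. \<phi> x < c - c1"
    using vanishing c1 by (intro order_tendstoD(2)) auto
  then obtain R where R: "\<And>x. \<bar>x\<bar> \<ge> R \<Longrightarrow> \<phi> x < c - c1"
    by (auto simp: eventually_at_infinity)
  \<comment> \<open>With this \<open>A\<close> the barrier is at least \<open>bound\<close> on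
    [-R, R], which forces the maximum into the region where \<open>c - \<phi>\<close> exceeds
    \<open>c1\<close>.\<close>
  define A where "A = bound * exp (\<eta> * \<bar>R\<bar>)"
  have bound0: "0 \<le> bound" using abs_le_bound[of 0] by linarith
  then have A: "A \<ge> 0" by (simp add: A_def)
  define E where "E = (\<lambda>x::real. exp (- (\<eta> * \<bar>x\<bar>)))"
  have E: "0 < E x" "\<bar>E x\<bar> \<le> 1" for x using \<eta> by (auto simp: E_def)
  have [measurable]: "E \<in> borel_measurable borel" unfolding E_def by measurable
  have "\<phi> x \<le> A * E x" for x
  proof (rule ccontr)
    assume "\<not> \<phi> x \<le> A * E x"
    then have pos: "\<phi> x - A * E x > 0" by simp
    have "((\<lambda>x. \<phi> x - A * E x) \<longlongrightarrow> 0 - A * 0) at_infinity"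
    proof (intro tendsto_intros vanishing)
      have "filterlim (\<lambda>x::real. \<eta> * \<bar>x\<bar>) at_top at_infinity"
        using \<eta> by (intro filterlim_tendsto_pos_mult_at_top[OF tendsto_const]) (auto simp: filterlim_norm_at_top simp flip: real_norm_def)
      then show "(E \<longlongrightarrow> 0) at_infinity"
        unfolding E_def by (intro filterlim_compose[OF exp_at_bot]) (simp add: filterlim_uminus_at_bot)
    qed
    moreover have "continuous_on UNIV (\<lambda>x. \<phi> x - A * E x)"
      unfolding E_def by (intro continuous_intros continuous)
    ultimately obtain z where z: "\<phi> z - A * E z > 0" "\<And>y. \<phi> y - A * E y \<le> \<phi> z - A * E z"
      using attains_positive_max[of UNIV "\<lambda>x. \<phi> x - A * E x" x] pos by auto
    define M where "M = \<phi> z - A * E z"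
    have "\<bar>z\<bar> \<ge> R"
    proof (rule ccontr)
      assume "\<not> \<bar>z\<bar> \<ge> R"
      then have "\<eta> * \<bar>z\<bar> \<le> \<eta> * \<bar>R\<bar>" using \<eta> by (intro mult_left_mono) auto
      then have "1 \<le> exp (\<eta> * \<bar>R\<bar>) * E z" by (simp add: E_def exp_add[symmetric])
      then have "bound * 1 \<le> bound * (exp (\<eta> * \<bar>R\<bar>) * E z)" using bound0 by (intro mult_left_mono)
      then have "bound \<le> A * E z" by (simp add: A_def mult.assoc)
      then show False using z(1) abs_le_bound[of z] by linarith
    qed
    then have "c1 \<le> c - \<phi> z" using R[of z] by simp
    then have "c1 * \<phi> z \<le> \<phi> z * (c - \<phi> z)"
      using nonneg[of z] by (subst mult.commute) (rule mult_left_mono)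
    also have "\<dots> = wconv \<phi> z" by (rule equation)
    also have "\<dots> \<le> wconv (\<lambda>y. A * E y + M) z"
    proof (rule wconv_mono)
      show "\<bar>\<phi> y\<bar> \<le> bound" for y by (rule abs_le_bound)
      show "\<bar>A * E y + M\<bar> \<le> A + \<bar>M\<bar>" for y
      proof -
        have "\<bar>A * E y\<bar> \<le> A * 1"
          using mult_left_mono[OF E(2)[of y] A] A by (simp add: abs_mult)
        then show ?thesis by linarith
      qed
      show "\<phi> y \<le> A * E y + M" for y using z(2)[of y] by (simp add: M_def)
    qed auto
    also have "\<dots> = A * wconv E z + M"
    proof -
      have "\<bar>A * E y\<bar> \<le> A * 1" for y
        using mult_left_mono[OF E(2)[of y] A] A by (simp add: abs_mult)
      then have "wconv (\<lambda>y. A * E y + M) z = wconv (\<lambda>y. A * E y) z + wconv (\<lambda>y. M) z"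
        by (intro wconv_add[where C="\<bar>M\<bar>"]) auto
      then show ?thesis by (simp add: wconv_cmult wconv_const)
    qed
    also have "\<dots> \<le> A * (c1 * E z) + M"
      using wconv_exp_le[of \<eta> z] \<eta> A by (intro add_right_mono mult_left_mono) (auto simp: E_def)
    finally have "c1 * (A * E z + M) \<le> A * (c1 * E z) + M" by (simp add: M_def)
    then have "c1 * M \<le> 1 * M" by (simp add: algebra_simps)
    then show False using z(1) c1 by (simp add: M_def)
  qed
  then show ?thesis
    unfolding decays_exponentially_def using \<eta>(1) nonneg
    by (intro exI[of _ \<eta>] conjI exI[of _ A]) (auto simp: E_def abs_of_nonneg)
qed

lemma wconv_reflection_diff:
  "wconv (\<lambda>y. \<phi> (2 * l - y) - \<phi> y) x = (\<phi> (2 * l - x) - \<phi> x) * (c - \<phi> x - \<phi> (2 * l - x))"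
proof -
  have "wconv (\<lambda>y. \<phi> (2 * l - y) - \<phi> y) x = wconv (\<lambda>y. \<phi> (2 * l - y)) x - wconv \<phi> x"
    by (intro wconv_diff[where B=bound and C=bound] abs_le_bound) auto
  also have "\<dots> = \<phi> (2 * l - x) * (c - \<phi> (2 * l - x)) - \<phi> x * (c - \<phi> x)"
    by (simp only: wconv_reflect equation)
  finally show ?thesis by (simp add: algebra_simps)
qed

lemma continuous_reflection_diff: "continuous_on S (\<lambda>y. \<phi> (2 * l - y) - \<phi> y)"
  by (intro continuous_intros continuous_on_compose2[OF continuous] continuous_on_subset[OF continuous]) auto

lemma reflection_max_principle:
  assumes "x0 > l" "\<phi> x0 < \<phi> (2 * l - x0)"
  shows "\<exists>x>l. \<phi> x < \<phi> (2 * l - x) \<and> c - \<phi> x - \<phi> (2 * l - x) \<le> wkernel_odd_mass (x - l)"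
proof -
  define w where "w = (\<lambda>y. \<phi> (2 * l - y) - \<phi> y)"
  have cont: "continuous_on S w" for S unfolding w_def by (rule continuous_reflection_diff)
  have "(w \<longlongrightarrow> 0 - 0) at_infinity"
    unfolding w_def by (intro tendsto_diff vanishing tendsto_at_infinity_reflect)
  then obtain x where x: "x \<ge> l" "w x > 0" "\<And>y. y \<ge> l \<Longrightarrow> w y \<le> w x"
    using attains_positive_max[of "{l..}" w x0] cont assms by (auto simp: w_def)
  have "w l = 0" by (simp add: w_def)
  with x have xl: "x > l" by (cases "x = l") auto
  have "\<bar>w y\<bar> \<le> bound + bound" for y
    using abs_le_bound[of y] abs_le_bound[of "2 * l - y"] by (simp add: w_def)
  then have "wconv w x \<le> w x * wkernel_odd_mass (x - l)"
    using x xl borel_measurable_continuous_onI[OF cont]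
    by (intro wconv_odd_le) (auto simp: w_def)
  moreover have "wconv w x = w x * (c - \<phi> x - \<phi> (2 * l - x))"
    unfolding w_def by (rule wconv_reflection_diff)
  ultimately have "c - \<phi> x - \<phi> (2 * l - x) \<le> wkernel_odd_mass (x - l)"
    using x(2) by simp
  then show ?thesis using xl x(2) by (intro exI[of _ x]) (auto simp: w_def)
qed

text \<open>A strong maximum principle: unless the odd difference \<open>f\<close> vanishes
  identically, its convolution is positive right of the plane. This convolution is
  \<open>f x\<close> times the factor, and \<open>f x \<ge> 0\<close>, so both are positive. The
  sign of the factor leaves \<open>\<phi> l = c / 2\<close> as the only way to lose positivity on
  the plane itself.\<close>

lemma touching:
  assumes ge: "\<And>y. y > l \<Longrightarrow> \<phi> (2 * l - y) \<le> \<phi> y"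
    and ne: "y0 > l" "\<phi> y0 \<noteq> \<phi> (2 * l - y0)" and x: "x > l"
  shows "\<phi> (2 * l - x) < \<phi> x" "\<phi> x + \<phi> (2 * l - x) < c"
proof -
  define w where "w = (\<lambda>y. \<phi> (2 * l - y) - \<phi> y)"
  define f where "f = (\<lambda>y. - w y)"
  have cont: "continuous_on UNIV w" unfolding w_def by (rule continuous_reflection_diff)
  have [measurable]: "w \<in> borel_measurable borel" by (rule borel_measurable_continuous_onI[OF cont])
  have bnd: "\<bar>f y\<bar> \<le> bound + bound" for y
    using abs_le_bound[of y] abs_le_bound[of "2 * l - y"] by (simp add: w_def f_def)
  have odd: "f (2 * l - y) = - f y" for y by (simp add: f_def w_def)
  have fnn: "f y \<ge> 0" if "y > l" for y using ge[OF that] by (simp add: f_def w_def)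
  have [measurable]: "f \<in> borel_measurable borel" unfolding f_def by measurable
  note A = wconv_odd_nonneg[where f=f and l=l and x=x, OF _ bnd odd fnn x]
  have "wconv f x \<noteq> 0"
  proof
    assume "wconv f x = 0"
    with A(2) have "AE y in lborel. f y = 0" by simp
    then have "f y0 = 0"
      unfolding f_def by (rule continuous_AE_zero_imp_zero[OF continuous_on_minus[OF cont]])
    then show False using ne by (simp add: f_def w_def)
  qed
  with A(1) have pos: "wconv f x > 0" by simp
  have "wconv f x = f x * (c - \<phi> x - \<phi> (2 * l - x))"
  proof -
    have "wconv w x = w x * (c - \<phi> x - \<phi> (2 * l - x))"
      unfolding w_def by (rule wconv_reflection_diff)
    then show ?thesis by (simp add: f_def wconv_uminus)
  qed
  with pos fnn[OF x] have "f x > 0" "c - \<phi> x - \<phi> (2 * l - x) > 0"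
    by (auto simp: zero_less_mult_iff)
  then show "\<phi> (2 * l - x) < \<phi> x" "\<phi> x + \<phi> (2 * l - x) < c" by (auto simp: f_def w_def)
qed

end

section \<open>The singularity of the kernel\<close>

text \<open>Otherwise \<open>sqrt \<xi> * m(\<xi>) = sqrt (tanh \<xi>)\<close> would tend to \<open>0\<close> by dominated convergence.\<close>

lemma stieltjes_inverse_sqrt_not_integrable:
  "\<not> integrable lborel (\<lambda>s. \<rho> s / sqrt \<bar>s\<bar>)"
proof
  assume int: "integrable lborel (\<lambda>s. \<rho> s / sqrt \<bar>s\<bar>)"
  define f where "f = (\<lambda>(n::nat) s. \<rho> s / sqrt \<bar>s\<bar> *
      (sqrt \<bar>s\<bar> * (2 * \<bar>s\<bar> / (s\<^sup>2 + (real (Suc n))\<^sup>2)) * sqrt (real (Suc n))))"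
  have f_eq: "f n s = \<rho> s * (2 * \<bar>s\<bar> / (s\<^sup>2 + (real (Suc n))\<^sup>2)) * sqrt (real (Suc n))" for n s
    using stieltjes_density_zero_or[of s] by (auto simp: f_def)
  have "(\<lambda>n. integral\<^sup>L lborel (f n)) \<longlonglongrightarrow> integral\<^sup>L lborel (\<lambda>s::real. 0::real)"
  proof (rule integral_dominated_convergence)
    show "integrable lborel (\<lambda>s. 2 * (\<rho> s / sqrt \<bar>s\<bar>))"
      using int by (rule integrable_mult_right)
    show "AE s in lborel. (\<lambda>n. f n s) \<longlonglongrightarrow> 0"
    proof (intro AE_I2)
      fix s :: real
      have "(\<lambda>n. 2 * \<bar>s\<bar> / (s\<^sup>2 + (real (Suc n))\<^sup>2) * sqrt (real (Suc n))) \<longlonglongrightarrow> 0"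
        by real_asymp
      from tendsto_mult_left[OF this, of "\<rho> s"]
      show "(\<lambda>n. f n s) \<longlonglongrightarrow> 0" by (simp add: f_eq mult.assoc)
    qed
    show "AE s in lborel. norm (f n s) \<le> 2 * (\<rho> s / sqrt \<bar>s\<bar>)" for n
    proof (intro AE_I2)
      fix s :: real
      define a where "a = \<bar>s\<bar>"
      define x where "x = real (Suc n)"
      have x: "x > 0" and a: "a \<ge> 0" by (auto simp: x_def a_def)
      \<comment> \<open>Both sides are homogeneous of degree 2 in (a, x), which is why the majorant
        is independent of \<open>n\<close>.\<close>
      have "sqrt a * a * sqrt x \<le> a\<^sup>2 + x\<^sup>2"
      proof -
        have "sqrt a * a * sqrt x \<le> sqrt (max a x) * max a x * sqrt (max a x)"
          using a x by (intro mult_mono) auto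
        also have "\<dots> = (max a x)\<^sup>2"
          using a x by (simp add: power2_eq_square mult.commute mult.left_commute)
        also have "\<dots> \<le> a\<^sup>2 + x\<^sup>2" by (auto simp: max_def)
        finally show ?thesis .
      qed
      then have "sqrt a * a * sqrt x / (a\<^sup>2 + x\<^sup>2) \<le> 1"
        using x by (simp add: divide_le_eq add_nonneg_pos)
      moreover have "sqrt a * (2 * a / (a\<^sup>2 + x\<^sup>2)) * sqrt x = 2 * (sqrt a * a * sqrt x / (a\<^sup>2 + x\<^sup>2))" by simp
      ultimately have 1: "sqrt a * (2 * a / (a\<^sup>2 + x\<^sup>2)) * sqrt x \<le> 2" by linarith
      have nn: "0 \<le> sqrt a * (2 * a / (a\<^sup>2 + x\<^sup>2)) * sqrt x" using a x by simp
      have 2: "0 \<le> \<rho> s / sqrt a"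
        using stieltjes_density_nonneg a by (intro divide_nonneg_nonneg) auto
      have "f n s = \<rho> s / sqrt a * (sqrt a * (2 * a / (a\<^sup>2 + x\<^sup>2)) * sqrt x)"
        by (simp add: f_def a_def x_def)
      moreover have "\<dots> \<le> \<rho> s / sqrt a * 2" using 1 2 by (rule mult_left_mono)
      moreover have "0 \<le> \<rho> s / sqrt a * (sqrt a * (2 * a / (a\<^sup>2 + x\<^sup>2)) * sqrt x)"
        using 2 nn by (rule mult_nonneg_nonneg)
      ultimately have "\<bar>f n s\<bar> \<le> \<rho> s / sqrt a * 2" by linarith
      then show "norm (f n s) \<le> 2 * (\<rho> s / sqrt \<bar>s\<bar>)" by (simp add: a_def mult.commute)
    qed
  qed (auto simp: f_def)
  moreover have "integral\<^sup>L lborel (f n) = sqrt (tanh (real (Suc n)))" for n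
  proof -
    have "integral\<^sup>L lborel (f n) = whitham_symbol (real (Suc n)) * sqrt (real (Suc n))"
      unfolding f_eq[abs_def]
      by (simp only: integral_mult_left_zero has_bochner_integral_integral_eq[OF whitham_symbol_stieltjes])
    also have "\<dots> = sqrt (tanh (real (Suc n)) / real (Suc n) * real (Suc n))"
      unfolding real_sqrt_mult by (simp add: whitham_symbol_def del: of_nat_Suc)
    finally show ?thesis by (simp del: of_nat_Suc)
  qed
  ultimately have "(\<lambda>n. sqrt (tanh (real (Suc n)))) \<longlonglongrightarrow> 0" by simp
  moreover have "(\<lambda>n. sqrt (tanh (real (Suc n)))) \<longlonglongrightarrow> sqrt 1"
  proof (intro tendsto_real_sqrt filterlim_compose[OF tanh_real_at_top])
    show "filterlim (\<lambda>n. real (Suc n)) at_top sequentially" by real_asymp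
  qed
  ultimately show False using LIMSEQ_unique by fastforce
qed

lemma nn_integral_inverse_sqrt:
  assumes "b \<ge> 0"
  shows "(\<integral>\<^sup>+t. ennreal (indicator {0..b} t * (1 / sqrt \<bar>t\<bar>)) \<partial>lborel) = ennreal (2 * sqrt b)"
proof -
  have "((\<lambda>t. t powr (-(1/2))) has_integral (b powr (-(1/2) + 1) / (-(1/2) + 1))) {0..b}"
    using assms by (intro has_integral_powr_from_0) auto
  then have "((\<lambda>t. 1 / sqrt \<bar>t\<bar>) has_integral (b powr (-(1/2) + 1) / (-(1/2) + 1))) {0..b}"
    by (rule has_integral_eq[rotated]) (simp add: powr_minus_divide powr_half_sqrt)
  then have "((\<lambda>t. 1 / sqrt \<bar>t\<bar>) has_integral (2 * sqrt b)) {0..b}"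
    using assms by (simp add: powr_half_sqrt mult.commute)
  then have "((\<lambda>t. if t \<in> {0..b} then 1 / sqrt \<bar>t\<bar> else 0) has_integral (2 * sqrt b)) UNIV"
    by (subst has_integral_restrict_UNIV)
  also have "(\<lambda>t. if t \<in> {0..b} then 1 / sqrt \<bar>t\<bar> else 0) = (\<lambda>t. indicator {0..b} t * (1 / sqrt \<bar>t\<bar>))"
    by (auto simp: fun_eq_iff indicator_def)
  finally show ?thesis
    by (intro nn_integral_has_integral_lborel) auto
qed

text \<open>
  The symbol is compared with the kernel by integrating it over \<open>[0, 1/\<bar>x\<bar>]\<close>: for each single \<open>s\<close> this
  integral of \<open>2\<bar>s\<bar> / (s\<^sup>2 + t\<^sup>2)\<close> exceeds \<open>exp (- \<bar>s\<bar>\<bar>x\<bar>)\<close>.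
\<close>

lemma wkernel_le:
  assumes "x \<noteq> 0"
  shows "wkernel x \<le> 2 / sqrt \<bar>x\<bar>"
proof -
  define b where "b = 1 / \<bar>x\<bar>"
  have b: "b > 0" using assms by (simp add: b_def)
  have sym: "ennreal (whitham_symbol t) = (\<integral>\<^sup>+s. ennreal (\<rho> s * (2 * \<bar>s\<bar> / (s\<^sup>2 + t\<^sup>2))) \<partial>lborel)" for t
    using whitham_symbol_stieltjes[of t] stieltjes_density_nonneg
    by (subst nn_integral_eq_integral) (auto simp: has_bochner_integral_iff)
  have "ennreal (wkernel x) = (\<integral>\<^sup>+s. ennreal (\<rho> s * exp (- (\<bar>s\<bar> * \<bar>x\<bar>))) \<partial>lborel)"
    by (rule ennreal_wkernel[OF assms])
  also have "\<dots> \<le> (\<integral>\<^sup>+s. (\<integral>\<^sup>+t. ennreal (indicator {0..b} t * (\<rho> s * (2 * \<bar>s\<bar> / (s\<^sup>2 + t\<^sup>2)))) \<partial>lborel) \<partial>lborel)"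
  proof (rule nn_integral_mono)
    fix s :: real
    consider "\<rho> s = 0" | "\<bar>s\<bar> > 1" using stieltjes_density_zero_or by blast
    then show "ennreal (\<rho> s * exp (- (\<bar>s\<bar> * \<bar>x\<bar>))) \<le>
        (\<integral>\<^sup>+t. ennreal (indicator {0..b} t * (\<rho> s * (2 * \<bar>s\<bar> / (s\<^sup>2 + t\<^sup>2)))) \<partial>lborel)"
    proof cases
      case 2
      \<comment> \<open>For \<open>t \<le> u\<close> the integrand is at least
        \<open>\<rho> s / \<bar>s\<bar>\<close>, so the inner integral is at least
        \<open>\<rho> s\<close> times the minimum of 1 and
        \<open>1 / (\<bar>s\<bar> * \<bar>x\<bar>)\<close>, and this minimum dominates the
        exponential.\<close>
      define u where "u = min b \<bar>s\<bar>"
      have u: "u > 0" "u \<le> b" "u \<le> \<bar>s\<bar>" using 2 b by (auto simp: u_def)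
      have "exp (- (\<bar>s\<bar> * \<bar>x\<bar>)) \<le> 1 / \<bar>s\<bar> * u"
      proof (cases "b \<le> \<bar>s\<bar>")
        case True
        have "\<bar>s\<bar> * \<bar>x\<bar> > 0" using 2 assms by simp
        moreover have "\<bar>s\<bar> * \<bar>x\<bar> \<le> exp (\<bar>s\<bar> * \<bar>x\<bar>)" using exp_ge_add_one_self[of "\<bar>s\<bar> * \<bar>x\<bar>"] by linarith
        ultimately have "inverse (exp (\<bar>s\<bar> * \<bar>x\<bar>)) \<le> inverse (\<bar>s\<bar> * \<bar>x\<bar>)" by (rule le_imp_inverse_le[rotated])
        then show ?thesis using True by (simp add: u_def b_def exp_minus min_absorb1 divide_inverse)
      next
        case False
        then show ?thesis using 2 by (simp add: u_def)
      qed
      then have "\<rho> s * exp (- (\<bar>s\<bar> * \<bar>x\<bar>)) \<le> \<rho> s / \<bar>s\<bar> * u"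
        using stieltjes_density_nonneg[of s] mult_left_mono by fastforce
      then have "ennreal (\<rho> s * exp (- (\<bar>s\<bar> * \<bar>x\<bar>))) \<le> ennreal (\<rho> s / \<bar>s\<bar>) * ennreal u"
        using stieltjes_density_nonneg[of s] u by (subst ennreal_mult[symmetric]) (auto intro: ennreal_leI)
      also have "\<dots> = (\<integral>\<^sup>+t. ennreal (\<rho> s / \<bar>s\<bar>) * indicator {0..u} t \<partial>lborel)"
        using u by (subst nn_integral_cmult_indicator) auto
      also have "\<dots> \<le> (\<integral>\<^sup>+t. ennreal (indicator {0..b} t * (\<rho> s * (2 * \<bar>s\<bar> / (s\<^sup>2 + t\<^sup>2)))) \<partial>lborel)"
      proof (rule nn_integral_mono)
        fix t :: real
        show "ennreal (\<rho> s / \<bar>s\<bar>) * indicator {0..u} t \<le> ennreal (indicator {0..b} t * (\<rho> s * (2 * \<bar>s\<bar> / (s\<^sup>2 + t\<^sup>2))))"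
        proof (cases "t \<in> {0..u}")
          case True
          then have "t\<^sup>2 \<le> \<bar>s\<bar>\<^sup>2" using u by (intro power_mono) auto
          then have "2 * \<bar>s\<bar> / (2 * \<bar>s\<bar>\<^sup>2) \<le> 2 * \<bar>s\<bar> / (s\<^sup>2 + t\<^sup>2)"
            using 2 by (intro divide_left_mono mult_pos_pos add_pos_nonneg) auto
          moreover have "2 * a / (2 * a\<^sup>2) = 1 / a" for a :: real by (simp add: power2_eq_square)
          then have "2 * \<bar>s\<bar> / (2 * \<bar>s\<bar>\<^sup>2) = 1 / \<bar>s\<bar>" .
          ultimately have "\<rho> s * (1 / \<bar>s\<bar>) \<le> \<rho> s * (2 * \<bar>s\<bar> / (s\<^sup>2 + t\<^sup>2))"
            by (intro mult_left_mono stieltjes_density_nonneg) simp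
          then show ?thesis using True u by (simp add: ennreal_leI)
        qed simp
      qed
      finally show ?thesis .
    qed simp
  qed
  also have "\<dots> = (\<integral>\<^sup>+t. (\<integral>\<^sup>+s. ennreal (indicator {0..b} t * (\<rho> s * (2 * \<bar>s\<bar> / (s\<^sup>2 + t\<^sup>2)))) \<partial>lborel) \<partial>lborel)"
    by (rule lborel_pair.Fubini') measurable
  also have "\<dots> = (\<integral>\<^sup>+t. ennreal (indicator {0..b} t * whitham_symbol t) \<partial>lborel)"
  proof (rule nn_integral_cong)
    fix t :: real
    show "(\<integral>\<^sup>+s. ennreal (indicator {0..b} t * (\<rho> s * (2 * \<bar>s\<bar> / (s\<^sup>2 + t\<^sup>2)))) \<partial>lborel) =
      ennreal (indicator {0..b} t * whitham_symbol t)"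
      by (cases "t \<in> {0..b}") (auto simp: sym)
  qed
  also have "\<dots> \<le> (\<integral>\<^sup>+t. ennreal (indicator {0..b} t * (1 / sqrt \<bar>t\<bar>)) \<partial>lborel)"
  proof (rule nn_integral_mono_AE)
    have "AE t in lborel. t \<noteq> (0::real)" by (rule AE_lborel_singleton)
    then show "AE t in lborel. ennreal (indicator {0..b} t * whitham_symbol t) \<le> ennreal (indicator {0..b} t * (1 / sqrt \<bar>t\<bar>))"
    proof eventually_elim
      case (elim t)
      show ?case
      proof (cases "t > 0")
        case True
        have "tanh t \<le> 1" using tanh_real_lt_1[of t] by simp
        then have "sqrt (tanh t / t) \<le> sqrt (1 / t)" using True by (intro real_sqrt_le_mono divide_right_mono) auto
        then show ?thesis using True
          by (intro ennreal_leI mult_left_mono) (auto simp: whitham_symbol_def real_sqrt_divide)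
      next
        case False
        then show ?thesis using elim by (simp add: indicator_def)
      qed
    qed
  qed
  also have "\<dots> = ennreal (2 * sqrt b)" using b by (intro nn_integral_inverse_sqrt) simp
  finally have "wkernel x \<le> 2 * sqrt b" using b by (subst (asm) ennreal_le_iff) auto
  then show ?thesis by (simp add: b_def real_sqrt_divide)
qed

section \<open>First and second differences of the kernel\<close>

lemma exp_second_difference_le:
  fixes v :: real
  assumes "v \<ge> 0"
  shows "exp v + exp (- v) - 2 \<le> v\<^sup>2 * exp v"
proof -
  have "exp v + exp (- v) - 2 = exp v * (1 - exp (- v))\<^sup>2"
  proof -
    have "p * (1 - q)\<^sup>2 = p - 2 * (p * q) + (p * q) * q" for p q :: real
      by (simp add: power2_eq_square algebra_simps)
    then show ?thesis using exp_minus_inverse[of v] by simp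
  qed
  also have "\<dots> \<le> exp v * v\<^sup>2"
    using assms exp_ge_add_one_self[of "- v"] by (intro mult_left_mono power_mono) auto
  finally show ?thesis by (simp add: mult.commute)
qed

text \<open>As \<open>y - t \<ge> y / 2\<close>, the exponential splits into two of argument
  \<open>y / 4\<close>: one absorbs \<open>s\<^sup>2\<close> at the cost of
  \<open>32 / y\<^sup>2\<close>, the other integrates to
  \<open>wkernel (y / 4) \<le> 4 / sqrt y\<close>.\<close>

lemma wkernel_second_difference_le:
  assumes "t > 0" "y \<ge> 2 * t"
  shows "wkernel (y + t) + wkernel (y - t) - 2 * wkernel y \<le> 128 * t\<^sup>2 / (y\<^sup>2 * sqrt y)"
proof -
  have y: "y > 0" using assms by simp
  have int: "integrable lborel (\<lambda>s. \<rho> s * exp (- (\<bar>s\<bar> * z)))" if "z > 0" for z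
    using integrable_stieltjes_exp0[of z] that by simp
  have k: "wkernel z = (LINT s|lborel. \<rho> s * exp (- (\<bar>s\<bar> * z)))" if "z > 0" for z
    using that by (simp add: wkernel_def)
  have "wkernel (y + t) + wkernel (y - t) - 2 * wkernel y =
     (LINT s|lborel. \<rho> s * exp (- (\<bar>s\<bar> * (y + t))) + \<rho> s * exp (- (\<bar>s\<bar> * (y - t))) - 2 * (\<rho> s * exp (- (\<bar>s\<bar> * y))))"
    using assms y int[of "y + t"] int[of "y - t"] int[of y] k[of "y + t"] k[of "y - t"] k[of y] by simp
  also have "\<dots> \<le> (LINT s|lborel. (32 * t\<^sup>2 / y\<^sup>2) * (\<rho> s * exp (- (\<bar>s\<bar> * (y / 4)))))"
  proof (rule integral_mono)
    show "integrable lborel (\<lambda>s. \<rho> s * exp (- (\<bar>s\<bar> * (y + t))) + \<rho> s * exp (- (\<bar>s\<bar> * (y - t))) - 2 * (\<rho> s * exp (- (\<bar>s\<bar> * y))))"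
      using assms y by (intro Bochner_Integration.integrable_add Bochner_Integration.integrable_diff integrable_mult_right int) auto
    show "integrable lborel (\<lambda>s. (32 * t\<^sup>2 / y\<^sup>2) * (\<rho> s * exp (- (\<bar>s\<bar> * (y / 4)))))"
      using y by (intro integrable_mult_right int) auto
    fix s :: real
    define a where "a = \<bar>s\<bar>"
    have a: "a \<ge> 0" by (simp add: a_def)
    have "exp (- (a * (y + t))) + exp (- (a * (y - t))) - 2 * exp (- (a * y)) =
        exp (- (a * y)) * (exp (a * t) + exp (- (a * t)) - 2)"
      by (simp add: algebra_simps exp_add[symmetric])
    also have "\<dots> \<le> exp (- (a * y)) * ((a * t)\<^sup>2 * exp (a * t))"
      using a assms by (intro mult_left_mono exp_second_difference_le) auto
    also have "\<dots> = t\<^sup>2 * (a\<^sup>2 * exp (- (a * (y - t))))"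
      by (simp add: algebra_simps exp_add[symmetric] power_mult_distrib)
    also have "\<dots> \<le> t\<^sup>2 * (a\<^sup>2 * (exp (- (a * (y / 4))) * exp (- (a * (y / 4)))))"
    proof -
      have "a * (y / 2) \<le> a * (y - t)" using a assms by (intro mult_left_mono) auto
      then show ?thesis by (intro mult_left_mono) (auto simp: exp_add[symmetric] algebra_simps)
    qed
    also have "\<dots> = t\<^sup>2 * (a\<^sup>2 * exp (- (a * (y / 4)))) * exp (- (a * (y / 4)))" by simp
    also have "\<dots> \<le> t\<^sup>2 * (fact 2 / (y / 4)\<^sup>2) * exp (- (a * (y / 4)))"
      using a y by (intro mult_right_mono mult_left_mono power_exp_minus_le) auto
    also have "\<dots> = (32 * t\<^sup>2 / y\<^sup>2) * exp (- (a * (y / 4)))"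
      by (simp add: power_divide fact_2)
    finally have "\<rho> s * (exp (- (a * (y + t))) + exp (- (a * (y - t))) - 2 * exp (- (a * y))) \<le>
        \<rho> s * ((32 * t\<^sup>2 / y\<^sup>2) * exp (- (a * (y / 4))))"
      by (intro mult_left_mono stieltjes_density_nonneg)
    then show "\<rho> s * exp (- (\<bar>s\<bar> * (y + t))) + \<rho> s * exp (- (\<bar>s\<bar> * (y - t))) - 2 * (\<rho> s * exp (- (\<bar>s\<bar> * y)))
       \<le> (32 * t\<^sup>2 / y\<^sup>2) * (\<rho> s * exp (- (\<bar>s\<bar> * (y / 4))))"
      by (simp add: a_def algebra_simps)
  qed
  also have "\<dots> = (32 * t\<^sup>2 / y\<^sup>2) * wkernel (y / 4)"
    using y k[of "y / 4"] by simp
  also have "\<dots> \<le> (32 * t\<^sup>2 / y\<^sup>2) * (2 / sqrt \<bar>y / 4\<bar>)"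
    using y by (intro mult_left_mono wkernel_le) auto
  also have "\<dots> = 128 * t\<^sup>2 / (y\<^sup>2 * sqrt y)"
    using y by (simp add: real_sqrt_divide)
  finally show ?thesis .
qed

text \<open>For \<open>y > 0\<close> this is the formal value of \<open>- wkernel'\<close>,
  differentiated under the integral; only the difference estimate below is used, no
  derivative.\<close>

definition wkernel_slope :: "real \<Rightarrow> real" where
  "wkernel_slope y = (LINT s|lborel. \<rho> s * (\<bar>s\<bar> * exp (- (\<bar>s\<bar> * y))))"

lemma wkernel_slope_measurable [measurable]: "wkernel_slope \<in> borel_measurable borel"
  unfolding wkernel_slope_def[abs_def] by measurable

lemma integrable_wkernel_slope:
  "y > 0 \<Longrightarrow> integrable lborel (\<lambda>s. \<rho> s * (\<bar>s\<bar> * exp (- (\<bar>s\<bar> * y))))"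
  using integrable_stieltjes_exp[of y 1] by simp

lemma wkernel_slope_pos: "y > 0 \<Longrightarrow> wkernel_slope y > 0"
  unfolding wkernel_slope_def by (intro stieltjes_integral_pos integrable_wkernel_slope) auto

lemma wkernel_slope_antimono:
  assumes "0 < y" "y \<le> z"
  shows "wkernel_slope z \<le> wkernel_slope y"
  unfolding wkernel_slope_def
proof (rule integral_mono)
  fix s :: real
  have "\<bar>s\<bar> * y \<le> \<bar>s\<bar> * z" using assms by (intro mult_left_mono) auto
  then show "\<rho> s * (\<bar>s\<bar> * exp (- (\<bar>s\<bar> * z))) \<le> \<rho> s * (\<bar>s\<bar> * exp (- (\<bar>s\<bar> * y)))"
    by (intro mult_left_mono stieltjes_density_nonneg) auto
qed (use assms in \<open>auto intro!: integrable_wkernel_slope\<close>)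

text \<open>For each exponential the difference over [y - t, y + t] is
  \<open>exp (- (\<bar>s\<bar> * y))\<close> times \<open>2 * sinh v\<close> with
  \<open>v = \<bar>s\<bar> * t\<close>, and \<open>sinh v \<ge> v\<close>.\<close>

lemma wkernel_difference_ge:
  assumes "0 < t" "t < y"
  shows "2 * t * wkernel_slope y \<le> wkernel (y - t) - wkernel (y + t)"
proof -
  have y: "y > 0" using assms by simp
  have int: "integrable lborel (\<lambda>s. \<rho> s * exp (- (\<bar>s\<bar> * z)))" if "z > 0" for z
    using integrable_stieltjes_exp0[of z] that by simp
  have k: "wkernel z = (LINT s|lborel. \<rho> s * exp (- (\<bar>s\<bar> * z)))" if "z > 0" for z
    using that by (simp add: wkernel_def)
  have "2 * t * wkernel_slope y = (LINT s|lborel. 2 * t * (\<rho> s * (\<bar>s\<bar> * exp (- (\<bar>s\<bar> * y)))))"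
    by (simp add: wkernel_slope_def)
  also have "\<dots> \<le> (LINT s|lborel. \<rho> s * exp (- (\<bar>s\<bar> * (y - t))) - \<rho> s * exp (- (\<bar>s\<bar> * (y + t))))"
  proof (rule integral_mono)
    show "integrable lborel (\<lambda>s. 2 * t * (\<rho> s * (\<bar>s\<bar> * exp (- (\<bar>s\<bar> * y)))))"
      using y by (intro integrable_mult_right integrable_wkernel_slope)
    show "integrable lborel (\<lambda>s. \<rho> s * exp (- (\<bar>s\<bar> * (y - t))) - \<rho> s * exp (- (\<bar>s\<bar> * (y + t))))"
      using assms y by (intro Bochner_Integration.integrable_diff int) auto
    fix s :: real
    define v where "v = \<bar>s\<bar> * t"
    have "v \<ge> 0" using assms by (simp add: v_def)
    then have "2 * v \<le> exp v - exp (- v)" using real_le_x_sinh[of v] by (simp add: exp_minus)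
    then have "exp (- (\<bar>s\<bar> * y)) * (2 * v) \<le> exp (- (\<bar>s\<bar> * y)) * (exp v - exp (- v))"
      by (intro mult_left_mono) auto
    also have "\<dots> = exp (- (\<bar>s\<bar> * (y - t))) - exp (- (\<bar>s\<bar> * (y + t)))"
      by (simp add: v_def algebra_simps exp_add[symmetric])
    finally have "\<rho> s * (exp (- (\<bar>s\<bar> * y)) * (2 * v)) \<le>
        \<rho> s * (exp (- (\<bar>s\<bar> * (y - t))) - exp (- (\<bar>s\<bar> * (y + t))))"
      by (intro mult_left_mono stieltjes_density_nonneg)
    then show "2 * t * (\<rho> s * (\<bar>s\<bar> * exp (- (\<bar>s\<bar> * y)))) \<le>
       \<rho> s * exp (- (\<bar>s\<bar> * (y - t))) - \<rho> s * exp (- (\<bar>s\<bar> * (y + t)))"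
      by (simp add: v_def algebra_simps)
  qed
  also have "\<dots> = wkernel (y - t) - wkernel (y + t)"
    using assms y int[of "y + t"] int[of "y - t"] k[of "y + t"] k[of "y - t"] by simp
  finally show ?thesis .
qed

text \<open>Heuristically the integrand is of order \<open>1 / y\<close>; this divergence stands for
  the logarithm in the degenerate case. Tonelli reduces it to the density: over \<open>y\<close>,
  the exponential of rate \<open>\<bar>s\<bar>\<close> contributes at least a multiple of
  \<open>\<rho> s / sqrt \<bar>s\<bar>\<close>, which is not integrable.\<close>

lemma wkernel_slope_sqrt_nn_integral:
  "(\<integral>\<^sup>+y. ennreal (indicator {0<..<1} y * (wkernel_slope y * sqrt y)) \<partial>lborel) = \<infinity>"
proof (rule ccontr)
  assume "(\<integral>\<^sup>+y. ennreal (indicator {0<..<1} y * (wkernel_slope y * sqrt y)) \<partial>lborel) \<noteq> \<infinity>"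
  then have fin: "(\<integral>\<^sup>+y. ennreal (indicator {0<..<1} y * (wkernel_slope y * sqrt y)) \<partial>lborel) < \<infinity>"
    by (simp add: less_top)
  \<comment> \<open>Only \<open>y\<close> between \<open>1 / (2 * a)\<close> and
    \<open>1 / a\<close> is kept, for \<open>a = \<bar>s\<bar>\<close>: the length is
    \<open>1 / (2 * a)\<close>, \<open>sqrt y\<close> is at least \<open>1 / sqrt (2 * a)\<close>,
    and the exponential is at least \<open>exp (-1)\<close>.\<close>
  define C :: real where "C = exp (-1) / (2 * sqrt 2)"
  have C: "C > 0" by (simp add: C_def)
  have "(\<integral>\<^sup>+s. ennreal (C * (\<rho> s / sqrt \<bar>s\<bar>)) \<partial>lborel) \<le>
     (\<integral>\<^sup>+s. (\<integral>\<^sup>+y. ennreal (indicator {0<..<1} y * sqrt y * (\<rho> s * (\<bar>s\<bar> * exp (- (\<bar>s\<bar> * y))))) \<partial>lborel) \<partial>lborel)"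
  proof (rule nn_integral_mono)
    fix s :: real
    consider "\<rho> s = 0" | "\<bar>s\<bar> > 1" using stieltjes_density_zero_or by blast
    then show "ennreal (C * (\<rho> s / sqrt \<bar>s\<bar>)) \<le>
      (\<integral>\<^sup>+y. ennreal (indicator {0<..<1} y * sqrt y * (\<rho> s * (\<bar>s\<bar> * exp (- (\<bar>s\<bar> * y))))) \<partial>lborel)"
    proof cases
      case 2
      define a where "a = \<bar>s\<bar>"
      have a: "a > 1" using 2 by (simp add: a_def)
      define D where "D = sqrt (1 / (2 * a)) * (\<rho> s * (a * exp (- 1)))"
      have D: "D \<ge> 0" using a stieltjes_density_nonneg[of s] by (simp add: D_def)
      have "C * (\<rho> s / sqrt a) = D * (1 / (2 * a))"
        using a by (simp add: C_def D_def real_sqrt_divide real_sqrt_mult field_simps)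
      then have "ennreal (C * (\<rho> s / sqrt a)) = ennreal D * ennreal (1 / (2 * a))"
        using D a by (simp add: ennreal_mult[symmetric])
      also have "ennreal (1 / (2 * a)) = emeasure lborel {1 / (2 * a)<..<1 / a}"
        using a by (subst emeasure_lborel_Ioo) (auto simp: field_simps)
      also have "ennreal D * emeasure lborel {1 / (2 * a)<..<1 / a} = (\<integral>\<^sup>+y. ennreal D * indicator {1 / (2 * a)<..<1 / a} y \<partial>lborel)"
        by (subst nn_integral_cmult_indicator) auto
      also have "\<dots> \<le> (\<integral>\<^sup>+y. ennreal (indicator {0<..<1} y * sqrt y * (\<rho> s * (\<bar>s\<bar> * exp (- (\<bar>s\<bar> * y))))) \<partial>lborel)"
      proof (rule nn_integral_mono)
        fix y :: real
        show "ennreal D * indicator {1 / (2 * a)<..<1 / a} y \<le> ennreal (indicator {0<..<1} y * sqrt y * (\<rho> s * (\<bar>s\<bar> * exp (- (\<bar>s\<bar> * y)))))"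
        proof (cases "y \<in> {1 / (2 * a)<..<1 / a}")
          case True
          have "1 / a < 1" "0 < 1 / (2 * a)" using a by auto
          then have y: "0 < y" "y < 1"
            using True by (auto simp del: divide_less_eq_1_pos intro: less_trans)
          have "a * y \<le> 1" using True a by (auto simp: field_simps)
          then have "D \<le> sqrt y * (\<rho> s * (a * exp (- (a * y))))"
            unfolding D_def using True a stieltjes_density_nonneg[of s]
            by (intro mult_mono real_sqrt_le_mono) auto
          then show ?thesis using True y by (simp add: a_def ennreal_leI)
        qed simp
      qed
      finally show ?thesis by (simp add: a_def)
    qed simp
  qed
  also have "\<dots> = (\<integral>\<^sup>+y. (\<integral>\<^sup>+s. ennreal (indicator {0<..<1} y * sqrt y * (\<rho> s * (\<bar>s\<bar> * exp (- (\<bar>s\<bar> * y))))) \<partial>lborel) \<partial>lborel)"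
    by (rule lborel_pair.Fubini') measurable
  also have "\<dots> = (\<integral>\<^sup>+y. ennreal (indicator {0<..<1} y * (wkernel_slope y * sqrt y)) \<partial>lborel)"
  proof (rule nn_integral_cong)
    fix y :: real
    show "(\<integral>\<^sup>+s. ennreal (indicator {0<..<1} y * sqrt y * (\<rho> s * (\<bar>s\<bar> * exp (- (\<bar>s\<bar> * y))))) \<partial>lborel) =
       ennreal (indicator {0<..<1} y * (wkernel_slope y * sqrt y))"
    proof (cases "y \<in> {0<..<1}")
      case True
      then show ?thesis
        using stieltjes_density_nonneg integrable_mult_right[OF integrable_wkernel_slope[of y], of "sqrt y"]
        by (subst nn_integral_eq_integral) (auto simp: wkernel_slope_def mult.commute)
    qed simp
  qed
  finally have "(\<integral>\<^sup>+s. ennreal (C * (\<rho> s / sqrt \<bar>s\<bar>)) \<partial>lborel) < \<infinity>"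
    using fin by (rule order_le_less_trans)
  then have "integrable lborel (\<lambda>s. C * (\<rho> s / sqrt \<bar>s\<bar>))"
    using C stieltjes_density_nonneg by (intro integrableI_nonneg) auto
  then have "integrable lborel (\<lambda>s. 1 / C * (C * (\<rho> s / sqrt \<bar>s\<bar>)))"
    by (rule integrable_mult_right)
  then have "integrable lborel (\<lambda>s. \<rho> s / sqrt \<bar>s\<bar>)"
    using C by simp
  then show False using stieltjes_inverse_sqrt_not_integrable by simp
qed

section \<open>The crest height is not attained by an asymmetric profile\<close>

text \<open>Up to the scaling by \<open>t\<close>, a bound for the second difference of the kernel with step \<open>t\<close>.\<close>

definition cusp_weight :: "real \<Rightarrow> real" where
  "cusp_weight z = (if \<bar>z\<bar> < 2 then 2 / sqrt \<bar>1 - \<bar>z\<bar>\<bar> else 128 / (z\<^sup>2 * sqrt \<bar>z\<bar>))"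

lemma cusp_weight_measurable [measurable]: "cusp_weight \<in> borel_measurable borel"
  unfolding cusp_weight_def[abs_def] by measurable

lemma cusp_weight_nonneg: "cusp_weight z \<ge> 0"
  by (simp add: cusp_weight_def)

text \<open>The weight has inverse square root singularities at 1 and -1 and decays like the power
  -5/2, leaving the power -2 after the factor \<open>1 + sqrt \<bar>z\<bar>\<close>, which carries
  the growth of the convolved function. Below 2 that factor is at most 3, whence
  \<open>6 = 2 * 3\<close>.\<close>

lemma integrable_cusp_weight: "integrable lborel (\<lambda>z. cusp_weight z * (1 + sqrt \<bar>z\<bar>))"
proof (rule Bochner_Integration.integrable_bound)
  define g where "g = (\<lambda>t::real. indicator {-1..1} t * (1 / sqrt \<bar>t\<bar>))"
  have g: "integrable lborel g"
    using set_integrable_inverse_sqrt[of 1] by (simp add: g_def set_integrable_def)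
  have gnn: "g t \<ge> 0" for t by (simp add: g_def)
  have g1: "integrable lborel (\<lambda>z. g (1 - z))" using g by (rule integrable_reflect)
  have g2: "integrable lborel (\<lambda>z. g (1 + z))"
    using lborel_integrable_real_affine[OF g, of 1 1] by simp
  have q: "integrable lborel (\<lambda>z::real. inverse (1 + z\<^sup>2))"
    using integrable_inverse_1_plus_square by (simp add: set_integrable_def einterval_eq)
  show "integrable lborel (\<lambda>z. 6 * (g (1 - z) + g (1 + z)) + 512 * inverse (1 + z\<^sup>2))"
    using g1 g2 q by (intro Bochner_Integration.integrable_add integrable_mult_right)
  show "AE z in lborel. norm (cusp_weight z * (1 + sqrt \<bar>z\<bar>)) \<le> norm (6 * (g (1 - z) + g (1 + z)) + 512 * inverse (1 + z\<^sup>2))"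
  proof (intro AE_I2)
    fix z :: real
    have inv: "inverse (1 + z\<^sup>2) \<ge> 0" by simp
    have "cusp_weight z * (1 + sqrt \<bar>z\<bar>) \<le> 6 * (g (1 - z) + g (1 + z)) + 512 * inverse (1 + z\<^sup>2)"
    proof (cases "\<bar>z\<bar> < 2")
      case True
      have "1 / sqrt \<bar>1 - \<bar>z\<bar>\<bar> \<le> g (1 - z) + g (1 + z)"
      proof (cases "z \<ge> 0")
        case z: True
        then have "1 / sqrt \<bar>1 - \<bar>z\<bar>\<bar> = g (1 - z)" using True by (simp add: g_def indicator_def)
        then show ?thesis using gnn[of "1 + z"] by simp
      next
        case z: False
        then have "1 / sqrt \<bar>1 - \<bar>z\<bar>\<bar> = g (1 + z)" using True by (simp add: g_def indicator_def)
        then show ?thesis using gnn[of "1 - z"] by simp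
      qed
      moreover have "sqrt \<bar>z\<bar> \<le> 2"
        using True real_sqrt_le_mono[of "\<bar>z\<bar>" "2\<^sup>2"] by (simp del: real_sqrt_le_iff)
      ultimately have "2 * (1 / sqrt \<bar>1 - \<bar>z\<bar>\<bar>) * (1 + sqrt \<bar>z\<bar>) \<le> 2 * (g (1 - z) + g (1 + z)) * 3"
        using gnn[of "1 - z"] gnn[of "1 + z"] by (intro mult_mono) auto
      moreover have "cusp_weight z * (1 + sqrt \<bar>z\<bar>) = 2 * (1 / sqrt \<bar>1 - \<bar>z\<bar>\<bar>) * (1 + sqrt \<bar>z\<bar>)"
        using True by (simp add: cusp_weight_def)
      ultimately show ?thesis using inv by linarith
    next
      case False
      then have z: "\<bar>z\<bar> \<ge> 2" by simp
      then have s1: "sqrt \<bar>z\<bar> \<ge> 1" by simp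
      have z1: "1 \<le> z\<^sup>2" using z power_mono[of 1 "\<bar>z\<bar>" 2] by simp
      have "cusp_weight z * (1 + sqrt \<bar>z\<bar>) = 128 / z\<^sup>2 * ((1 + sqrt \<bar>z\<bar>) / sqrt \<bar>z\<bar>)"
        using z by (simp add: cusp_weight_def)
      also have "\<dots> \<le> 128 / z\<^sup>2 * 2"
        using s1 by (intro mult_left_mono) (auto simp: divide_le_eq)
      also have "\<dots> = 256 / z\<^sup>2" by simp
      also have "\<dots> \<le> 512 / (1 + z\<^sup>2)"
        using z1 by (simp add: divide_simps)
      finally show ?thesis using gnn[of "1 - z"] gnn[of "1 + z"] by (simp add: divide_inverse)
    qed
    moreover have "0 \<le> cusp_weight z * (1 + sqrt \<bar>z\<bar>)"
      using cusp_weight_nonneg by simp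
    ultimately show "norm (cusp_weight z * (1 + sqrt \<bar>z\<bar>)) \<le> norm (6 * (g (1 - z) + g (1 + z)) + 512 * inverse (1 + z\<^sup>2))"
      by simp
  qed
qed measurable

definition cusp_constant :: real where
  "cusp_constant = (LINT z|lborel. cusp_weight z * (1 + sqrt \<bar>z\<bar>))"

lemma cusp_constant_nonneg: "cusp_constant \<ge> 0"
  unfolding cusp_constant_def
  by (intro Bochner_Integration.integral_nonneg mult_nonneg_nonneg cusp_weight_nonneg) simp

text \<open>For \<open>\<bar>y\<bar> < 2 * t\<close> nothing cancels:
  \<open>wkernel (u + t) - 2 * wkernel u\<close> is nonpositive and is dropped, and the remaining
  term has the bound of \<open>wkernel_le\<close>. Beyond that the second difference estimate
  applies.\<close>

lemma wkernel_second_difference_weight: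
  assumes t: "t > 0" and y: "y \<noteq> 0" "\<bar>y\<bar> \<noteq> t"
  shows "wkernel (t - y) + wkernel (t + y) - 2 * wkernel y \<le> cusp_weight (y / t) / sqrt t"
proof -
  define u where "u = \<bar>y\<bar>"
  have u: "u > 0" "u \<noteq> t" using y by (auto simp: u_def)
  have eq: "wkernel (t - y) + wkernel (t + y) - 2 * wkernel y = wkernel (u - t) + wkernel (u + t) - 2 * wkernel u"
  proof -
    have "t - y = - (y - t)" "- y - t = - (t + y)" by simp_all
    then have "wkernel (t - y) = wkernel (y - t)" "wkernel (- y - t) = wkernel (t + y)"
      by (simp_all only: wkernel_minus)
    then show ?thesis
      by (cases "y \<ge> 0") (simp_all add: u_def wkernel_minus add.commute)
  qed
  have yt: "\<bar>y / t\<bar> = u / t" using t by (simp add: u_def)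
  show ?thesis
  proof (cases "u < 2 * t")
    case True
    have "wkernel (u + t) \<le> wkernel u"
      using wkernel_strict_antimono[of u "u + t"] u t by simp
    moreover have "0 \<le> wkernel u" by (rule wkernel_nonneg)
    moreover have "wkernel (u - t) \<le> 2 / sqrt \<bar>u - t\<bar>" using u by (intro wkernel_le) simp
    moreover have "2 / sqrt \<bar>u - t\<bar> = cusp_weight (y / t) / sqrt t"
    proof -
      have "\<bar>u - t\<bar> = \<bar>1 - u / t\<bar> * t"
      proof -
        have "\<bar>1 - u / t\<bar> * t = \<bar>(1 - u / t) * t\<bar>" using t by (simp add: abs_mult)
        also have "(1 - u / t) * t = t - u" using t by (simp add: left_diff_distrib)
        finally show ?thesis by (simp add: abs_minus_commute)
      qed
      moreover have "\<bar>y / t\<bar> < 2" unfolding yt using True t by (simp add: divide_less_eq)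
      ultimately show ?thesis
        by (simp add: cusp_weight_def yt real_sqrt_mult del: abs_divide)
    qed
    ultimately show ?thesis unfolding eq by linarith
  next
    case False
    have "wkernel (u - t) + wkernel (u + t) - 2 * wkernel u \<le> 128 * t\<^sup>2 / (u\<^sup>2 * sqrt u)"
      using wkernel_second_difference_le[of t u] False t by simp
    also have "\<dots> = cusp_weight (y / t) / sqrt t"
    proof -
      have "\<not> \<bar>y / t\<bar> < 2" unfolding yt using False t by (simp add: divide_less_eq)
      moreover have "(y / t)\<^sup>2 = u\<^sup>2 / t\<^sup>2" by (simp add: u_def power_divide)
      ultimately show ?thesis using t
        by (simp add: cusp_weight_def yt real_sqrt_divide del: abs_divide)
    qed
    finally show ?thesis unfolding eq .
  qed
qed

text \<open>Evenness of \<open>S\<close> turns the left side into the integral of \<open>S\<close>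
  against a second difference of the kernel with step \<open>t\<close>. After the substitution
  \<open>y = t * z\<close> the kernel part scales like \<open>sqrt t\<close>, and \<open>S\<close>
  contributes at most \<open>b * (sqrt t + e) * (1 + sqrt \<bar>z\<bar>)\<close>.\<close>

lemma wconv_even_difference_le:
  assumes S: "S \<in> borel_measurable borel" "\<And>y. \<bar>S y\<bar> \<le> B" "\<And>y. S y \<ge> 0" "\<And>y. S (- y) = S y"
    and t: "t > 0" and e: "e \<ge> 0" and b: "b \<ge> 0" "\<And>y. S y \<le> b * (sqrt \<bar>y\<bar> + e)"
  shows "2 * (wconv S t - wconv S 0) \<le> b * cusp_constant * (sqrt t + e)\<^sup>2"
proof -
  have [measurable]: "S \<in> borel_measurable borel" by fact
  define G where "G = (\<lambda>z. cusp_weight z * (1 + sqrt \<bar>z\<bar>))"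
  have G: "integrable lborel G" unfolding G_def by (rule integrable_cusp_weight)
  define C where "C = b * (sqrt t + e) / sqrt t"
  have int: "integrable lborel (\<lambda>y. wkernel (x - y) * S y)" for x
    using S by (intro integrable_wkernel_mult) auto
  have int': "integrable lborel (\<lambda>y. wkernel (t + y) * S y)"
  proof -
    have "(\<lambda>y. wkernel (t + y) * S y) = (\<lambda>y. wkernel (- t - y) * S y)"
      using wkernel_minus[of "t + y" for y] by (simp add: fun_eq_iff)
    then show ?thesis using int[of "- t"] by (simp only:)
  qed
  have "wconv S t = wconv S (- t)"
    using wconv_reflect[of S 0 t] by (simp add: S(4))
  also have "\<dots> = (LINT y|lborel. wkernel (t + y) * S y)"
  proof -
    have "wkernel (- t - y) = wkernel (t + y)" for y
      using wkernel_minus[of "t + y"] by (simp add: algebra_simps)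
    then show ?thesis by (simp add: wconv_def)
  qed
  finally have w2: "wconv S t = (LINT y|lborel. wkernel (t + y) * S y)" .
  have w0: "wconv S 0 = (LINT y|lborel. wkernel y * S y)"
    by (simp add: wconv_def wkernel_minus)
  have int0: "integrable lborel (\<lambda>y. wkernel y * S y)" using int[of 0] by (simp add: wkernel_minus)
  have "2 * (wconv S t - wconv S 0) = wconv S t + wconv S t - 2 * wconv S 0" by simp
  also have "\<dots> = (LINT y|lborel. wkernel (t - y) * S y) + (LINT y|lborel. wkernel (t + y) * S y) - 2 * (LINT y|lborel. wkernel y * S y)"
    by (simp only: w2[symmetric] w0[symmetric]) (simp add: wconv_def)
  also have "\<dots> = (LINT y|lborel. wkernel (t - y) * S y + wkernel (t + y) * S y - 2 * (wkernel y * S y))"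
    using int int' int0 by simp
  also have "\<dots> \<le> (LINT y|lborel. C * G (0 + (1 / t) * y))"
  proof (rule integral_mono_AE)
    show "integrable lborel (\<lambda>y. wkernel (t - y) * S y + wkernel (t + y) * S y - 2 * (wkernel y * S y))"
      using int int' int0 by simp
    show "integrable lborel (\<lambda>y. C * G (0 + (1 / t) * y))"
      using G t by (intro integrable_mult_right lborel_integrable_real_affine) auto
    have "AE y in lborel. y \<noteq> 0 \<and> y \<noteq> t \<and> y \<noteq> - t"
      by (intro AE_conjI AE_lborel_singleton)
    then show "AE y in lborel. wkernel (t - y) * S y + wkernel (t + y) * S y - 2 * (wkernel y * S y) \<le> C * G (0 + (1 / t) * y)"
    proof eventually_elim
      case (elim y)
      have "wkernel (t - y) * S y + wkernel (t + y) * S y - 2 * (wkernel y * S y) =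
          (wkernel (t - y) + wkernel (t + y) - 2 * wkernel y) * S y" by (simp add: algebra_simps)
      also have "\<dots> \<le> cusp_weight (y / t) / sqrt t * S y"
        using elim t S(3) by (intro mult_right_mono wkernel_second_difference_weight) auto
      also have "\<dots> \<le> cusp_weight (y / t) / sqrt t * (b * ((sqrt t + e) * (1 + sqrt \<bar>y / t\<bar>)))"
      proof (intro mult_left_mono)
        have "S y \<le> b * (sqrt \<bar>y\<bar> + e)" by (rule b(2))
        also have "\<dots> \<le> b * ((sqrt t + e) * (1 + sqrt \<bar>y / t\<bar>))"
        proof (rule mult_left_mono[OF _ b(1)])
          have "sqrt t * sqrt \<bar>y / t\<bar> = sqrt \<bar>y\<bar>"
            using t by (simp add: real_sqrt_mult[symmetric] abs_divide)
          moreover have "0 \<le> sqrt t" "0 \<le> e * sqrt \<bar>y / t\<bar>" using t e by auto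
          ultimately show "sqrt \<bar>y\<bar> + e \<le> (sqrt t + e) * (1 + sqrt \<bar>y / t\<bar>)"
            by (simp add: algebra_simps)
        qed
        finally show "S y \<le> b * ((sqrt t + e) * (1 + sqrt \<bar>y / t\<bar>))" .
      qed (use t cusp_weight_nonneg in auto)
      also have "\<dots> = C * G (0 + (1 / t) * y)"
        by (simp add: C_def G_def)
      finally show ?case .
    qed
  qed
  also have "\<dots> = C * (t * integral\<^sup>L lborel G)"
  proof -
    have "integral\<^sup>L lborel G = \<bar>1 / t\<bar> *\<^sub>R (LINT y|lborel. G (0 + (1 / t) * y))"
      using t by (intro lborel_integral_real_affine) simp
    then show ?thesis using t by simp
  qed
  also have "\<dots> = b * (sqrt t + e) * sqrt t * cusp_constant"
  proof -
    have "C * (t * X) = b * (sqrt t + e) * (t / sqrt t) * X" for X by (simp add: C_def)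
    then show ?thesis using t by (simp only: real_div_sqrt less_imp_le cusp_constant_def G_def)
  qed
  also have "\<dots> \<le> b * (sqrt t + e) * (sqrt t + e) * cusp_constant"
    using b(1) e t cusp_constant_nonneg by (intro mult_right_mono mult_left_mono) auto
  finally show ?thesis by (simp add: power2_eq_square mult_ac)
qed

text \<open>Of the nonnegative integrand in \<open>wconv_odd\<close> only the part right of
  \<open>t\<close> is kept, where the kernel difference has a lower bound by the slope. Extended
  reals spare a proof that the smaller integral is finite.\<close>

lemma wconv_odd_ge:
  assumes f: "f \<in> borel_measurable borel" "\<And>y. \<bar>f y\<bar> \<le> B" and odd: "\<And>y. f (- y) = - f y"
    and nonneg: "\<And>y. y > 0 \<Longrightarrow> f y \<ge> 0" and t: "t > 0"
  shows "(\<integral>\<^sup>+y. ennreal (indicator {t<..} y * (2 * t * wkernel_slope y * f y)) \<partial>lborel) \<le> ennreal (2 * wconv f t)"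
proof -
  define h where "h = (\<lambda>y. (wkernel (t - y) - wkernel (t + y - 2 * 0)) * f y)"
  have odd0: "f (2 * 0 - y) = - f y" for y using odd by simp
  have ae: "AE y in lborel. y \<noteq> t \<and> y \<noteq> 2 * 0 - t"
    by (intro AE_conjI AE_lborel_singleton)
  have ae_nn: "AE y in lborel. 0 \<le> h y"
    using ae unfolding h_def
    by eventually_elim (use wconv_odd_integrand(1)[where f = f and l = 0, OF odd0 nonneg t] in auto)
  have int: "integrable lborel h" and eq: "2 * wconv f t = integral\<^sup>L lborel h"
    unfolding h_def using wconv_odd[where l = 0, OF f odd0] by auto
  have "(\<integral>\<^sup>+y. ennreal (indicator {t<..} y * (2 * t * wkernel_slope y * f y)) \<partial>lborel) \<le> (\<integral>\<^sup>+y. ennreal (h y) \<partial>lborel)"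
  proof (rule nn_integral_mono_AE)
    show "AE y in lborel. ennreal (indicator {t<..} y * (2 * t * wkernel_slope y * f y)) \<le> ennreal (h y)"
      using ae_nn
    proof eventually_elim
      case (elim y)
      show ?case
      proof (cases "y > t")
        case True
        have "2 * t * wkernel_slope y * f y \<le> (wkernel (y - t) - wkernel (y + t)) * f y"
          using True t nonneg[of y] by (intro mult_right_mono wkernel_difference_ge) auto
        also have "\<dots> = h y" using wkernel_minus[of "y - t"] by (simp add: h_def add.commute)
        finally show ?thesis using True by (simp add: ennreal_leI)
      qed simp
    qed
  qed
  also have "\<dots> = ennreal (integral\<^sup>L lborel h)" by (rule nn_integral_eq_integral[OF int ae_nn])
  finally show ?thesis by (simp add: eq)
qed

section \<open>Square root estimates at a crest of height c/2\<close>

context solitary_wave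
begin

context
  assumes crest: "\<phi> 0 = c / 2"
    and asym: "\<And>t. t > 0 \<Longrightarrow> \<phi> (- t) < \<phi> t"
    and sum_less: "\<And>t. t > 0 \<Longrightarrow> \<phi> t + \<phi> (- t) < c"
begin

text \<open>\<open>gap_even\<close> is the function \<open>s\<close> of the overview and
  \<open>gap_odd\<close> the function \<open>f\<close>.\<close>

definition gap_even :: "real \<Rightarrow> real" where "gap_even y = c - \<phi> y - \<phi> (- y)"

definition gap_odd :: "real \<Rightarrow> real" where "gap_odd y = \<phi> y - \<phi> (- y)"

lemma gap_measurable [measurable]:
  "gap_even \<in> borel_measurable borel" "gap_odd \<in> borel_measurable borel"
  unfolding gap_even_def[abs_def] gap_odd_def[abs_def] by measurable

lemma gap_bounded: "\<bar>gap_even y\<bar> \<le> c + 2 * bound" "\<bar>gap_odd y\<bar> \<le> 2 * bound"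
  using abs_le_bound[of y] abs_le_bound[of "- y"] c_gt_1 by (auto simp: gap_even_def gap_odd_def)

lemma gap_even_minus: "gap_even (- y) = gap_even y"
  by (simp add: gap_even_def)

lemma gap_odd_minus: "gap_odd (- y) = - gap_odd y"
  by (simp add: gap_odd_def)

lemma gap_even_pos: "y > 0 \<Longrightarrow> gap_even y > 0"
  using sum_less[of y] by (simp add: gap_even_def)

lemma gap_odd_pos: "y > 0 \<Longrightarrow> gap_odd y > 0"
  using asym[of y] by (simp add: gap_odd_def)

lemma gap_even_0: "gap_even 0 = 0"
  by (simp add: gap_even_def crest)

lemma gap_even_nonneg: "gap_even y \<ge> 0"
  using gap_even_pos[of y] gap_even_pos[of "- y"] gap_even_minus[of y] gap_even_0
  by (cases y "0 :: real" rule: linorder_cases) auto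

lemma wconv_gap_odd: "wconv gap_odd t = gap_odd t * gap_even t"
  using wconv_reflection_diff[of 0 t] wconv_uminus[of gap_odd t]
  by (simp add: gap_odd_def[abs_def] gap_even_def algebra_simps)

text \<open>Completing the square, \<open>\<phi> * (c - \<phi>) = c\<^sup>2 / 4 - (\<phi> - c /
  2)\<^sup>2\<close>, so the crest condition makes the squares vanish at 0. With p and q the
  deviations of \<phi> from \<open>c / 2\<close> at t and -t, the rest is \<open>(p + q)\<^sup>2 +
  (p - q)\<^sup>2 = 2 * (p\<^sup>2 + q\<^sup>2)\<close>.\<close>

lemma wconv_gap_even: "2 * (wconv gap_even t - wconv gap_even 0) = (gap_even t)\<^sup>2 + (gap_odd t)\<^sup>2"
proof -
  have w: "wconv gap_even x = c - \<phi> x * (c - \<phi> x) - \<phi> (- x) * (c - \<phi> (- x))" for x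
  proof -
    have b1: "\<bar>c - \<phi> y\<bar> \<le> c + bound" for y using abs_le_bound[of y] c_gt_1 by linarith
    have b2: "\<bar>c\<bar> \<le> c" using c_gt_1 by simp
    have "wconv gap_even x = wconv (\<lambda>y. (c - \<phi> y) - \<phi> (- y)) x" by (simp add: gap_even_def[abs_def])
    also have "\<dots> = wconv (\<lambda>y. c - \<phi> y) x - wconv (\<lambda>y. \<phi> (- y)) x"
      by (rule wconv_diff[OF _ b1 _ abs_le_bound]) auto
    also have "wconv (\<lambda>y. c - \<phi> y) x = wconv (\<lambda>y. c) x - wconv \<phi> x"
      by (rule wconv_diff[OF _ b2 _ abs_le_bound]) auto
    also have "wconv (\<lambda>y. \<phi> (- y)) x = wconv \<phi> (- x)"
      using wconv_reflect[of \<phi> 0 x] by simp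
    finally show ?thesis by (simp add: wconv_const equation[symmetric])
  qed
  show ?thesis
    unfolding w gap_even_def gap_odd_def crest minus_zero
    by (simp add: power2_eq_square algebra_simps)
qed

text \<open>
  The best constant \<open>b\<close> in \<open>gap_even y \<le> b (sqrt \<bar>y\<bar> + e)\<close>, finite thanks to \<open>e > 0\<close>, satisfies
  \<open>b\<^sup>2 \<le> b A\<close>.
\<close>

lemma gap_upper:
  assumes t: "t > 0"
  shows "(gap_even t)\<^sup>2 + (gap_odd t)\<^sup>2 \<le> cusp_constant\<^sup>2 * t"
proof -
  define A where "A = cusp_constant"
  have A: "A \<ge> 0" by (simp add: A_def cusp_constant_nonneg)
  have eps: "(gap_even t)\<^sup>2 + (gap_odd t)\<^sup>2 \<le> A\<^sup>2 * (sqrt t + e)\<^sup>2" if e: "e > 0" for e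
  proof -
    define r where "r = (\<lambda>y. gap_even y / (sqrt \<bar>y\<bar> + e))"
    define b where "b = (SUP y. r y)"
    have pos: "sqrt \<bar>y\<bar> + e > 0" for y using e by (simp add: add_nonneg_pos)
    have "r y \<le> (c + 2 * bound) / e" for y
      unfolding r_def using e gap_bounded(1)[of y] gap_even_nonneg[of y] by (intro frac_le) auto
    then have bdd: "bdd_above (range r)" by (intro bdd_aboveI2) auto
    have r_le: "r y \<le> b" for y unfolding b_def by (rule cSUP_upper[OF _ bdd]) simp
    have le: "gap_even y \<le> b * (sqrt \<bar>y\<bar> + e)" for y
      using r_le[of y] pos[of y] by (simp add: r_def pos_divide_le_eq)
    have b0: "b \<ge> 0" using r_le[of 0] by (simp add: r_def gap_even_0)
    have main: "(gap_even x)\<^sup>2 + (gap_odd x)\<^sup>2 \<le> b * A * (sqrt x + e)\<^sup>2" if "x > 0" for x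
      using wconv_even_difference_le[of gap_even "c + 2 * bound" x e b] wconv_gap_even[of x]
        gap_bounded gap_even_nonneg gap_even_minus that e b0 le by (simp add: A_def)
    have "r y \<le> sqrt (b * A)" for y
    proof (cases "y = 0")
      case True
      then show ?thesis using b0 A by (simp add: r_def gap_even_0)
    next
      case False
      have eq: "gap_even \<bar>y\<bar> = gap_even y" using gap_even_minus[of y] by (simp add: abs_if)
      have "(gap_even \<bar>y\<bar>)\<^sup>2 + (gap_odd \<bar>y\<bar>)\<^sup>2 \<le> b * A * (sqrt \<bar>y\<bar> + e)\<^sup>2"
        by (rule main) (use False in simp)
      then have "(gap_even y)\<^sup>2 \<le> b * A * (sqrt \<bar>y\<bar> + e)\<^sup>2"
        unfolding eq using zero_le_power2[of "gap_odd \<bar>y\<bar>"] by linarith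
      then have "(r y)\<^sup>2 \<le> b * A"
        using pos[of y] by (simp add: r_def power_divide pos_divide_le_eq)
      then show ?thesis by (rule real_le_rsqrt)
    qed
    then have "b \<le> sqrt (b * A)" unfolding b_def by (intro cSUP_least) auto
    then have "b\<^sup>2 \<le> b * A" using b0 A power_mono[of b "sqrt (b * A)" 2] by simp
    then have "b \<le> A" using b0 A by (cases "b = 0") (auto simp: power2_eq_square)
    then have "b * A * (sqrt t + e)\<^sup>2 \<le> A * A * (sqrt t + e)\<^sup>2"
      using A by (intro mult_right_mono) auto
    with main[OF t] show ?thesis by (simp add: power2_eq_square)
  qed
  have "(\<lambda>n. A\<^sup>2 * (sqrt t + 1 / real (Suc n))\<^sup>2) \<longlonglongrightarrow> A\<^sup>2 * (sqrt t + 0)\<^sup>2"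
    by (intro tendsto_intros LIMSEQ_Suc[OF lim_1_over_n])
  moreover have "\<exists>N. \<forall>n\<ge>N. (gap_even t)\<^sup>2 + (gap_odd t)\<^sup>2 \<le> A\<^sup>2 * (sqrt t + 1 / real (Suc n))\<^sup>2"
    using eps by simp
  ultimately have "(gap_even t)\<^sup>2 + (gap_odd t)\<^sup>2 \<le> A\<^sup>2 * (sqrt t + 0)\<^sup>2" by (rule LIMSEQ_le_const)
  then show ?thesis using t by (simp add: A_def)
qed

lemma gap_product_le:
  assumes "t > 0"
  shows "2 * wconv gap_odd t \<le> cusp_constant\<^sup>2 * t"
proof -
  have "0 \<le> (gap_even t - gap_odd t)\<^sup>2" by simp
  then have "2 * (gap_odd t * gap_even t) \<le> (gap_even t)\<^sup>2 + (gap_odd t)\<^sup>2"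
    by (simp add: power2_diff mult_ac)
  then show ?thesis using gap_upper[OF assms] by (simp add: wconv_gap_odd)
qed

text \<open>The interval [1, 2] lies right of every \<open>t < 1\<close>, and \<open>gap_odd\<close>
  has a positive minimum on it; this part of the integral alone bounds
  \<open>wconv gap_odd t\<close> below by a multiple of \<open>t\<close>. Dividing by
  \<open>gap_even t\<close>, at most a multiple of \<open>sqrt t\<close>, leaves
  \<open>sqrt t\<close>.\<close>

lemma gap_odd_lower: "\<exists>d>0. \<forall>t\<in>{0<..<1}. d * sqrt t \<le> gap_odd t"
proof -
  have cont: "continuous_on {1..2} gap_odd"
    unfolding gap_odd_def[abs_def]
    by (intro continuous_intros continuous_on_compose2[OF continuous] continuous_on_subset[OF continuous]) auto
  obtain z where z: "z \<in> {1..2}" "\<And>y. y \<in> {1..2} \<Longrightarrow> gap_odd z \<le> gap_odd y"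
    using continuous_attains_inf[of "{1..2::real}" gap_odd] cont by auto
  define \<mu> where "\<mu> = gap_odd z"
  have \<mu>: "\<mu> > 0" unfolding \<mu>_def using z by (intro gap_odd_pos) auto
  define \<delta> where "\<delta> = wkernel_slope 2 * \<mu>"
  have \<delta>: "\<delta> > 0" using \<mu> wkernel_slope_pos[of 2] by (simp add: \<delta>_def)
  \<comment> \<open>The summand 1 makes the later divisor positive; \<open>cusp_constant\<close> is
    only known to be nonnegative.\<close>
  define A where "A = cusp_constant + 1"
  have A: "A > 0" "cusp_constant \<le> A" using cusp_constant_nonneg by (auto simp: A_def)
  have "\<delta> / A * sqrt t \<le> gap_odd t" if t: "t \<in> {0<..<1}" for t
  proof -
    have "ennreal (2 * t * \<delta>) = (\<integral>\<^sup>+y. ennreal (2 * t * \<delta>) * indicator {1..2::real} y \<partial>lborel)"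
      by (subst nn_integral_cmult_indicator) auto
    also have "\<dots> \<le> (\<integral>\<^sup>+y. ennreal (indicator {t<..} y * (2 * t * wkernel_slope y * gap_odd y)) \<partial>lborel)"
    proof (rule nn_integral_mono)
      fix y :: real
      show "ennreal (2 * t * \<delta>) * indicator {1..2::real} y \<le> ennreal (indicator {t<..} y * (2 * t * wkernel_slope y * gap_odd y))"
      proof (cases "y \<in> {1..2}")
        case True
        have "wkernel_slope 2 * \<mu> \<le> wkernel_slope y * gap_odd y"
          using True z(2)[OF True] \<mu> wkernel_slope_pos[of y]
          by (intro mult_mono wkernel_slope_antimono) (auto simp: \<mu>_def)
        then have "2 * t * \<delta> \<le> 2 * t * (wkernel_slope y * gap_odd y)"
          unfolding \<delta>_def using t by (intro mult_left_mono) auto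
        then show ?thesis using True t by (simp add: ennreal_leI mult.assoc)
      qed simp
    qed
    also have "\<dots> \<le> ennreal (2 * wconv gap_odd t)"
      using t gap_odd_pos less_imp_le gap_odd_minus gap_bounded(2)
      by (intro wconv_odd_ge[where B = "2 * bound"]) (auto simp: less_imp_le)
    finally have "t * \<delta> \<le> gap_odd t * gap_even t"
      using t gap_odd_pos[of t] gap_even_pos[of t]
      by (subst (asm) ennreal_le_iff) (auto simp: wconv_gap_odd)
    also have "\<dots> \<le> gap_odd t * (A * sqrt t)"
    proof (rule mult_left_mono)
      have "(gap_even t)\<^sup>2 + (gap_odd t)\<^sup>2 \<le> cusp_constant\<^sup>2 * t"
        by (rule gap_upper) (use t in simp)
      then have "(gap_even t)\<^sup>2 \<le> cusp_constant\<^sup>2 * t"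
        using zero_le_power2[of "gap_odd t"] by linarith
      also have "\<dots> \<le> A\<^sup>2 * t"
        using t A cusp_constant_nonneg by (intro mult_right_mono power_mono) auto
      also have "\<dots> = (A * sqrt t)\<^sup>2" using t by (simp add: power_mult_distrib)
      finally show "gap_even t \<le> A * sqrt t" by (rule power2_le_imp_le) (use A t in auto)
    qed (use t gap_odd_pos[of t] in auto)
    also have "\<dots> = sqrt t * (A * gap_odd t)" by simp
    finally have "t * \<delta> \<le> sqrt t * (A * gap_odd t)" .
    moreover have "sqrt t * (\<delta> * sqrt t) = t * \<delta>"
    proof -
      have "sqrt t * (\<delta> * sqrt t) = (sqrt t * sqrt t) * \<delta>" by (simp only: mult_ac)
      then show ?thesis using t by simp
    qed
    ultimately have "sqrt t * (\<delta> * sqrt t) \<le> sqrt t * (A * gap_odd t)" by (simp only:)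
    then have "\<delta> * sqrt t \<le> A * gap_odd t" using t by simp
    then show ?thesis using A by (simp add: pos_divide_le_eq mult.commute)
  qed
  then show ?thesis using \<delta> A by (intro exI[of _ "\<delta> / A"]) auto
qed

text \<open>Inserting \<open>gap_odd y \<ge> d * sqrt y\<close> into \<open>wconv_odd_ge\<close>
  produces a factor \<open>t\<close> on both sides. After cancelling it, the integrals of
  \<open>wkernel_slope y * sqrt y\<close> over (t, 1) are bounded uniformly in \<open>t\<close>, and
  monotone convergence contradicts their divergence.\<close>

lemma crest_contradiction: False
proof -
  obtain d where d: "d > 0" "\<And>t. t \<in> {0<..<1} \<Longrightarrow> d * sqrt t \<le> gap_odd t"
    using gap_odd_lower by blast
  \<comment> \<open>Chosen so that \<open>2 * t * d * D\<close> is the upper bound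
    \<open>cusp_constant\<^sup>2 * t\<close> of \<open>gap_product_le\<close>.\<close>
  define D where "D = cusp_constant\<^sup>2 / (2 * d)"
  define F where "F = (\<lambda>n y. ennreal (indicator {1 / real (n + 2)<..<1} y * (wkernel_slope y * sqrt y)))"
  have [measurable]: "F n \<in> borel_measurable borel" for n unfolding F_def by measurable
  have bnd: "(\<integral>\<^sup>+y. F n y \<partial>lborel) \<le> ennreal D" for n
  proof -
    define t where "t = 1 / real (n + 2)"
    have t: "0 < t" "t < 1" by (auto simp: t_def)
    have F: "F n y = ennreal (indicator {t<..<1} y * (wkernel_slope y * sqrt y))" for y
      by (simp only: F_def t_def)
    have "ennreal (2 * t * d) * (\<integral>\<^sup>+y. F n y \<partial>lborel) = (\<integral>\<^sup>+y. ennreal (2 * t * d) * F n y \<partial>lborel)"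
      by (rule nn_integral_cmult[symmetric]) measurable
    also have "\<dots> \<le> (\<integral>\<^sup>+y. ennreal (indicator {t<..} y * (2 * t * wkernel_slope y * gap_odd y)) \<partial>lborel)"
    proof (rule nn_integral_mono)
      fix y :: real
      show "ennreal (2 * t * d) * F n y \<le> ennreal (indicator {t<..} y * (2 * t * wkernel_slope y * gap_odd y))"
      proof (cases "y \<in> {t<..<1}")
        case True
        have "2 * t * wkernel_slope y * (d * sqrt y) \<le> 2 * t * wkernel_slope y * gap_odd y"
          using True t d(2)[of y] wkernel_slope_pos[of y] by (intro mult_left_mono) auto
        moreover have "ennreal (2 * t * d) * F n y = ennreal (2 * t * wkernel_slope y * (d * sqrt y))"
          using True t d(1) wkernel_slope_pos[of y]
          by (simp add: F ennreal_mult[symmetric] mult_ac)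
        ultimately show ?thesis using True by (simp add: ennreal_leI)
      qed (simp add: F)
    qed
    also have "\<dots> \<le> ennreal (2 * wconv gap_odd t)"
      using t gap_odd_pos gap_odd_minus gap_bounded(2)
      by (intro wconv_odd_ge[where B = "2 * bound"]) (auto simp: less_imp_le)
    also have "\<dots> \<le> ennreal (cusp_constant\<^sup>2 * t)"
      using gap_product_le[OF t(1)] by (rule ennreal_leI)
    also have "\<dots> = ennreal (2 * t * d) * ennreal D"
      using t d by (simp add: D_def ennreal_mult[symmetric])
    finally show ?thesis
      using t d by (subst (asm) ennreal_mult_le_mult_iff) (auto simp: ennreal_mult_eq_top_iff)
  qed
  have inc: "incseq F"
  proof (intro incseq_SucI le_funI)
    fix n y
    have "1 / real (Suc n + 2) \<le> 1 / real (n + 2)" by (intro divide_left_mono) auto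
    show "F n y \<le> F (Suc n) y"
    proof (cases "y > 0")
      case True
      have "indicator {1 / real (n + 2)<..<1} y \<le> (indicator {1 / real (Suc n + 2)<..<1} y :: real)"
        using \<open>1 / real (Suc n + 2) \<le> 1 / real (n + 2)\<close> by (simp add: indicator_def del: of_nat_add of_nat_Suc add_Suc)
      then show ?thesis
        unfolding F_def using True wkernel_slope_pos[of y] by (intro ennreal_leI mult_right_mono) auto
    next
      case False
      have "a > 0 \<Longrightarrow> indicator {a<..<1} y = (0::real)" for a :: real
        using False by (simp add: indicator_def)
      from this[of "1 / real (n + 2)"] have "F n y = 0" by (simp add: F_def)
      then show ?thesis by simp
    qed
  qed
  have "ennreal (indicator {0<..<1} y * (wkernel_slope y * sqrt y)) \<le> (SUP n. F n y)" for y
  proof (cases "y \<in> {0<..<1}")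
    case True
    then obtain n where n: "1 / real (Suc n) < y" using nat_approx_posE[of y] by auto
    have "1 / real (n + 2) \<le> 1 / real (Suc n)" by (intro divide_left_mono) auto
    then have "ennreal (indicator {0<..<1} y * (wkernel_slope y * sqrt y)) = F n y"
      using True n by (simp add: F_def)
    also have "\<dots> \<le> (SUP n. F n y)" by (rule SUP_upper) (rule UNIV_I)
    finally show ?thesis .
  qed simp
  then have "(\<integral>\<^sup>+y. ennreal (indicator {0<..<1} y * (wkernel_slope y * sqrt y)) \<partial>lborel) \<le> (\<integral>\<^sup>+y. (SUP n. F n y) \<partial>lborel)"
    by (intro nn_integral_mono)
  also have "\<dots> = (SUP n. \<integral>\<^sup>+y. F n y \<partial>lborel)"
    using inc by (intro nn_integral_monotone_convergence_SUP) auto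
  also have "\<dots> \<le> ennreal D" using bnd by (intro SUP_least)
  finally show False unfolding wkernel_slope_sqrt_nn_integral by (simp add: top_unique)
qed

end

end

section \<open>Moving the plane\<close>

context solitary_wave
begin

definition ordered_at :: "real \<Rightarrow> bool" where
  "ordered_at l \<longleftrightarrow> (\<forall>x>l. \<phi> (2 * l - x) \<le> \<phi> x)"

text \<open>Two values of \<phi> below \<open>(c - 1) / 2\<close> make
  \<open>c - \<phi> x - \<phi> (2 * l - x)\<close> larger than 1, more than the kernel mass allows
  in the maximum principle.\<close>

lemma small_at_minus_infinity: "\<exists>N>0. \<forall>y\<le>-N. \<phi> y < (c - 1) / 2"
proof -
  have "\<forall>\<^sub>F x in at_infinity. \<phi> x < (c - 1) / 2"
    using vanishing c_gt_1 by (intro order_tendstoD(2)) auto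
  then obtain R where R: "\<And>x. \<bar>x\<bar> \<ge> R \<Longrightarrow> \<phi> x < (c - 1) / 2"
    by (auto simp: eventually_at_infinity)
  then show ?thesis by (intro exI[of _ "max R 1"]) auto
qed

text \<open>The larger value sits at the mirror image, which therefore cannot lie left of
  \<open>- N\<close>. This starts the plane, and since it also gives \<open>x < 2 * l + N\<close>,
  it supplies the compactness when planes converge.\<close>

lemma not_ordered_max_point:
  assumes N: "\<And>y. y \<le> - N \<Longrightarrow> \<phi> y < (c - 1) / 2" and "\<not> ordered_at l"
  shows "\<exists>x>l. \<phi> x < \<phi> (2 * l - x) \<and> c - \<phi> x - \<phi> (2 * l - x) \<le> wkernel_odd_mass (x - l) \<and> - N < 2 * l - x"
proof -
  obtain x0 where "x0 > l" "\<phi> x0 < \<phi> (2 * l - x0)"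
    using assms(2) by (auto simp: ordered_at_def not_le)
  then obtain x where x: "x > l" "\<phi> x < \<phi> (2 * l - x)" "c - \<phi> x - \<phi> (2 * l - x) \<le> wkernel_odd_mass (x - l)"
    using reflection_max_principle by blast
  have "- N < 2 * l - x"
  proof (rule ccontr)
    assume "\<not> - N < 2 * l - x"
    then have "\<phi> (2 * l - x) < (c - 1) / 2" by (intro N) simp
    then have "2 * \<phi> (2 * l - x) < c - 1" by simp
    moreover have "c - \<phi> x - \<phi> (2 * l - x) \<le> 1"
      using x(3) wkernel_odd_mass_le_1 by (rule order_trans)
    ultimately show False using x(2) by simp
  qed
  with x show ?thesis by blast
qed

lemma ordered_far_left: "\<exists>N>0. \<forall>l\<le>-N. ordered_at l"
proof -
  obtain N where N: "N > 0" "\<And>y. y \<le> - N \<Longrightarrow> \<phi> y < (c - 1) / 2"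
    using small_at_minus_infinity by blast
  have "ordered_at l" if "l \<le> - N" for l
  proof (rule ccontr)
    assume "\<not> ordered_at l"
    then obtain x where "x > l" "- N < 2 * l - x" using not_ordered_max_point[OF N(2)] by blast
    with that show False by simp
  qed
  with N(1) show ?thesis by blast
qed

text \<open>For \<open>l > 0\<close> the mirror image of \<open>2 * l\<close> is 0, and for large
  \<open>l\<close> the value at \<open>2 * l\<close> has dropped below
  \<open>\<phi> 0\<close>.\<close>

lemma ordered_at_bounded: "\<exists>L. \<forall>l. ordered_at l \<longrightarrow> l \<le> L"
proof -
  have "\<forall>\<^sub>F x in at_infinity. \<phi> x < \<phi> 0"
    using vanishing positive[of 0] by (rule order_tendstoD(2))
  then obtain R where R: "\<And>x. \<bar>x\<bar> \<ge> R \<Longrightarrow> \<phi> x < \<phi> 0"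
    by (auto simp: eventually_at_infinity)
  have "l \<le> max R 0" if "ordered_at l" for l
  proof (rule ccontr)
    assume "\<not> l \<le> max R 0"
    then have l: "l > 0" "l > R" by auto
    then have "\<phi> (2 * l - 2 * l) \<le> \<phi> (2 * l)"
      using that unfolding ordered_at_def by (metis less_add_same_cancel1 mult_2)
    moreover have "\<phi> (2 * l) < \<phi> 0" using l by (intro R) auto
    ultimately show False by simp
  qed
  then show ?thesis by blast
qed

lemma isCont: "isCont \<phi> x"
  using continuous by (simp add: continuous_on_eq_continuous_at)

text \<open>Maximum points for unordered planes shrinking to \<open>l0\<close> accumulate at some
  \<open>z\<close> with \<open>\<phi> z \<le> \<phi> (2 * l0 - z)\<close>. If \<phi> is not
  symmetric about \<open>l0\<close>, strictness forces \<open>z = l0\<close>; the distances to the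
  planes then tend to 0, the kernel mass with them, and \<open>c \<le> 2 * \<phi> l0\<close>
  follows. With \<open>touching\<close> this is equality, the degenerate case.\<close>

lemma symmetric_at_maximal:
  assumes ordered: "ordered_at l0" and maximal: "\<And>\<epsilon>. \<epsilon> > 0 \<Longrightarrow> \<exists>l. l0 < l \<and> l < l0 + \<epsilon> \<and> \<not> ordered_at l"
    and x: "x > l0"
  shows "\<phi> x = \<phi> (2 * l0 - x)"
proof (rule ccontr)
  assume "\<phi> x \<noteq> \<phi> (2 * l0 - x)"
  with ordered x have touch: "\<phi> (2 * l0 - y) < \<phi> y" "\<phi> y + \<phi> (2 * l0 - y) < c" if "y > l0" for y
    using touching[of l0 x y] that by (auto simp: ordered_at_def)
  obtain N where N: "N > 0" "\<And>y. y \<le> - N \<Longrightarrow> \<phi> y < (c - 1) / 2"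
    using small_at_minus_infinity by blast
  have "\<forall>n::nat. \<exists>l. l0 < l \<and> l < l0 + 1 / real (Suc n) \<and> \<not> ordered_at l"
    using maximal by simp
  then obtain L where L: "\<And>n. l0 < L n" "\<And>n. L n < l0 + 1 / real (Suc n)" "\<And>n. \<not> ordered_at (L n)"
    by metis
  have "\<forall>n. \<exists>x>L n. \<phi> x < \<phi> (2 * L n - x) \<and> c - \<phi> x - \<phi> (2 * L n - x) \<le> wkernel_odd_mass (x - L n) \<and> - N < 2 * L n - x"
    using not_ordered_max_point[OF N(2) L(3)] by blast
  then obtain X where X: "\<And>n. X n > L n" "\<And>n. \<phi> (X n) < \<phi> (2 * L n - X n)"
      "\<And>n. c - \<phi> (X n) - \<phi> (2 * L n - X n) \<le> wkernel_odd_mass (X n - L n)" "\<And>n. - N < 2 * L n - X n"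
    by metis
  have L1: "L n < l0 + 1" for n
  proof -
    have "1 / real (Suc n) \<le> 1" by simp
    then show ?thesis using L(2)[of n] by linarith
  qed
  have "X n \<in> {l0..2 * (l0 + 1) + N}" for n
    using X(1)[of n] X(4)[of n] L(1)[of n] L1[of n] by auto
  then obtain z r where r: "strict_mono r" "(X \<circ> r) \<longlonglongrightarrow> z" "z \<in> {l0..2 * (l0 + 1) + N}"
    using compact_Icc[of l0 "2 * (l0 + 1) + N"] unfolding compact_def by metis
  have Llim: "L \<longlonglongrightarrow> l0"
  proof (rule tendsto_sandwich)
    show "\<forall>\<^sub>F n in sequentially. l0 \<le> L n" "\<forall>\<^sub>F n in sequentially. L n \<le> l0 + 1 / real (Suc n)"
      using L by (auto intro!: always_eventually less_imp_le)
    show "(\<lambda>n. l0 + 1 / real (Suc n)) \<longlonglongrightarrow> l0" by real_asymp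
  qed auto
  have Lr: "(\<lambda>n. L (r n)) \<longlonglongrightarrow> l0" using LIMSEQ_subseq_LIMSEQ[OF Llim r(1)] by (simp add: o_def)
  have Xr: "(\<lambda>n. X (r n)) \<longlonglongrightarrow> z" using r(2) by (simp add: o_def)
  have p1: "(\<lambda>n. \<phi> (X (r n))) \<longlonglongrightarrow> \<phi> z" by (rule isCont_tendsto_compose[OF isCont Xr])
  have p2: "(\<lambda>n. \<phi> (2 * L (r n) - X (r n))) \<longlonglongrightarrow> \<phi> (2 * l0 - z)"
    by (rule isCont_tendsto_compose[OF isCont]) (intro tendsto_intros Lr Xr)
  have "\<phi> z \<le> \<phi> (2 * l0 - z)"
    using X(2) by (intro LIMSEQ_le[OF p1 p2]) (auto intro: less_imp_le)
  then have z: "z = l0" using touch(1)[of z] r(3) by (cases "z > l0") auto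
  have "(\<lambda>n. X (r n) - L (r n)) \<longlonglongrightarrow> l0 - l0" using Xr Lr unfolding z by (rule tendsto_diff)
  then have m: "(\<lambda>n. wkernel_odd_mass (X (r n) - L (r n))) \<longlonglongrightarrow> 0"
    by (intro wkernel_odd_mass_tendsto_0) simp
  have "(\<lambda>n. c - \<phi> (X (r n)) - \<phi> (2 * L (r n) - X (r n))) \<longlonglongrightarrow> c - \<phi> z - \<phi> (2 * l0 - z)"
    by (intro tendsto_intros p1 p2)
  then have "c - \<phi> z - \<phi> (2 * l0 - z) \<le> 0"
    by (rule LIMSEQ_le[OF _ m]) (use X(3) in auto)
  then have ge: "c \<le> 2 * \<phi> l0" by (simp add: z)
  have s: "(\<lambda>n. l0 + 1 / real (Suc n)) \<longlonglongrightarrow> l0" by real_asymp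
  have s': "(\<lambda>n. 2 * l0 - (l0 + 1 / real (Suc n))) \<longlonglongrightarrow> l0" by real_asymp
  have "(\<lambda>n. \<phi> (l0 + 1 / real (Suc n)) + \<phi> (2 * l0 - (l0 + 1 / real (Suc n)))) \<longlonglongrightarrow> \<phi> l0 + \<phi> l0"
    by (intro tendsto_add isCont_tendsto_compose[OF isCont] s s')
  then have "\<phi> l0 + \<phi> l0 \<le> c"
  proof (rule LIMSEQ_le_const2)
    have "\<phi> (l0 + 1 / real (Suc n)) + \<phi> (2 * l0 - (l0 + 1 / real (Suc n))) \<le> c" for n
      by (rule less_imp_le, rule touch(2)) simp
    then show "\<exists>N. \<forall>n\<ge>N. \<phi> (l0 + 1 / real (Suc n)) + \<phi> (2 * l0 - (l0 + 1 / real (Suc n))) \<le> c" by blast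
  qed
  with ge have crest: "\<phi> l0 = c / 2" by simp
  \<comment> \<open>The equation is translation invariant, so the crest may be moved to 0.\<close>
  interpret shifted: solitary_wave c "\<lambda>y. \<phi> (l0 + y)"
  proof
    show "c > 1" by (rule c_gt_1)
    show "continuous_on UNIV (\<lambda>y. \<phi> (l0 + y))"
      by (intro continuous_on_compose2[OF continuous] continuous_intros) auto
    show "Elementary_Metric_Spaces.bounded (range (\<lambda>y. \<phi> (l0 + y)))"
      using bounded by (rule bounded_subset) auto
    show "\<phi> (l0 + x) * (c - \<phi> (l0 + x)) = wconv (\<lambda>y. \<phi> (l0 + y)) x" for x
      by (simp add: wconv_shift equation)
    show "((\<lambda>y. \<phi> (l0 + y)) \<longlongrightarrow> 0) at_infinity"
      using tendsto_at_infinity_reflect[OF tendsto_at_infinity_reflect[OF vanishing, of 0], of "- l0"]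
      by (simp add: add.commute)
    show "\<exists>x. \<phi> (l0 + x) \<noteq> 0" using positive[of "l0 + 0"] by (intro exI[of _ 0]) simp
  qed
  show False
  proof (rule shifted.crest_contradiction)
    show "\<phi> (l0 + 0) = c / 2" using crest by simp
    show "\<phi> (l0 + - t) < \<phi> (l0 + t)" if "t > 0" for t
      using touch(1)[of "l0 + t"] that by simp
    show "\<phi> (l0 + t) + \<phi> (l0 + - t) < c" if "t > 0" for t
      using touch(2)[of "l0 + t"] that by simp
  qed
qed

text \<open>The supremum runs over initial segments, since the ordered positions are not known in
  advance to form an interval.\<close>

definition symmetry_axis :: real where
  "symmetry_axis = Sup {l. \<forall>l'\<le>l. ordered_at l'}"

text \<open>The supremum exists by \<open>ordered_far_left\<close> and
  \<open>ordered_at_bounded\<close>. It is attained because, by continuity of \<phi>, the ordering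
  passes to limits of planes.\<close>

lemma ordered_upto_axis_iff: "(\<forall>l'\<le>l. ordered_at l') \<longleftrightarrow> l \<le> symmetry_axis"
  and ordered_below_axis: "l \<le> symmetry_axis \<Longrightarrow> ordered_at l"
proof -
  define \<Lambda> where "\<Lambda> = {l. \<forall>l'\<le>l. ordered_at l'}"
  obtain N where N: "N > 0" "\<And>l. l \<le> - N \<Longrightarrow> ordered_at l" using ordered_far_left by blast
  have ne: "\<Lambda> \<noteq> {}" using N(2) unfolding \<Lambda>_def by blast
  obtain L where L: "\<And>l. ordered_at l \<Longrightarrow> l \<le> L" using ordered_at_bounded by blast
  have bdd: "bdd_above \<Lambda>"
  proof (rule bdd_aboveI[of _ L])
    fix l assume "l \<in> \<Lambda>"
    then have "ordered_at l" unfolding \<Lambda>_def by blast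
    then show "l \<le> L" by (rule L)
  qed
  have less: "ordered_at l" if "l < symmetry_axis" for l
  proof -
    have "l < Sup \<Lambda>" using that by (simp only: symmetry_axis_def \<Lambda>_def)
    then obtain l' where l': "l' \<in> \<Lambda>" "l < l'" by (rule less_cSupE[OF _ ne])
    from l'(1) have "\<forall>k\<le>l'. ordered_at k" unfolding \<Lambda>_def by (rule CollectD)
    then show ?thesis using l'(2) by simp
  qed
  have at: "ordered_at symmetry_axis"
    unfolding ordered_at_def
  proof (intro allI impI)
    fix x assume x: "x > symmetry_axis"
    have "(\<lambda>n. 2 * (a - 1 / real (Suc n)) - x) \<longlonglongrightarrow> 2 * a - x" for a :: real by real_asymp
    note s = this[of symmetry_axis]
    have "\<phi> (2 * (symmetry_axis - 1 / real (Suc n)) - x) \<le> \<phi> x" for n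
    proof -
      have "ordered_at (symmetry_axis - 1 / real (Suc n))" by (rule less) simp
      moreover have "symmetry_axis - 1 / real (Suc n) < x"
      proof -
        have "0 < 1 / real (Suc n)" by simp
        then show ?thesis using x by linarith
      qed
      ultimately show ?thesis unfolding ordered_at_def by blast
    qed
    then show "\<phi> (2 * symmetry_axis - x) \<le> \<phi> x"
      by (intro LIMSEQ_le_const2[OF isCont_tendsto_compose[OF isCont s]]) blast
  qed
  show le: "l \<le> symmetry_axis \<Longrightarrow> ordered_at l" for l
    using less at by (cases "l = symmetry_axis") auto
  show "(\<forall>l'\<le>l. ordered_at l') \<longleftrightarrow> l \<le> symmetry_axis" for l
  proof
    assume "\<forall>l'\<le>l. ordered_at l'"
    then have "l \<in> \<Lambda>" by (simp add: \<Lambda>_def)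
    then have "l \<le> Sup \<Lambda>" by (rule cSup_upper[OF _ bdd])
    then show "l \<le> symmetry_axis" by (simp only: symmetry_axis_def \<Lambda>_def)
  qed (use le in auto)
qed

lemma symmetric_about_axis: "\<phi> x = \<phi> (2 * symmetry_axis - x)"
proof -
  have right: "\<phi> y = \<phi> (2 * symmetry_axis - y)" if "y > symmetry_axis" for y
  proof (rule symmetric_at_maximal[OF _ _ that])
    show "ordered_at symmetry_axis" by (rule ordered_below_axis) simp
    fix \<epsilon> :: real assume \<epsilon>: "\<epsilon> > 0"
    have "\<not> (\<forall>l'\<le>symmetry_axis + \<epsilon> / 2. ordered_at l')" using \<epsilon> by (simp add: ordered_upto_axis_iff)
    then obtain l where l: "l \<le> symmetry_axis + \<epsilon> / 2" "\<not> ordered_at l" by blast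
    then have "symmetry_axis < l" using ordered_below_axis[of l] by force
    then show "\<exists>l. symmetry_axis < l \<and> l < symmetry_axis + \<epsilon> \<and> \<not> ordered_at l" using l \<epsilon> by (intro exI[of _ l]) auto
  qed
  consider "x > symmetry_axis" | "x = symmetry_axis" | "x < symmetry_axis" by linarith
  then show ?thesis
  proof cases
    case 3
    then show ?thesis using right[of "2 * symmetry_axis - x"] by simp
  qed (use right in auto)
qed

text \<open>A second axis of symmetry would make \<open>\<phi>\<close> periodic.\<close>

lemma not_symmetric_below_axis:
  assumes "l < symmetry_axis"
  shows "\<exists>x>l. \<phi> x \<noteq> \<phi> (2 * l - x)"
proof (rule ccontr)
  assume "\<not> (\<exists>x>l. \<phi> x \<noteq> \<phi> (2 * l - x))"
  then have sym: "\<And>x. x > l \<Longrightarrow> \<phi> x = \<phi> (2 * l - x)" by blast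
  define p where "p = 2 * (symmetry_axis - l)"
  have p: "p > 0" using assms by (simp add: p_def)
  have per: "\<phi> (x + p) = \<phi> x" if "x > l" for x
    using sym[OF that] symmetric_about_axis[of "2 * l - x"] by (simp add: p_def algebra_simps)
  have "\<phi> (symmetry_axis + real n * p) = \<phi> symmetry_axis" for n
  proof (induction n)
    case (Suc n)
    have "symmetry_axis + real n * p > l" using assms p by (simp add: add_strict_increasing2 add.commute less_le_trans)
    from per[OF this] Suc show ?case by (simp add: algebra_simps)
  qed simp
  moreover have "(\<lambda>n. \<phi> (symmetry_axis + real n * p)) \<longlonglongrightarrow> 0"
  proof (rule filterlim_compose[OF vanishing])
    have "filterlim (\<lambda>n. a + real n * p) at_top sequentially" for a using p by real_asymp
    then show "filterlim (\<lambda>n. symmetry_axis + real n * p) at_infinity sequentially"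
      by (rule filterlim_mono) (auto simp: at_top_le_at_infinity)
  qed
  ultimately have "\<phi> symmetry_axis = 0" by (simp add: LIMSEQ_const_iff)
  then show False using positive[of symmetry_axis] by simp
qed

text \<open>The mirror images of \<open>x\<close> and \<open>y\<close> in the axis are mirror images
  of each other in the plane at \<open>l\<close>, which lies left of the axis. There the reflection
  inequality is strict, since \<phi> is not symmetric about \<open>l\<close>.\<close>

lemma strictly_decreasing:
  assumes "symmetry_axis \<le> x" "x < y"
  shows "\<phi> y < \<phi> x"
proof -
  define l where "l = 2 * symmetry_axis - (x + y) / 2"
  have l: "l < symmetry_axis" using assms by (simp add: l_def field_simps)
  obtain x0 where x0: "x0 > l" "\<phi> x0 \<noteq> \<phi> (2 * l - x0)" using not_symmetric_below_axis[OF l] by blast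
  have "\<phi> (2 * l - (2 * symmetry_axis - x)) < \<phi> (2 * symmetry_axis - x)"
  proof (rule touching(1)[OF _ x0])
    show "\<phi> (2 * l - y) \<le> \<phi> y" if "y > l" for y
      using ordered_below_axis[of l] l that by (simp add: ordered_at_def)
    show "2 * symmetry_axis - x > l" using assms by (simp add: l_def field_simps)
  qed
  moreover have "2 * l - (2 * symmetry_axis - x) = 2 * symmetry_axis - y" by (simp add: l_def field_simps)
  ultimately show ?thesis using symmetric_about_axis[of x] symmetric_about_axis[of y] by simp
qed

section \<open>Translation into the notions of the theorem\<close>

lemma Sigma_minus_empty_iff: "Sigma_minus \<phi> l = {} \<longleftrightarrow> ordered_at l"
proof -
  have "Sigma_minus \<phi> l = {} \<longleftrightarrow> (\<forall>x. l < x \<longrightarrow> \<not> \<phi> x < \<phi> (2 * l - x))"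
    by (auto simp: Sigma_minus_def Sigma_half_def reflection_def)
  then show ?thesis by (simp add: ordered_at_def not_less)
qed

lemma starting_point_iff: "starting_point \<phi> N \<longleftrightarrow> N > 0 \<and> - N \<le> symmetry_axis"
  using ordered_upto_axis_iff[of "- N"] by (simp add: starting_point_def Sigma_minus_empty_iff)

text \<open>Reachability inspects only the positions from \<open>- N\<close> on; those further left
  are ordered because \<open>- N\<close> does not exceed the axis.\<close>

lemma reachable_eq:
  assumes "- N \<le> symmetry_axis"
  shows "reachable \<phi> (- N) = {- N..symmetry_axis}"
proof -
  have "(\<forall>l'\<in>{- N..l}. ordered_at l') \<longleftrightarrow> l \<le> symmetry_axis" if "- N \<le> l" for l
  proof
    assume *: "\<forall>l'\<in>{- N..l}. ordered_at l'"
    have "ordered_at l'" if "l' \<le> l" for l'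
      using * that ordered_below_axis[of l'] assms by (cases "- N \<le> l'") auto
    then show "l \<le> symmetry_axis" using ordered_upto_axis_iff[of l] by blast
  qed (use ordered_below_axis in auto)
  moreover have "reachable \<phi> (- N) = {l. - N \<le> l \<and> (\<forall>l'\<in>{- N..l}. ordered_at l')}"
    by (simp add: reachable_def Sigma_half_def reflection_def ordered_at_def)
  ultimately show ?thesis by (auto intro!: ordered_below_axis)
qed

end

lemma solitary_waveI:
  assumes "whitham_kernel K" "supercritical_solution K c \<phi>" "(\<phi> \<longlongrightarrow> 0) at_infinity" "\<exists>x. \<phi> x \<noteq> 0"
  shows "solitary_wave c \<phi>"
proof
  have sol: "c > 1" "continuous_on UNIV \<phi>" "bounded (range \<phi>)"
    "\<And>x. - c * \<phi> x + (\<phi> x)\<^sup>2 + Defs.convolution K \<phi> x = 0"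
    using assms(2) by (auto simp: supercritical_solution_def steady_whitham_solution_def)
  then show "c > 1" "continuous_on UNIV \<phi>" "bounded (range \<phi>)" by auto
  show "\<phi> x * (c - \<phi> x) = wconv \<phi> x" for x
    using sol(4)[of x] whitham_convolution_eq[OF assms(1) borel_measurable_continuous_onI[OF sol(2)], of x]
    by (simp add: algebra_simps power2_eq_square)
qed (use assms in auto)

text \<open>That the process stops finally at \<open>l0\<close> is expressed by the reachable set
  being exactly \<open>{- N..l0}\<close>, with the same \<open>l0\<close> for every starting point;
  that it stops only there, by the clause excluding coincidence with the reflection for every
  \<open>l < l0\<close>.\<close>

theorem theorem4p4:
  fixes K \<phi> :: "real \<Rightarrow> real" and c :: real
  assumes kernel: "whitham_kernel K"
    and solution: "supercritical_solution K c \<phi>"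
    and vanishing: "(\<phi> \<longlongrightarrow> 0) at_infinity"
    and nontrivial: "\<exists>x. \<phi> x \<noteq> 0"
  shows "(\<exists>N. starting_point \<phi> N) \<and>
    (\<exists>l0.
      (\<forall>N. starting_point \<phi> N \<longrightarrow> - N \<le> l0 \<and> reachable \<phi> (- N) = {- N..l0}) \<and>
      (\<forall>x \<in> Sigma_half l0. \<phi> x = reflection l0 \<phi> x) \<and>
      (\<forall>l < l0. \<exists>x \<in> Sigma_half l. \<phi> x \<noteq> reflection l \<phi> x) \<and>
      symmetric_about \<phi> l0 \<and>
      strict_antimono_on {l0..} \<phi> \<and>
      decays_exponentially \<phi>)"
proof -
  interpret solitary_wave c \<phi>
    by (rule solitary_waveI[OF kernel solution vanishing nontrivial])
  have "starting_point \<phi> (max 1 (- symmetry_axis))" by (auto simp: starting_point_iff max_def)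
  moreover have "\<forall>N. starting_point \<phi> N \<longrightarrow> - N \<le> symmetry_axis \<and> reachable \<phi> (- N) = {- N..symmetry_axis}"
    by (simp add: starting_point_iff reachable_eq)
  moreover have "\<forall>x \<in> Sigma_half symmetry_axis. \<phi> x = reflection symmetry_axis \<phi> x" "symmetric_about \<phi> symmetry_axis"
    using symmetric_about_axis by (auto simp: reflection_def symmetric_about_def)
  moreover have "\<forall>l < symmetry_axis. \<exists>x \<in> Sigma_half l. \<phi> x \<noteq> reflection l \<phi> x"
    using not_symmetric_below_axis by (auto simp: Sigma_half_def reflection_def)
  moreover have "strict_antimono_on {symmetry_axis..} \<phi>"
    using strictly_decreasing by (auto intro!: monotone_onI)
  ultimately show ?thesis using exponential_decay by blast
qed

end
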